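(* The Banach algebra $A(\overline{\mathbb{D}}^{\mathbb{N}})$ is isometrically isomorphic (as a Banach algebra) to $\mathcal{A}(\mathbb{C}_+)$ and also to $\mathcal{A}_u(B_{c_0})$.
   Context: $\mathbb{D}$ is the open unit disk in $\mathbb{C}$ and $\overline{\mathbb{D}}$ its closure. $A(\overline{\mathbb{D}}^{\mathbb{N}})$ is the space of all functions $f:\overline{\mathbb{D}}^{\mathbb{N}}\to\mathbb{C}$ that are continuous on $\overline{\mathbb{D}}^{\mathbb{N}}$ (endowed with the product topology) and separately holomorphic on $\mathbb{D}^{\mathbb{N}}$ (holomorphic in each coordinate when the others are fixed), with the supremum norm on $\overline{\mathbb{D}}^{\mathbb{N}}$. $\mathbb{C}_+=\{s\in\mathbb{C}:\operatorname{Re} s>0\}$. $\mathcal{A}(\mathbb{C}_+)$ is the set of all Dirichlet series $D(s)=\sum_{n=1}^{\infty}\frac{a_n}{n^s}$ ($a_n\in\mathbb{C}$) which are convergent at every point of $\mathbb{C}_+$ and define a uniformly continuous function on $\mathbb{C}_+$, with the supremum norm $\|D\|_\infty=\sup_{s\in\mathbb{C}_+}|D(s)|$ (such functions are bounded on $\mathbb{C}_+$). $c_0$ is the complex Banach space of complex sequences converging to zero, with the sup norm, and $B_{c_0}$ is its open unit ball. $\mathcal{A}_u(B_{c_0})$ is the space of all functions $f:B_{c_0}\to\mathbb{C}$ which are uniformly continuous and complex Fréchet differentiable on $B_{c_0}$, with norm $\|f\|_{B_{c_0}}=\sup\{|f(x)|:x\in B_{c_0}\}$. All three spaces carry pointwise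 multiplication of functions. *)

theory Defs
  imports "HOL-Analysis.Analysis"
begin

section \<open>Algebras of functions with the supremum norm\<close>

text \<open>
  A function on a set \<open>S\<close> is represented by its extensional representative, so that equality
  in HOL is equality on \<open>S\<close>; all algebra operations are pointwise on \<open>S\<close>.
\<close>

definition fun_add :: "'a set \<Rightarrow> ('a \<Rightarrow> complex) \<Rightarrow> ('a \<Rightarrow> complex) \<Rightarrow> 'a \<Rightarrow> complex" where
  "fun_add S f g = (\<lambda>x\<in>S. f x + g x)"

definition fun_scale :: "'a set \<Rightarrow> complex \<Rightarrow> ('a \<Rightarrow> complex) \<Rightarrow> 'a \<Rightarrow> complex" where
  "fun_scale S c f = (\<lambda>x\<in>S. c * f x)"

definition fun_mult :: "'a set \<Rightarrow> ('a \<Rightarrow> complex) \<Rightarrow> ('a \<Rightarrow> complex) \<Rightarrow> 'a \<Rightarrow> complex" where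
  "fun_mult S f g = (\<lambda>x\<in>S. f x * g x)"

definition sup_norm :: "'a set \<Rightarrow> ('a \<Rightarrow> complex) \<Rightarrow> real" where
  "sup_norm S f = (SUP x\<in>S. norm (f x))"

text \<open>
  The algebra and norm axioms are automatic for pointwise operations on bounded functions.
  Boundedness must be required explicitly, since the real supremum of an unbounded set is an
  unspecified value. The last conjunct is completeness with respect to the supremum norm.
\<close>

definition sup_banach_algebra :: "'a set \<Rightarrow> ('a \<Rightarrow> complex) set \<Rightarrow> bool" where
  "sup_banach_algebra S A \<longleftrightarrow>
     A \<subseteq> extensional S \<and>
     (\<forall>f\<in>A. bounded (f ` S)) \<and>
     (\<lambda>x\<in>S. 1) \<in> A \<and>
     (\<forall>f\<in>A. \<forall>g\<in>A. fun_add S f g \<in> A) \<and>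
     (\<forall>c. \<forall>f\<in>A. fun_scale S c f \<in> A) \<and>
     (\<forall>f\<in>A. \<forall>g\<in>A. fun_mult S f g \<in> A) \<and>
     (\<forall>F. (\<forall>n::nat. F n \<in> A) \<longrightarrow>
          (\<forall>e>0. \<exists>N. \<forall>m\<ge>N. \<forall>n\<ge>N. sup_norm S (\<lambda>x. F m x - F n x) < e) \<longrightarrow>
          (\<exists>f\<in>A. (\<lambda>n. sup_norm S (\<lambda>x. F n x - f x)) \<longlonglongrightarrow> 0))"

definition isometric_algebra_iso ::
    "'a set \<Rightarrow> ('a \<Rightarrow> complex) set \<Rightarrow> 'b set \<Rightarrow> ('b \<Rightarrow> complex) set \<Rightarrow>
     (('a \<Rightarrow> complex) \<Rightarrow> ('b \<Rightarrow> complex)) \<Rightarrow> bool" where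
  "isometric_algebra_iso S A T B \<Phi> \<longleftrightarrow>
     bij_betw \<Phi> A B \<and>
     (\<forall>f\<in>A. \<forall>g\<in>A. \<Phi> (fun_add S f g) = fun_add T (\<Phi> f) (\<Phi> g)) \<and>
     (\<forall>c. \<forall>f\<in>A. \<Phi> (fun_scale S c f) = fun_scale T c (\<Phi> f)) \<and>
     (\<forall>f\<in>A. \<forall>g\<in>A. \<Phi> (fun_mult S f g) = fun_mult T (\<Phi> f) (\<Phi> g)) \<and>
     (\<forall>f\<in>A. sup_norm T (\<Phi> f) = sup_norm S f)"

section \<open>The infinite polydisc algebra\<close>

text \<open>The topology on \<open>nat \<Rightarrow> complex\<close> is the product topology.\<close>

definition closed_polydisc :: "(nat \<Rightarrow> complex) set" where
  "closed_polydisc = (\<Pi>\<^sub>E n\<in>UNIV. cball 0 1)"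

definition open_polydisc :: "(nat \<Rightarrow> complex) set" where
  "open_polydisc = (\<Pi>\<^sub>E n\<in>UNIV. ball 0 1)"

definition polydisc_algebra :: "((nat \<Rightarrow> complex) \<Rightarrow> complex) set" where
  "polydisc_algebra = {f \<in> extensional closed_polydisc.
     continuous_on closed_polydisc f \<and>
     (\<forall>z\<in>open_polydisc. \<forall>n. (\<lambda>w. f (z(n := w))) holomorphic_on ball 0 1)}"

section \<open>Uniformly continuous Dirichlet series\<close>

definition right_half_plane :: "complex set" where
  "right_half_plane = {s. Re s > 0}"

definition dirichlet_algebra :: "(complex \<Rightarrow> complex) set" where
  "dirichlet_algebra = {D \<in> extensional right_half_plane.
     (\<exists>a :: nat \<Rightarrow> complex. \<forall>s\<in>right_half_plane.
        (\<lambda>n. a (Suc n) / of_nat (Suc n) powr s) sums D s) \<and>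
     uniformly_continuous_on right_half_plane D}"

section \<open>The Banach space of complex null sequences\<close>

typedef c0 = "{x :: nat \<Rightarrow> complex. x \<longlonglongrightarrow> 0}"
  morphisms c0_nth Abs_c0
  by (rule exI[of _ "\<lambda>_. 0"]) simp

setup_lifting type_definition_c0

lemma c0_nth_tendsto: "c0_nth x \<longlonglongrightarrow> 0"
  using c0_nth by blast

lemma c0_eqI: "(\<And>n. c0_nth x n = c0_nth y n) \<Longrightarrow> x = y"
  by (simp add: c0_nth_inject[symmetric] fun_eq_iff)

instantiation c0 :: real_vector
begin

lift_definition zero_c0 :: c0 is "\<lambda>_. 0" by simp
lift_definition plus_c0 :: "c0 \<Rightarrow> c0 \<Rightarrow> c0" is "\<lambda>x y n. x n + y n"
  by (rule tendsto_add_zero)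
lift_definition minus_c0 :: "c0 \<Rightarrow> c0 \<Rightarrow> c0" is "\<lambda>x y n. x n - y n"
  using tendsto_diff by fastforce
lift_definition uminus_c0 :: "c0 \<Rightarrow> c0" is "\<lambda>x n. - x n"
  using tendsto_minus by fastforce
lift_definition scaleR_c0 :: "real \<Rightarrow> c0 \<Rightarrow> c0" is "\<lambda>r x n. r *\<^sub>R x n"
  using tendsto_scaleR[OF tendsto_const] by fastforce

instance
  by standard (transfer; simp add: fun_eq_iff algebra_simps)+

end

lift_definition scaleC_c0 :: "complex \<Rightarrow> c0 \<Rightarrow> c0" is "\<lambda>c x n. c * x n"
  by (rule tendsto_mult_right_zero)

lemma scaleR_scaleC_c0: "r *\<^sub>R x = scaleC_c0 (of_real r) x"
  by transfer (simp add: scaleR_conv_of_real)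

lemma c0_bdd_above: "bdd_above (range (\<lambda>n. norm (c0_nth x n)))"
proof -
  have "Bseq (c0_nth x)"
    using c0_nth_tendsto convergent_def convergent_imp_Bseq by blast
  then show ?thesis
    by (auto simp: Bseq_def bdd_above_def)
qed

instantiation c0 :: real_normed_vector
begin

definition norm_c0 :: "c0 \<Rightarrow> real" where
  "norm_c0 x = (SUP n. norm (c0_nth x n))"

definition dist_c0 :: "c0 \<Rightarrow> c0 \<Rightarrow> real" where
  "dist_c0 x y = norm (x - y)"

definition sgn_c0 :: "c0 \<Rightarrow> c0" where
  "sgn_c0 x = x /\<^sub>R norm x"

definition uniformity_c0 :: "(c0 \<times> c0) filter" where
  "uniformity_c0 = (INF e\<in>{0<..}. principal {(x, y). dist x y < e})"

definition open_c0 :: "c0 set \<Rightarrow> bool" where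
  "open_c0 U = (\<forall>x\<in>U. \<forall>\<^sub>F (x', y) in uniformity. x' = x \<longrightarrow> y \<in> U)"

lemma norm_c0_nth_le: "norm (c0_nth x n) \<le> norm x"
  unfolding norm_c0_def by (rule cSUP_upper[OF UNIV_I c0_bdd_above])

lemma norm_c0_leI: "(\<And>n. norm (c0_nth x n) \<le> b) \<Longrightarrow> norm x \<le> b"
  unfolding norm_c0_def by (rule cSUP_least) auto

instance
proof
  fix x y :: c0 and r :: real
  show "dist x y = norm (x - y)" by (rule dist_c0_def)
  show "sgn x = x /\<^sub>R norm x" by (rule sgn_c0_def)
  show "uniformity = (INF e\<in>{0<..}. principal {(x :: c0, y). dist x y < e})"
    by (rule uniformity_c0_def)
  show "open U = (\<forall>x\<in>U. \<forall>\<^sub>F (x', y) in uniformity. x' = x \<longrightarrow> y \<in> U)" for U :: "c0 set"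
    by (rule open_c0_def)
  show "norm x = 0 \<longleftrightarrow> x = 0"
  proof
    assume "norm x = 0"
    then have "c0_nth x n = 0" for n
      using norm_c0_nth_le[of x n] by simp
    then show "x = 0" by (intro c0_eqI) (simp add: zero_c0.rep_eq)
  next
    assume "x = 0"
    then show "norm x = 0" by (simp add: norm_c0_def zero_c0.rep_eq)
  qed
  show "norm (x + y) \<le> norm x + norm y"
    by (rule norm_c0_leI)
      (simp add: plus_c0.rep_eq add_mono norm_c0_nth_le norm_triangle_le)
  have le: "norm (r *\<^sub>R x) \<le> \<bar>r\<bar> * norm x" for r and x :: c0
    by (rule norm_c0_leI) (simp add: scaleR_c0.rep_eq mult_left_mono norm_c0_nth_le)
  show "norm (r *\<^sub>R x) = \<bar>r\<bar> * norm x"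
  proof (cases "r = 0")
    case True
    then show ?thesis by (simp add: norm_c0_def zero_c0.rep_eq)
  next
    case False
    then have "norm x \<le> \<bar>inverse r\<bar> * norm (r *\<^sub>R x)"
      using le[of "inverse r" "r *\<^sub>R x"] by simp
    then have "\<bar>r\<bar> * norm x \<le> norm (r *\<^sub>R x)"
      using False by (simp add: field_simps)
    with le show ?thesis by (simp add: antisym)
  qed
qed

end

lemma norm_scaleC_c0: "norm (scaleC_c0 c x) = norm c * norm x"
proof (rule antisym)
  have le: "norm (scaleC_c0 c x) \<le> norm c * norm x" for c x
    by (rule norm_c0_leI) (simp add: scaleC_c0.rep_eq norm_mult mult_left_mono norm_c0_nth_le)
  show "norm (scaleC_c0 c x) \<le> norm c * norm x" by (rule le)
  show "norm c * norm x \<le> norm (scaleC_c0 c x)"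
  proof (cases "c = 0")
    case False
    have "scaleC_c0 (inverse c) (scaleC_c0 c x) = x"
      using False by (intro c0_eqI) (simp add: scaleC_c0.rep_eq)
    then have "norm x \<le> norm (inverse c) * norm (scaleC_c0 c x)"
      using le[of "inverse c" "scaleC_c0 c x"] by simp
    then have "norm c * norm x \<le> norm c * (inverse (norm c) * norm (scaleC_c0 c x))"
      by (intro mult_left_mono) (simp_all only: norm_inverse norm_ge_zero)
    also have "\<dots> = norm (scaleC_c0 c x)" using False by simp
    finally show ?thesis .
  qed simp
qed

instance c0 :: banach
proof
  fix X :: "nat \<Rightarrow> c0" assume C: "Cauchy X"
  have "Cauchy (\<lambda>k. c0_nth (X k) n)" for n
  proof (rule metric_CauchyI)
    fix e :: real assume "e > 0"
    then obtain M where M: "\<forall>m\<ge>M. \<forall>k\<ge>M. dist (X m) (X k) < e"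
      using C metric_CauchyD by blast
    have "dist (c0_nth (X m) n) (c0_nth (X k) n) \<le> dist (X m) (X k)" for m k
      using norm_c0_nth_le[of "X m - X k" n] by (simp add: dist_norm minus_c0.rep_eq)
    then show "\<exists>M. \<forall>m\<ge>M. \<forall>k\<ge>M. dist (c0_nth (X m) n) (c0_nth (X k) n) < e"
      using M by (meson le_less_trans)
  qed
  then have "\<forall>n. \<exists>l. (\<lambda>k. c0_nth (X k) n) \<longlonglongrightarrow> l"
    by (simp add: Cauchy_convergent_iff convergent_def)
  then obtain L where L: "\<And>n. (\<lambda>k. c0_nth (X k) n) \<longlonglongrightarrow> L n" by metis
  have unif: "\<exists>M. \<forall>k\<ge>M. \<forall>n. norm (c0_nth (X k) n - L n) \<le> e" if "e > 0" for e
  proof -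
    obtain M where M: "\<forall>m\<ge>M. \<forall>k\<ge>M. dist (X m) (X k) < e"
      using C \<open>e > 0\<close> metric_CauchyD by blast
    have "norm (c0_nth (X k) n - L n) \<le> e" if "k \<ge> M" for k n
    proof (rule tendsto_upperbound)
      show "(\<lambda>m. norm (c0_nth (X k) n - c0_nth (X m) n)) \<longlonglongrightarrow> norm (c0_nth (X k) n - L n)"
        by (intro tendsto_intros L)
      have "norm (c0_nth (X k) n - c0_nth (X m) n) \<le> e" if "m \<ge> M" for m
        using norm_c0_nth_le[of "X k - X m" n] M \<open>k \<ge> M\<close> that
        by (fastforce simp: dist_norm minus_c0.rep_eq)
      then show "\<forall>\<^sub>F m in sequentially. norm (c0_nth (X k) n - c0_nth (X m) n) \<le> e"
        by (auto simp: eventually_sequentially)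
    qed simp
    then show ?thesis by blast
  qed
  have L0: "L \<longlonglongrightarrow> 0"
  proof (rule LIMSEQ_I)
    fix e :: real assume "e > 0"
    then obtain M where M: "\<And>n. norm (c0_nth (X M) n - L n) \<le> e / 2"
      using unif[of "e / 2"] by auto
    obtain N where N: "\<And>n. n \<ge> N \<Longrightarrow> norm (c0_nth (X M) n) < e / 2"
      using LIMSEQ_D[OF c0_nth_tendsto, of "e / 2" "X M"] \<open>e > 0\<close> by auto
    have "norm (L n - 0) < e" if "n \<ge> N" for n
      using M[of n] N[OF that] norm_triangle_ineq4[of "c0_nth (X M) n" "c0_nth (X M) n - L n"]
      by simp
    then show "\<exists>N. \<forall>n\<ge>N. norm (L n - 0) < e" by blast
  qed
  then have nth: "c0_nth (Abs_c0 L) = L" by (simp add: Abs_c0_inverse)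
  have "X \<longlonglongrightarrow> Abs_c0 L"
  proof (rule LIMSEQ_I)
    fix e :: real assume "e > 0"
    then obtain M where M: "\<forall>k\<ge>M. \<forall>n. norm (c0_nth (X k) n - L n) \<le> e / 2"
      using unif[of "e / 2"] by auto
    have "norm (X k - Abs_c0 L) \<le> e / 2" if "k \<ge> M" for k
      using M that by (intro norm_c0_leI) (simp add: minus_c0.rep_eq nth)
    then show "\<exists>M. \<forall>k\<ge>M. norm (X k - Abs_c0 L) < e"
      using \<open>e > 0\<close> by (intro exI[of _ M]) fastforce
  qed
  then show "convergent X" by (rule convergentI)
qed

section \<open>Uniformly continuous holomorphic functions on the ball of the null sequences\<close>

text \<open>
  \<^const>\<open>has_derivative\<close> is real Frechet differentiability; the complex derivative must
  in addition be complex linear.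
\<close>

definition complex_frechet_differentiable_at :: "(c0 \<Rightarrow> complex) \<Rightarrow> c0 \<Rightarrow> bool" where
  "complex_frechet_differentiable_at f x \<longleftrightarrow>
     (\<exists>f'. (f has_derivative f') (at x) \<and> (\<forall>c v. f' (scaleC_c0 c v) = c * f' v))"

definition ball_algebra :: "(c0 \<Rightarrow> complex) set" where
  "ball_algebra = {f \<in> extensional (ball 0 1).
     uniformly_continuous_on (ball 0 1) f \<and>
     (\<forall>x\<in>ball 0 1. complex_frechet_differentiable_at f x)}"

end

theory Submission
  imports Defs "HOL-Complex_Analysis.Complex_Analysis" "HOL-Probability.Characteristic_Functions"
begin

text \<open>
  The three algebras consist of the same functions, seen on three sets of points. Both the half
  plane and the unit ball of \<open>c\<^sub>0\<close> embed into the closed polydisc: a point \<open>s\<close> as the sequence of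
  the numbers \<open>p powr (-s)\<close> for the primes \<open>p\<close> (Bohr's substitution, \<open>bohr_point\<close>), a null sequence as
  itself. Restriction of functions along these embeddings gives the two isomorphisms. The locale
  \<open>norming_pullback\<close> shows that restriction is an isometric isomorphism, and that the target is a
  Banach algebra, once three things are known: restrictions lie in the target algebra, the embedded
  points norm the polydisc algebra, and every function in the target is a uniform limit of
  restrictions.

  For the half plane, the points norm because a function is largest on the torus, by the
  maximum principle in each coordinate, and because vertical lines wind densely around
  finite-dimensional tori, by Kronecker's theorem (\<open>half_plane_norming\<close>). That a restriction is a
  Dirichlet series converging at every point rests on Bohr's inequality
  (\<open>norm_partial_sum_le\<close>): the partial sums of a Dirichlet polynomial are bounded by a multiple of
  \<open>log (N + 1)\<close> times its norm. At a point with \<open>Re s > 0\<close> they are therefore bounded by a constant times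
  the norm, uniformly in \<open>N\<close>, and convergence passes from polynomials, which are dense
  (\<open>polydisc_algebra_induct\<close>), to their uniform limits (\<open>bohr_point_dirichlet_series\<close>). Conversely, a
  uniformly continuous Dirichlet series is a uniform limit of its Gaussian averages in the vertical
  direction, and these have absolutely summable coefficients (\<open>dirichlet_algebra_approx\<close>).

  For the ball, the points norm by continuity, and a restriction is Frechet differentiable because it
  is bounded and holomorphic on every complex line (locale \<open>bounded_line_holomorphic\<close>). The
  substantial part is approximation. A function in the ball algebra is a uniform limit of finite sums
  of homogeneous polynomials, by uniform continuity and Taylor expansion. On the unit ball a polynomial
  is the uniform limit of its values at truncated sequences (\<open>poly_growth_truncation\<close>), a form of
  the weak continuity of polynomials on \<open>c\<^sub>0\<close> due to Littlewood, Bogdanowicz and Pelczynski. It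
  is proved by induction on the degree: if truncation failed, there would be large derivatives along
  disjoint blocks, whose sums over sets of blocks are polynomials of lower degree, and
  Schur's theorem on summable sequences (\<open>schur\<close>) excludes this.
\<close>


section \<open>Restriction of a function algebra to a norming set\<close>

lemma sup_norm_leI:
  "S \<noteq> {} \<Longrightarrow> (\<And>x. x \<in> S \<Longrightarrow> norm (f x) \<le> C) \<Longrightarrow> sup_norm S f \<le> C"
  unfolding sup_norm_def by (rule cSUP_least)

lemma norm_le_sup_norm:
  assumes "\<And>x. x \<in> S \<Longrightarrow> norm (f x) \<le> C" "x \<in> S"
  shows "norm (f x) \<le> sup_norm S f"
  unfolding sup_norm_def by (rule cSUP_upper[OF assms(2)]) (use assms(1) in \<open>auto intro!: bdd_aboveI\<close>)

definition pullback :: "'t set \<Rightarrow> ('t \<Rightarrow> 's) \<Rightarrow> ('s \<Rightarrow> complex) \<Rightarrow> 't \<Rightarrow> complex" where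
  "pullback T \<gamma> f = (\<lambda>t\<in>T. f (\<gamma> t))"

text \<open>
  Completeness of the target \<open>B\<close> and its closure under the operations come out as conclusions,
  because restriction along \<open>\<gamma>\<close> is an isometric bijection from \<open>A\<close>.
\<close>

locale norming_pullback =
  fixes S :: "'s set" and A and T :: "'t set" and B and \<gamma> :: "'t \<Rightarrow> 's"
  assumes A: "sup_banach_algebra S A"
    and nonempty: "S \<noteq> {}" "T \<noteq> {}"
    and maps: "t \<in> T \<Longrightarrow> \<gamma> t \<in> S"
    and image: "f \<in> A \<Longrightarrow> pullback T \<gamma> f \<in> B"
    and norming: "f \<in> A \<Longrightarrow> (\<And>t. t \<in> T \<Longrightarrow> norm (f (\<gamma> t)) \<le> C) \<Longrightarrow> s \<in> S \<Longrightarrow> norm (f s) \<le> C"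
    and ext: "B \<subseteq> extensional T"
    and dense: "g \<in> B \<Longrightarrow> e > 0 \<Longrightarrow> \<exists>f\<in>A. \<forall>t\<in>T. norm (g t - f (\<gamma> t)) \<le> e"
begin

lemma bounded_on:
  assumes "f \<in> A" obtains C where "\<And>s. s \<in> S \<Longrightarrow> norm (f s) \<le> C"
proof -
  have "bounded (f ` S)" using assms A unfolding sup_banach_algebra_def by blast
  then show thesis using that by (auto simp: bounded_iff)
qed

lemma sup_norm_pullback:
  assumes "f \<in> A" shows "sup_norm T (pullback T \<gamma> f) = sup_norm S f"
proof -
  obtain C where C: "\<And>s. s \<in> S \<Longrightarrow> norm (f s) \<le> C" using bounded_on assms by blast
  have le: "norm (f (\<gamma> t)) \<le> sup_norm T (pullback T \<gamma> f)" if "t \<in> T" for t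
    using norm_le_sup_norm[of T "pullback T \<gamma> f" C t] C maps that by (simp add: pullback_def)
  show ?thesis
  proof (rule antisym)
    show "sup_norm T (pullback T \<gamma> f) \<le> sup_norm S f"
      using nonempty maps by (intro sup_norm_leI) (auto simp: pullback_def intro!: norm_le_sup_norm C)
    show "sup_norm S f \<le> sup_norm T (pullback T \<gamma> f)"
      by (rule sup_norm_leI[OF nonempty(1)]) (rule norming[OF assms le])
  qed
qed

lemma norm_diff_le:
  assumes "f \<in> A" "g \<in> A" "\<And>t. t \<in> T \<Longrightarrow> norm (f (\<gamma> t) - g (\<gamma> t)) \<le> C" "s \<in> S"
  shows "norm (f s - g s) \<le> C"
proof -
  have "fun_add S f (fun_scale S (-1) g) \<in> A"
    using A assms unfolding sup_banach_algebra_def by blast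
  from norming[OF this _ assms(4), of C] show ?thesis
    using assms maps by (simp add: fun_add_def fun_scale_def)
qed

text \<open>
  Approximants of \<open>g\<close> form a Cauchy sequence in \<open>A\<close>, because the image of \<open>\<gamma>\<close> norms their
  differences. The limit of this sequence restricts to \<open>g\<close>.
\<close>

lemma pullback_surj:
  assumes "g \<in> B" shows "\<exists>f\<in>A. pullback T \<gamma> f = g"
proof -
  have "\<forall>n. \<exists>f\<in>A. \<forall>t\<in>T. norm (g t - f (\<gamma> t)) \<le> inverse (real (Suc n))"
    using dense[OF assms] by simp
  then obtain h where h: "\<And>n. h n \<in> A" and
    gh: "\<And>n t. t \<in> T \<Longrightarrow> norm (g t - h n (\<gamma> t)) \<le> inverse (real (Suc n))" by metis
  have d: "norm (h m s - h n s) \<le> inverse (real (Suc m)) + inverse (real (Suc n))" if "s \<in> S" for m n s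
  proof (rule norm_diff_le[OF h h _ that])
    fix t assume "t \<in> T"
    from gh[OF this, of m] gh[OF this, of n]
    show "norm (h m (\<gamma> t) - h n (\<gamma> t)) \<le> inverse (real (Suc m)) + inverse (real (Suc n))"
      using norm_triangle_ineq4[of "g t - h n (\<gamma> t)" "g t - h m (\<gamma> t)"] by simp
  qed
  have "\<exists>N. \<forall>m\<ge>N. \<forall>n\<ge>N. sup_norm S (\<lambda>x. h m x - h n x) < e" if "e > 0" for e
  proof -
    obtain N where N: "inverse (real (Suc N)) < e / 2"
      using reals_Archimedean[OF half_gt_zero[OF \<open>e > 0\<close>]] by blast
    have "sup_norm S (\<lambda>x. h m x - h n x) < e" if "m \<ge> N" "n \<ge> N" for m n
    proof -
      have "inverse (real (Suc m)) \<le> inverse (real (Suc N))" "inverse (real (Suc n)) \<le> inverse (real (Suc N))"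
        using that by (auto intro!: le_imp_inverse_le)
      moreover have "sup_norm S (\<lambda>x. h m x - h n x) \<le> inverse (real (Suc m)) + inverse (real (Suc n))"
        by (intro sup_norm_leI nonempty d)
      ultimately show ?thesis using N by linarith
    qed
    then show ?thesis by blast
  qed
  then obtain f where f: "f \<in> A" and lim: "(\<lambda>n. sup_norm S (\<lambda>x. h n x - f x)) \<longlonglongrightarrow> 0"
    using A h unfolding sup_banach_algebra_def by blast
  have "g t = f (\<gamma> t)" if "t \<in> T" for t
  proof -
    obtain C where C: "\<And>s. s \<in> S \<Longrightarrow> norm (f s) \<le> C" using bounded_on f by blast
    have "norm (h n (\<gamma> t) - f (\<gamma> t)) \<le> sup_norm S (\<lambda>x. h n x - f x)" for n
    proof -
      obtain D where D: "\<And>s. s \<in> S \<Longrightarrow> norm (h n s) \<le> D" using bounded_on h by blast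
      have "norm (h n s - f s) \<le> D + C" if "s \<in> S" for s
        using norm_triangle_ineq4[of "h n s" "f s"] C[OF that] D[OF that] by linarith
      then show ?thesis using maps[OF that] by (intro norm_le_sup_norm[where S=S and f="\<lambda>x. h n x - f x"])
    qed
    then have "(\<lambda>n. h n (\<gamma> t) - f (\<gamma> t)) \<longlonglongrightarrow> 0"
      by (intro Lim_null_comparison[OF _ lim]) auto
    moreover have "(\<lambda>n. g t - h n (\<gamma> t)) \<longlonglongrightarrow> 0"
      using gh[OF that] by (intro Lim_null_comparison[OF _ LIMSEQ_inverse_real_of_nat]) auto
    ultimately have "(\<lambda>n. (h n (\<gamma> t) - f (\<gamma> t)) + (g t - h n (\<gamma> t))) \<longlonglongrightarrow> 0 + 0"
      by (rule tendsto_add)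
    then have "(\<lambda>n::nat. g t - f (\<gamma> t)) \<longlonglongrightarrow> 0" by simp
    then show ?thesis by (simp add: LIMSEQ_const_iff)
  qed
  then have "pullback T \<gamma> f = g"
    using assms ext by (auto simp: pullback_def extensional_def fun_eq_iff)
  with f show ?thesis by blast
qed

lemma pullback_ops:
  "pullback T \<gamma> (fun_add S f g) = fun_add T (pullback T \<gamma> f) (pullback T \<gamma> g)"
  "pullback T \<gamma> (fun_scale S c f) = fun_scale T c (pullback T \<gamma> f)"
  "pullback T \<gamma> (fun_mult S f g) = fun_mult T (pullback T \<gamma> f) (pullback T \<gamma> g)"
  "pullback T \<gamma> (\<lambda>s\<in>S. 1) = (\<lambda>t\<in>T. 1)"
  using maps by (auto simp: pullback_def fun_add_def fun_scale_def fun_mult_def fun_eq_iff)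

theorem isometric_algebra_iso_pullback: "isometric_algebra_iso S A T B (pullback T \<gamma>)"
  unfolding isometric_algebra_iso_def
proof (intro conjI ballI allI)
  show "bij_betw (pullback T \<gamma>) A B"
    unfolding bij_betw_def
  proof
    show "inj_on (pullback T \<gamma>) A"
    proof (rule inj_onI)
      fix f g assume fg: "f \<in> A" "g \<in> A" "pullback T \<gamma> f = pullback T \<gamma> g"
      have eq: "f (\<gamma> t) = g (\<gamma> t)" if "t \<in> T" for t
        using fun_cong[OF fg(3), of t] that by (simp add: pullback_def)
      have "norm (f s - g s) \<le> 0" if "s \<in> S" for s
        by (rule norm_diff_le[OF fg(1,2) _ that]) (simp add: eq)
      moreover have "f \<in> extensional S" "g \<in> extensional S"
        using fg A unfolding sup_banach_algebra_def by auto
      ultimately show "f = g" by (intro extensionalityI[of f S g]) auto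
    qed
    show "pullback T \<gamma> ` A = B"
      using image pullback_surj by blast
  qed
qed (simp_all add: pullback_ops sup_norm_pullback)

theorem sup_banach_algebra_codomain: "sup_banach_algebra T B"
proof -
  have complete: "\<exists>f\<in>B. (\<lambda>n. sup_norm T (\<lambda>x. F n x - f x)) \<longlonglongrightarrow> 0"
    if F: "\<forall>n::nat. F n \<in> B"
      and C: "\<forall>e>0. \<exists>N. \<forall>m\<ge>N. \<forall>n\<ge>N. sup_norm T (\<lambda>x. F m x - F n x) < e" for F
  proof -
    have "\<forall>n. \<exists>f\<in>A. pullback T \<gamma> f = F n" using F pullback_surj by blast
    then obtain h where h: "\<And>n. h n \<in> A" and hF: "\<And>n. pullback T \<gamma> (h n) = F n" by metis
    have Fh: "F n t = h n (\<gamma> t)" if "t \<in> T" for n t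
      using fun_cong[OF hF[of n], of t] that by (simp add: pullback_def)
    have transfer: "sup_norm T (\<lambda>x. f (\<gamma> x) - g (\<gamma> x)) = sup_norm S (\<lambda>x. f x - g x)"
      if "f \<in> A" "g \<in> A" for f g
    proof -
      have "fun_add S f (fun_scale S (-1) g) \<in> A"
        using A that unfolding sup_banach_algebra_def by blast
      from sup_norm_pullback[OF this] show ?thesis
        using maps by (simp add: sup_norm_def pullback_def fun_add_def fun_scale_def cong: SUP_cong)
    qed
    have "sup_norm T (\<lambda>x. F m x - F n x) = sup_norm S (\<lambda>x. h m x - h n x)" for m n
      unfolding transfer[OF h h, symmetric] by (simp add: sup_norm_def Fh cong: SUP_cong)
    then have "\<forall>e>0. \<exists>N. \<forall>m\<ge>N. \<forall>n\<ge>N. sup_norm S (\<lambda>x. h m x - h n x) < e" using C by simp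
    then obtain f where f: "f \<in> A" "(\<lambda>n. sup_norm S (\<lambda>x. h n x - f x)) \<longlonglongrightarrow> 0"
      using A h unfolding sup_banach_algebra_def by blast
    have "sup_norm T (\<lambda>x. F n x - pullback T \<gamma> f x) = sup_norm S (\<lambda>x. h n x - f x)" for n
      unfolding transfer[OF h f(1), symmetric] by (simp add: sup_norm_def Fh pullback_def cong: SUP_cong)
    with f image[OF f(1)] show ?thesis by (intro bexI[of _ "pullback T \<gamma> f"]) simp_all
  qed
  have add: "fun_add S f g \<in> A" if "f \<in> A" "g \<in> A" for f g
    using A that unfolding sup_banach_algebra_def by blast
  have mult: "fun_mult S f g \<in> A" if "f \<in> A" "g \<in> A" for f g
    using A that unfolding sup_banach_algebra_def by blast
  have scale: "fun_scale S c f \<in> A" if "f \<in> A" for c f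
    using A that unfolding sup_banach_algebra_def by blast
  have one: "(\<lambda>s\<in>S. 1) \<in> A"
    using A unfolding sup_banach_algebra_def by blast
  show ?thesis
    unfolding sup_banach_algebra_def
  proof (intro conjI allI ballI impI)
    show "(\<lambda>t\<in>T. 1) \<in> B" using image[OF one] by (simp only: pullback_ops)
    show "fun_add T f g \<in> B" if "f \<in> B" "g \<in> B" for f g
    proof -
      obtain f' g' where "f' \<in> A" "g' \<in> A" "f = pullback T \<gamma> f'" "g = pullback T \<gamma> g'"
        using \<open>f \<in> B\<close> \<open>g \<in> B\<close> pullback_surj by metis
      then show ?thesis using image[OF add, of f' g'] by (simp add: pullback_ops)
    qed
    show "fun_mult T f g \<in> B" if "f \<in> B" "g \<in> B" for f g
    proof -
      obtain f' g' where "f' \<in> A" "g' \<in> A" "f = pullback T \<gamma> f'" "g = pullback T \<gamma> g'"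
        using \<open>f \<in> B\<close> \<open>g \<in> B\<close> pullback_surj by metis
      then show ?thesis using image[OF mult, of f' g'] by (simp add: pullback_ops)
    qed
    show "fun_scale T c f \<in> B" if "f \<in> B" for c f
    proof -
      obtain f' where "f' \<in> A" "f = pullback T \<gamma> f'" using \<open>f \<in> B\<close> pullback_surj by metis
      then show ?thesis using image[OF scale, of f' c] by (simp add: pullback_ops)
    qed
    fix f assume "f \<in> B"
    then obtain f' where f': "f' \<in> A" "f = pullback T \<gamma> f'" using pullback_surj by metis
    then obtain C where "\<And>s. s \<in> S \<Longrightarrow> norm (f' s) \<le> C" using bounded_on by blast
    then show "bounded (f ` T)" using maps f' by (auto simp: bounded_iff pullback_def)
  next
    show "B \<subseteq> extensional T" by (rule ext)
  next
    fix F :: "nat \<Rightarrow> 't \<Rightarrow> complex"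
    assume "\<forall>n. F n \<in> B" "\<forall>e>0. \<exists>N. \<forall>m\<ge>N. \<forall>n\<ge>N. sup_norm T (\<lambda>x. F m x - F n x) < e"
    then show "\<exists>f\<in>B. (\<lambda>n. sup_norm T (\<lambda>x. F n x - f x)) \<longlonglongrightarrow> 0" by (rule complete)
  qed
qed

end

section \<open>Taylor coefficients as uniform limits\<close>

definition taylor_coeff :: "(complex \<Rightarrow> complex) \<Rightarrow> nat \<Rightarrow> complex" where
  "taylor_coeff h k = (deriv ^^ k) h 0 / fact k"

text \<open>
  Cauchy's estimate without control on the boundary circle: let the radius increase to \<open>R\<close>.
\<close>

lemma norm_taylor_coeff_le:
  assumes h: "h holomorphic_on ball 0 R" and M: "\<And>w. norm w < R \<Longrightarrow> norm (h w) \<le> M" and R: "R > 0"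
  shows "norm (taylor_coeff h k) \<le> M / R ^ k"
proof -
  have "norm (taylor_coeff h k) * r ^ k \<le> M" if "0 < r" "r < R" for r
  proof -
    have "norm ((deriv ^^ k) h 0) \<le> fact k * M / r ^ k"
    proof (rule Cauchy_inequality)
      show "h holomorphic_on ball 0 r" using h by (rule holomorphic_on_subset) (use that in auto)
      show "continuous_on (cball 0 r) h"
        by (rule continuous_on_subset[OF holomorphic_on_imp_continuous_on[OF h]]) (use that in auto)
      show "norm (h x) \<le> M" if "norm (0 - x) = r" for x
        using M[of x] that \<open>r < R\<close> by simp
    qed (use that in auto)
    then show ?thesis using that by (simp add: taylor_coeff_def norm_divide field_simps)
  qed
  then have "\<forall>\<^sub>F r in at_left R. norm (taylor_coeff h k) * r ^ k \<le> M"
    using eventually_at_left_real[OF R] by (auto elim: eventually_mono)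
  moreover have "((\<lambda>r. norm (taylor_coeff h k) * r ^ k) \<longlongrightarrow> norm (taylor_coeff h k) * R ^ k) (at_left R)"
    by (intro tendsto_intros)
  ultimately have "norm (taylor_coeff h k) * R ^ k \<le> M"
    by (metis tendsto_upperbound trivial_limit_at_left_real)
  then show ?thesis using R by (simp add: field_simps)
qed

lemma norm_taylor_remainder_le:
  assumes h: "h holomorphic_on ball 0 R" and M: "\<And>w. norm w < R \<Longrightarrow> norm (h w) \<le> M" and w: "norm w < R"
  shows "norm (h w - (\<Sum>k<n. taylor_coeff h k * w ^ k)) \<le> M * (norm w / R) ^ n / (1 - norm w / R)"
proof -
  have R: "R > 0" using w norm_ge_zero[of w] by linarith
  define q where "q = norm w / R"
  have q: "0 \<le> q" "q < 1" using w R by (auto simp: q_def)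
  have "(\<lambda>k. taylor_coeff h k * w ^ k) sums h w"
    using holomorphic_power_series[OF h, of w] w by (simp add: taylor_coeff_def)
  from sums_split_initial_segment[OF this, of n]
  have s: "(\<lambda>k. taylor_coeff h (k + n) * w ^ (k + n)) sums (h w - (\<Sum>k<n. taylor_coeff h k * w ^ k))" .
  have b: "norm (taylor_coeff h (k + n) * w ^ (k + n)) \<le> M * q ^ n * q ^ k" for k
  proof -
    have "norm (taylor_coeff h (k + n)) * norm w ^ (k + n) \<le> M / R ^ (k + n) * norm w ^ (k + n)"
      by (intro mult_right_mono norm_taylor_coeff_le[OF h M R]) auto
    then show ?thesis by (simp add: norm_mult norm_power q_def power_divide power_add mult_ac)
  qed
  have g: "(\<lambda>k. M * q ^ n * q ^ k) sums (M * q ^ n * (1 / (1 - q)))"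
    using q by (intro sums_mult geometric_sums) auto
  have "norm (\<Sum>k. taylor_coeff h (k + n) * w ^ (k + n)) \<le> (\<Sum>k. M * q ^ n * q ^ k)"
    by (rule norm_suminf_le[OF b]) (use g sums_summable in blast)
  then show ?thesis using s g by (simp add: sums_iff q_def)
qed

text \<open>
  Dividing by \<open>t ^ k\<close> what is left of \<open>h t\<close> after removing the terms of lower order gives the
  \<open>k\<close>-th coefficient with an error that depends only on the bound of \<open>h\<close>. For functions with a
  parameter the coefficients are therefore uniform limits of algebraic expressions in the
  function itself, and inherit every property that survives such limits.
\<close>

lemma norm_taylor_quotient_diff_le:
  assumes h: "h holomorphic_on ball 0 R" and M: "\<And>w. norm w < R \<Longrightarrow> norm (h w) \<le> M"
    and R: "R > 0" and t: "norm t \<le> R / 2" "t \<noteq> 0"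
  shows "norm ((h t - (\<Sum>i<k. taylor_coeff h i * t ^ i)) / t ^ k - taylor_coeff h k)
    \<le> 2 * M * norm t / R ^ Suc k"
proof -
  have M0: "M \<ge> 0" using order_trans[OF norm_ge_zero M[of 0]] R by simp
  have tR: "norm t < R" "norm t / R \<le> 1 / 2" using t R by (auto simp: field_simps)
  have "norm (h t - (\<Sum>i<Suc k. taylor_coeff h i * t ^ i)) \<le> M * (norm t / R) ^ Suc k / (1 - norm t / R)"
    by (rule norm_taylor_remainder_le[OF h M tR(1)])
  also have "\<dots> \<le> M * (norm t / R) ^ Suc k / (1/2)"
    using tR M0 R by (intro divide_left_mono) auto
  finally have "norm (h t - (\<Sum>i<Suc k. taylor_coeff h i * t ^ i)) \<le> 2 * M * norm t / R ^ Suc k * norm t ^ k"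
    by (simp add: power_divide mult_ac)
  then have "norm (h t - (\<Sum>i<Suc k. taylor_coeff h i * t ^ i)) / norm t ^ k \<le> 2 * M * norm t / R ^ Suc k"
    using t by (simp add: pos_divide_le_eq)
  moreover have "(h t - (\<Sum>i<k. taylor_coeff h i * t ^ i)) / t ^ k - taylor_coeff h k
      = (h t - (\<Sum>i<Suc k. taylor_coeff h i * t ^ i)) / t ^ k"
    using t by (simp add: field_simps)
  ultimately show ?thesis by (simp only: norm_divide norm_power)
qed

section \<open>The polydisc algebra\<close>

lemma mem_closed_polydisc: "z \<in> closed_polydisc \<longleftrightarrow> (\<forall>n. norm (z n) \<le> 1)"
  by (auto simp: closed_polydisc_def)

lemma mem_open_polydisc: "z \<in> open_polydisc \<longleftrightarrow> (\<forall>n. norm (z n) < 1)"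
  by (auto simp: open_polydisc_def)

lemma compact_closed_polydisc: "compact closed_polydisc"
proof -
  have "compactin (product_topology (\<lambda>n::nat. euclidean :: complex topology) UNIV) closed_polydisc"
    unfolding closed_polydisc_def compactin_PiE by (simp add: compactin_euclidean_iff)
  then show ?thesis by (simp only: euclidean_product_topology compactin_euclidean_iff)
qed

lemma closed_polydisc_nonempty: "closed_polydisc \<noteq> {}"
proof -
  have "(\<lambda>_. 0) \<in> closed_polydisc" by (simp add: mem_closed_polydisc)
  then show ?thesis by blast
qed

text \<open>
  Up to an error \<open>e\<close>, a continuous function on the compact polydisc sees only finitely many
  coordinates. This is uniform continuity for the product metric, in which the weights of the
  coordinates decay geometrically.
\<close>

lemma closed_polydisc_uniform_continuity:
  assumes f: "continuous_on closed_polydisc f" and e: "(e::real) > 0"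
  shows "\<exists>m. \<exists>d>0. \<forall>x\<in>closed_polydisc. \<forall>y\<in>closed_polydisc.
    (\<forall>i<m. norm (x i - y i) < d) \<longrightarrow> norm (f x - f y :: complex) < e"
proof -
  have "uniformly_continuous_on closed_polydisc f"
    using f compact_closed_polydisc by (rule compact_uniformly_continuous)
  then obtain D where D: "D > 0" and unif: "\<And>x y. x \<in> closed_polydisc \<Longrightarrow> y \<in> closed_polydisc \<Longrightarrow>
      dist x y < D \<Longrightarrow> dist (f x) (f y) < e"
    unfolding uniformly_continuous_on_def using e by (metis dist_commute)
  obtain N where N: "(1/2)^N < D/2" using real_arch_pow_inv[of "D/2" "1/2"] D by auto
  \<comment> \<open>The metric enumerates the coordinates by \<open>from_nat\<close>, so the first \<open>N\<close> weights concern these.\<close>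
  define m where "m = Suc (Max ((from_nat :: nat \<Rightarrow> nat) ` {..N}))"
  show ?thesis
  proof (intro exI[of _ m] exI[of _ "D/4"] conjI ballI impI)
    fix x y assume xy: "x \<in> closed_polydisc" "y \<in> closed_polydisc" "\<forall>i<m. norm (x i - y i) < D/4"
    have "from_nat n < m" if "n \<le> N" for n
      unfolding m_def using that by (auto simp: less_Suc_eq_le)
    then have b: "dist (x (from_nat n)) (y (from_nat n)) < D/4" if "n \<le> N" for n
      using xy(3) that by (simp add: dist_norm)
    let ?M = "{dist (x (from_nat n)) (y (from_nat n))|n. n \<le> N}"
    have "Max ?M \<le> D/4"
      by (rule Max.boundedI) (use b in \<open>auto intro: less_imp_le\<close>)
    then have "dist x y < D"
      using dist_fun_le_dist_first_terms[of x y N] N by linarith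
    then show "norm (f x - f y) < e"
      using unif[OF xy(1,2)] by (simp add: dist_norm)
  qed (use D in simp)
qed

lemma polydisc_algebraD:
  assumes "f \<in> polydisc_algebra"
  shows "f \<in> extensional closed_polydisc" "continuous_on closed_polydisc f"
  using assms by (auto simp: polydisc_algebra_def)

lemma upd_closed_polydisc [intro]:
  "z \<in> closed_polydisc \<Longrightarrow> norm w \<le> 1 \<Longrightarrow> z(n := w) \<in> closed_polydisc"
  by (auto simp: mem_closed_polydisc)

lemma continuous_on_upd [continuous_intros]:
  fixes z :: "nat \<Rightarrow> complex"
  shows "continuous_on S (\<lambda>w. z(n := w))"
proof (rule continuous_on_coordinatewise_then_product)
  show "continuous_on S (\<lambda>w. (z(n := w)) i)" for i
    by (cases "i = n") auto
qed

lemma polydisc_algebra_continuous_coordinate: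
  assumes "f \<in> polydisc_algebra" "z \<in> closed_polydisc"
  shows "continuous_on (cball 0 1) (\<lambda>w. f (z(n := w)))"
  by (rule continuous_on_compose2[OF polydisc_algebraD(2)[OF assms(1)] continuous_on_upd])
    (use assms in auto)

lemma continuous_on_coord: "continuous_on S (\<lambda>z :: nat \<Rightarrow> complex. z i)"
  using continuous_on_product_coordinates by (rule continuous_on_subset) simp

lemma uniform_limitI_le:
  assumes "\<And>e. e > 0 \<Longrightarrow> \<exists>N. \<forall>n\<ge>N. \<forall>x\<in>S. norm (F n x - f x) \<le> e"
  shows "uniform_limit S (F :: nat \<Rightarrow> 'x \<Rightarrow> 'y::real_normed_vector) f sequentially"
proof (rule uniform_limitI)
  fix e :: real assume "e > 0"
  then obtain N where "\<forall>n\<ge>N. \<forall>x\<in>S. norm (F n x - f x) \<le> e/2" using assms[of "e/2"] by auto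
  then show "\<forall>\<^sub>F n in sequentially. \<forall>x\<in>S. dist (F n x) (f x) < e"
    unfolding eventually_sequentially dist_norm using \<open>e > 0\<close>
    by (intro exI[of _ N]) fastforce
qed

lemma uniform_approx_sequence:
  fixes f :: "'x \<Rightarrow> complex"
  assumes ap: "\<And>e. e > 0 \<Longrightarrow> \<exists>g. P g \<and> (\<forall>x\<in>S. norm (g x - f x) \<le> e)"
  obtains F :: "nat \<Rightarrow> 'x \<Rightarrow> complex" where "\<And>n. P (F n)" "uniform_limit S F f sequentially"
proof -
  have "\<exists>g. P g \<and> (\<forall>x\<in>S. norm (g x - f x) \<le> inverse (real (Suc n)))" for n
    by (rule ap) simp
  then obtain F where F: "\<And>n. P (F n)"
      and l: "\<And>n x. x \<in> S \<Longrightarrow> norm (F n x - f x) \<le> inverse (real (Suc n))" by metis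
  have "uniform_limit S F f sequentially"
  proof (rule uniform_limitI_le)
    fix e :: real assume "e > 0"
    then obtain N where "inverse (real (Suc N)) < e" using reals_Archimedean by blast
    moreover have "inverse (real (Suc n)) \<le> inverse (real (Suc N))" if "n \<ge> N" for n
      using that by (auto intro!: le_imp_inverse_le)
    ultimately show "\<exists>N. \<forall>n\<ge>N. \<forall>x\<in>S. norm (F n x - f x) \<le> e"
      using l by (intro exI[of _ N]) (meson less_imp_le order_trans)
  qed
  with F show thesis by (rule that)
qed

lemma holomorphic_on_uniform_approx:
  assumes S: "open S" and ap: "\<And>e. e > 0 \<Longrightarrow> \<exists>g. g holomorphic_on S \<and> (\<forall>x\<in>S. norm (g x - f x) \<le> e)"
  shows "f holomorphic_on S"
proof -
  obtain F where F: "\<And>n. F n holomorphic_on S" and ul: "uniform_limit S F f sequentially"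
    by (rule uniform_approx_sequence[OF ap], assumption, rule that)
  show ?thesis
  proof (rule holomorphic_uniform_sequence[OF S F])
    fix x assume "x \<in> S"
    then obtain d where "d > 0" "cball x d \<subseteq> S" using S open_contains_cball by blast
    then show "\<exists>d>0. cball x d \<subseteq> S \<and> uniform_limit (cball x d) F f sequentially"
      using uniform_limit_on_subset[OF ul] by blast
  qed
qed

lemma continuous_on_uniform_approx:
  fixes f :: "'x::topological_space \<Rightarrow> complex"
  assumes ap: "\<And>e. e > 0 \<Longrightarrow> \<exists>g. continuous_on S g \<and> (\<forall>x\<in>S. norm (g x - f x) \<le> e)"
  shows "continuous_on S f"
proof -
  obtain F where F: "\<And>n. continuous_on S (F n)" and ul: "uniform_limit S F f sequentially"
    by (rule uniform_approx_sequence[OF ap], assumption, rule that)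
  show ?thesis
    by (rule uniform_limit_theorem[OF _ ul]) (use F in auto)
qed

text \<open>
  Holomorphy in one coordinate persists when the other coordinates lie on the boundary: shrink
  them into the open polydisc and let the dilation tend to the identity, which by uniform
  continuity is a uniform limit.
\<close>

lemma polydisc_algebra_holomorphic_coordinate:
  assumes f: "f \<in> polydisc_algebra" and z: "z \<in> closed_polydisc"
  shows "(\<lambda>w. f (z(n := w))) holomorphic_on ball 0 1"
proof (rule holomorphic_on_uniform_approx)
  fix e :: real assume e: "e > 0"
  obtain m d where d: "d > 0" and unif0: "\<forall>x\<in>closed_polydisc. \<forall>y\<in>closed_polydisc.
      (\<forall>i<m. norm (x i - y i) < d) \<longrightarrow> norm (f x - f y) < e"
    using closed_polydisc_uniform_continuity[OF polydisc_algebraD(2)[OF f] e] by blast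
  note unif = unif0[rule_format]
  define r where "r = max (1/2) (1 - d/2)"
  have r: "0 < r" "r < 1" "1 - r < d" using d by (auto simp: r_def)
  define y where "y = (\<lambda>i. of_real r * z i)"
  have y: "norm (y i) \<le> r" for i
    using z r by (auto simp: y_def norm_mult mem_closed_polydisc intro: mult_left_le)
  then have yo: "y \<in> open_polydisc" using r by (auto simp: mem_open_polydisc intro: le_less_trans)
  then have yc: "y \<in> closed_polydisc" by (auto simp: mem_open_polydisc mem_closed_polydisc less_imp_le)
  have yz: "norm (y i - z i) < d" for i
  proof -
    have "norm (y i - z i) = (1 - r) * norm (z i)"
    proof -
      have "y i - z i = of_real (-(1 - r)) * z i" by (simp add: y_def algebra_simps)
      then show ?thesis using r by (simp only: norm_mult norm_of_real)
    qed
    also have "\<dots> \<le> 1 - r" using z r by (auto simp: mem_closed_polydisc intro: mult_left_le)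
    finally show ?thesis using r by linarith
  qed
  show "\<exists>g. g holomorphic_on ball 0 1 \<and> (\<forall>w\<in>ball 0 1. norm (g w - f (z(n := w))) \<le> e)"
  proof (intro exI conjI ballI)
    show "(\<lambda>w. f (y(n := w))) holomorphic_on ball 0 1"
      using f yo by (simp add: polydisc_algebra_def)
    fix w :: complex assume "w \<in> ball 0 1"
    then have "norm w \<le> 1" by simp
    then show "norm (f (y(n := w)) - f (z(n := w))) \<le> e"
      by (intro unif[THEN less_imp_le] upd_closed_polydisc yc z) (use yz d in auto)
  qed
qed auto

lemma polydisc_algebraI:
  assumes "f \<in> extensional closed_polydisc" "continuous_on closed_polydisc f"
    and "\<And>z n. z \<in> closed_polydisc \<Longrightarrow> (\<lambda>w. f (z(n := w))) holomorphic_on ball 0 1"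
  shows "f \<in> polydisc_algebra"
  using assms by (auto simp: polydisc_algebra_def mem_open_polydisc mem_closed_polydisc less_imp_le)

lemma polydisc_algebra_restrictI:
  assumes c: "continuous_on closed_polydisc f"
    and h: "\<And>z n. z \<in> closed_polydisc \<Longrightarrow> (\<lambda>w. f (z(n := w))) holomorphic_on ball 0 1"
  shows "(\<lambda>z\<in>closed_polydisc. f z) \<in> polydisc_algebra"
proof (rule polydisc_algebraI)
  show "continuous_on closed_polydisc (\<lambda>z\<in>closed_polydisc. f z)"
    using c by (rule continuous_on_eq) simp
  show "(\<lambda>w. (\<lambda>z\<in>closed_polydisc. f z) (z(n := w))) holomorphic_on ball 0 1"
    if "z \<in> closed_polydisc" for z n
    using h[OF that, of n] by (rule holomorphic_transform) (use that in auto)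
qed auto

lemma polydisc_algebra_uniform_approx:
  assumes "f \<in> extensional closed_polydisc"
    and ap: "\<And>e. e > 0 \<Longrightarrow> \<exists>g\<in>polydisc_algebra. \<forall>z\<in>closed_polydisc. norm (g z - f z) \<le> e"
  shows "f \<in> polydisc_algebra"
proof (rule polydisc_algebraI[OF assms(1)])
  show "continuous_on closed_polydisc f"
    by (rule continuous_on_uniform_approx) (use ap polydisc_algebraD in blast)
  fix z n assume z: "z \<in> closed_polydisc"
  show "(\<lambda>w. f (z(n := w))) holomorphic_on ball 0 1"
  proof (rule holomorphic_on_uniform_approx)
    fix e :: real assume "e > 0"
    then obtain g where g: "g \<in> polydisc_algebra" "\<And>z. z \<in> closed_polydisc \<Longrightarrow> norm (g z - f z) \<le> e"
      using ap by blast
    show "\<exists>h. h holomorphic_on ball 0 1 \<and> (\<forall>w\<in>ball 0 1. norm (h w - f (z(n := w))) \<le> e)"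
      using polydisc_algebra_holomorphic_coordinate[OF g(1) z] z
      by (intro exI[of _ "\<lambda>w. g (z(n := w))"] conjI ballI g(2)) auto
  qed auto
qed

lemma polydisc_algebra_const: "(\<lambda>z\<in>closed_polydisc. c) \<in> polydisc_algebra"
  by (rule polydisc_algebra_restrictI) auto

lemma polydisc_algebra_coord: "(\<lambda>z\<in>closed_polydisc. z i) \<in> polydisc_algebra"
proof (rule polydisc_algebra_restrictI)
  show "(\<lambda>w. (z(n := w)) i) holomorphic_on ball 0 1" for z :: "nat \<Rightarrow> complex" and n
    by (cases "i = n") auto
qed (rule continuous_on_coord)

lemma polydisc_algebra_add:
  "f \<in> polydisc_algebra \<Longrightarrow> g \<in> polydisc_algebra \<Longrightarrow> (\<lambda>z\<in>closed_polydisc. f z + g z) \<in> polydisc_algebra"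
  by (intro polydisc_algebra_restrictI continuous_intros holomorphic_intros polydisc_algebraD
      polydisc_algebra_holomorphic_coordinate)

lemma polydisc_algebra_mult:
  "f \<in> polydisc_algebra \<Longrightarrow> g \<in> polydisc_algebra \<Longrightarrow> (\<lambda>z\<in>closed_polydisc. f z * g z) \<in> polydisc_algebra"
  by (intro polydisc_algebra_restrictI continuous_intros holomorphic_intros polydisc_algebraD
      polydisc_algebra_holomorphic_coordinate)

lemma polydisc_algebra_scale:
  "f \<in> polydisc_algebra \<Longrightarrow> (\<lambda>z\<in>closed_polydisc. c * f z) \<in> polydisc_algebra"
  by (intro polydisc_algebra_restrictI continuous_intros holomorphic_intros polydisc_algebraD
      polydisc_algebra_holomorphic_coordinate)

lemma polydisc_algebra_sum:
  "finite I \<Longrightarrow> (\<And>i. i \<in> I \<Longrightarrow> f i \<in> polydisc_algebra) \<Longrightarrow>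
    (\<lambda>z\<in>closed_polydisc. \<Sum>i\<in>I. f i z) \<in> polydisc_algebra"
  by (intro polydisc_algebra_restrictI continuous_intros holomorphic_intros polydisc_algebraD
      polydisc_algebra_holomorphic_coordinate) auto

lemma polydisc_algebra_bounded:
  assumes "f \<in> polydisc_algebra" obtains M where "M > 0" "\<And>z. z \<in> closed_polydisc \<Longrightarrow> norm (f z) \<le> M"
proof -
  have "bounded (f ` closed_polydisc)"
    using compact_continuous_image[OF polydisc_algebraD(2)[OF assms] compact_closed_polydisc]
    by (rule compact_imp_bounded)
  then show thesis using that unfolding bounded_pos by auto
qed

theorem sup_banach_algebra_polydisc_algebra: "sup_banach_algebra closed_polydisc polydisc_algebra"
  unfolding sup_banach_algebra_def
proof (intro conjI ballI allI impI)
  show "bounded (f ` closed_polydisc)" if "f \<in> polydisc_algebra" for f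
    using compact_continuous_image[OF polydisc_algebraD(2)[OF that] compact_closed_polydisc]
    by (rule compact_imp_bounded)
  fix F :: "nat \<Rightarrow> (nat \<Rightarrow> complex) \<Rightarrow> complex"
  assume F: "\<forall>n. F n \<in> polydisc_algebra"
    and C: "\<forall>e>0. \<exists>N. \<forall>m\<ge>N. \<forall>n\<ge>N. sup_norm closed_polydisc (\<lambda>x. F m x - F n x) < e"
  have le: "norm (F m z - F n z) \<le> sup_norm closed_polydisc (\<lambda>x. F m x - F n x)"
    if z: "z \<in> closed_polydisc" for m n z
  proof -
    obtain M where M: "\<And>z. z \<in> closed_polydisc \<Longrightarrow> norm (F m z) \<le> M" using F polydisc_algebra_bounded by metis
    obtain M' where M': "\<And>z. z \<in> closed_polydisc \<Longrightarrow> norm (F n z) \<le> M'" using F polydisc_algebra_bounded by metis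
    have "norm (F m x - F n x) \<le> M + M'" if "x \<in> closed_polydisc" for x
      using norm_triangle_ineq4[of "F m x" "F n x"] M[OF that] M'[OF that] by linarith
    then show ?thesis using z by (rule norm_le_sup_norm[where f="\<lambda>x. F m x - F n x"])
  qed
  have cauchy: "\<exists>N. \<forall>m\<ge>N. \<forall>n\<ge>N. \<forall>z\<in>closed_polydisc. norm (F m z - F n z) < e" if "e > 0" for e
    using C that le by (meson le_less_trans)
  have "convergent (\<lambda>n. F n z)" if z: "z \<in> closed_polydisc" for z
  proof -
    have "Cauchy (\<lambda>n. F n z)"
      unfolding Cauchy_def dist_norm using cauchy z by blast
    then show ?thesis by (simp add: Cauchy_convergent_iff)
  qed
  then obtain f0 where f0: "\<And>z. z \<in> closed_polydisc \<Longrightarrow> (\<lambda>n. F n z) \<longlonglongrightarrow> f0 z"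
    unfolding convergent_def by metis
  define f where "f = (\<lambda>z\<in>closed_polydisc. f0 z)"
  have close: "\<exists>N. \<forall>n\<ge>N. \<forall>z\<in>closed_polydisc. norm (F n z - f z) \<le> e" if "e > 0" for e
  proof -
    obtain N where N: "\<forall>m\<ge>N. \<forall>n\<ge>N. \<forall>z\<in>closed_polydisc. norm (F m z - F n z) < e"
      using cauchy \<open>0 < e\<close> by blast
    have "norm (F n z - f z) \<le> e" if "n \<ge> N" "z \<in> closed_polydisc" for n z
    proof (rule tendsto_upperbound)
      show "(\<lambda>m. norm (F n z - F m z)) \<longlonglongrightarrow> norm (F n z - f z)"
        using f0[OF that(2)] that by (intro tendsto_intros) (simp add: f_def)
      show "\<forall>\<^sub>F m in sequentially. norm (F n z - F m z) \<le> e"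
        unfolding eventually_sequentially using N that by (intro exI[of _ N]) (auto intro: less_imp_le)
    qed simp
    then show ?thesis by blast
  qed
  show "\<exists>f\<in>polydisc_algebra. (\<lambda>n. sup_norm closed_polydisc (\<lambda>x. F n x - f x)) \<longlonglongrightarrow> 0"
  proof (rule bexI)
    show "f \<in> polydisc_algebra"
    proof (rule polydisc_algebra_uniform_approx)
      show "f \<in> extensional closed_polydisc" by (simp add: f_def)
      show "\<exists>g\<in>polydisc_algebra. \<forall>z\<in>closed_polydisc. norm (g z - f z) \<le> e" if "e > 0" for e
        using close[OF that] F by blast
    qed
    show "(\<lambda>n. sup_norm closed_polydisc (\<lambda>x. F n x - f x)) \<longlonglongrightarrow> 0"
    proof (rule LIMSEQ_I)
      fix e :: real assume "e > 0"
      then obtain N where N: "\<And>n z. n \<ge> N \<Longrightarrow> z \<in> closed_polydisc \<Longrightarrow> norm (F n z - f z) \<le> e/2"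
        using close[of "e/2"] by auto
      have "norm (sup_norm closed_polydisc (\<lambda>x. F n x - f x) - 0) < e" if "n \<ge> N" for n
      proof -
        have "sup_norm closed_polydisc (\<lambda>x. F n x - f x) \<le> e/2"
          by (rule sup_norm_leI[OF closed_polydisc_nonempty N[OF that]])
        moreover have "0 \<le> sup_norm closed_polydisc (\<lambda>x. F n x - f x)"
          using norm_le_sup_norm[of closed_polydisc "\<lambda>x. F n x - f x", OF N[OF that]]
            closed_polydisc_nonempty norm_ge_zero order_trans by (metis ex_in_conv)
        ultimately show ?thesis using \<open>e > 0\<close> by simp
      qed
      then show "\<exists>N. \<forall>n\<ge>N. norm (sup_norm closed_polydisc (\<lambda>x. F n x - f x) - 0) < e" by blast
    qed
  qed
qed (auto simp: fun_add_def fun_scale_def fun_mult_def polydisc_algebraD(1)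
    intro: polydisc_algebra_const polydisc_algebra_add polydisc_algebra_mult polydisc_algebra_scale)

text \<open>
  Truncation, rotation, dilation and freezing of coordinates are all affine in each coordinate
  separately, so a single substitution rule covers them.
\<close>

lemma affine_closed_polydisc:
  assumes "\<And>i. norm (a i) + norm (b i) \<le> (1::real)" "z \<in> closed_polydisc"
  shows "(\<lambda>i. a i + b i * z i :: complex) \<in> closed_polydisc"
  unfolding mem_closed_polydisc
proof
  fix i
  have "norm (a i + b i * z i) \<le> norm (a i) + norm (b i) * norm (z i)"
    by (metis norm_mult norm_triangle_ineq)
  also have "\<dots> \<le> norm (a i) + norm (b i)"
    using assms(2) by (auto simp: mem_closed_polydisc intro: mult_left_le)
  finally show "norm (a i + b i * z i) \<le> 1" using assms(1)[of i] by linarith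
qed

lemma polydisc_algebra_affine:
  assumes f: "f \<in> polydisc_algebra" and ab: "\<And>i. norm (a i) + norm (b i) \<le> (1::real)"
  shows "(\<lambda>z\<in>closed_polydisc. f (\<lambda>i. a i + b i * z i)) \<in> polydisc_algebra"
proof (rule polydisc_algebra_restrictI)
  show "continuous_on closed_polydisc (\<lambda>z. f (\<lambda>i. a i + b i * z i))"
  proof (rule continuous_on_compose2[OF polydisc_algebraD(2)[OF f]])
    show "continuous_on closed_polydisc (\<lambda>z i. a i + b i * z i)"
      by (intro continuous_on_coordinatewise_then_product continuous_intros
          continuous_on_coord)
  qed (use ab affine_closed_polydisc in blast)
  fix z n assume z: "z \<in> closed_polydisc"
  define y where "y = (\<lambda>i. a i + b i * z i)"
  have y: "y \<in> closed_polydisc" unfolding y_def using ab z by (rule affine_closed_polydisc)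
  have eq: "(\<lambda>i. a i + b i * (z(n := w)) i) = y(n := a n + b n * w)" for w
    by (auto simp: y_def)
  show "(\<lambda>w. f (\<lambda>i. a i + b i * (z(n := w)) i)) holomorphic_on ball 0 1"
  proof (cases "b n = 0")
    case True
    then show ?thesis unfolding eq by simp
  next
    case False
    have "norm (a n + b n * w) < 1" if "norm w < 1" for w
    proof -
      have "norm (b n) * norm w < norm (b n)" using that False by simp
      then show ?thesis using ab[of n] norm_triangle_ineq[of "a n" "b n * w"] by (simp add: norm_mult)
    qed
    then have "((\<lambda>w. f (y(n := w))) \<circ> (\<lambda>w. a n + b n * w)) holomorphic_on ball 0 1"
      by (intro holomorphic_on_compose_gen[OF _ polydisc_algebra_holomorphic_coordinate[OF f y, of n]]
          holomorphic_intros) auto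
    then show ?thesis unfolding eq by (simp add: o_def)
  qed
qed

section \<open>Density of polynomials\<close>

lemma polydisc_algebra_fix_coordinate:
  assumes "f \<in> polydisc_algebra" "norm t \<le> 1"
  shows "(\<lambda>z\<in>closed_polydisc. f (z(n := t))) \<in> polydisc_algebra"
proof -
  have "(\<lambda>z\<in>closed_polydisc. f (\<lambda>i. (if i = n then t else 0) + (if i = n then 0 else 1) * z i)) \<in> polydisc_algebra"
    by (rule polydisc_algebra_affine) (use assms in auto)
  moreover have "(\<lambda>i. (if i = n then t else 0) + (if i = n then 0 else 1) * z i) = z(n := t)" for z :: "nat \<Rightarrow> complex"
    by auto
  ultimately show ?thesis by simp
qed

text \<open>
  The coefficients are uniform limits of difference quotients that are formed inside the algebra by
  freezing the coordinate at a small value.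
\<close>

lemma polydisc_algebra_taylor_coeff:
  assumes f: "f \<in> polydisc_algebra"
  shows "(\<lambda>z\<in>closed_polydisc. taylor_coeff (\<lambda>w. f (z(n := w))) k) \<in> polydisc_algebra"
proof (induction k rule: less_induct)
  case (less k)
  obtain M where M: "M > 0" "\<And>z. z \<in> closed_polydisc \<Longrightarrow> norm (f z) \<le> M"
    by (rule polydisc_algebra_bounded[OF f]) (rule that)
  let ?c = "\<lambda>i z. taylor_coeff (\<lambda>w. f (z(n := w))) i"
  show ?case
  proof (rule polydisc_algebra_uniform_approx)
    fix e :: real assume e: "e > 0"
    define t where "t = min (1/2) (e / (2 * M))"
    have t: "0 < t" "t \<le> 1/2" "2 * M * t \<le> e"
      using e M(1) by (auto simp: t_def min_def field_simps)
    define g where "g = (\<lambda>z\<in>closed_polydisc. (f (z(n := of_real t)) -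
      (\<Sum>i<k. ?c i z * of_real t ^ i)) / of_real t ^ k)"
    have "(\<lambda>z\<in>closed_polydisc. \<Sum>i<k. (\<lambda>z\<in>closed_polydisc. of_real t ^ i * (\<lambda>z\<in>closed_polydisc. ?c i z) z) z)
        \<in> polydisc_algebra"
      by (intro polydisc_algebra_sum polydisc_algebra_scale less.IH) auto
    from polydisc_algebra_scale[OF polydisc_algebra_add[OF polydisc_algebra_fix_coordinate[OF f, of "of_real t" n]
        polydisc_algebra_scale[OF this, of "-1"]], of "1 / of_real t ^ k"]
    have "g \<in> polydisc_algebra"
      using t by (simp add: g_def mult.commute restrict_def cong: if_cong)
    moreover have "norm (g z - (\<lambda>z\<in>closed_polydisc. ?c k z) z) \<le> e" if z: "z \<in> closed_polydisc" for z
    proof -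
      have "norm (g z - ?c k z) \<le> 2 * M * norm (of_real t :: complex) / 1 ^ Suc k"
        unfolding g_def using z t M(2)
        by (simp only: restrict_apply' if_True, intro norm_taylor_quotient_diff_le
            polydisc_algebra_holomorphic_coordinate[OF f z]) (auto intro!: M(2) upd_closed_polydisc)
      then show ?thesis using t z by simp
    qed
    ultimately show "\<exists>g\<in>polydisc_algebra. \<forall>z\<in>closed_polydisc.
        norm (g z - (\<lambda>z\<in>closed_polydisc. ?c k z) z) \<le> e" by blast
  qed (rule restrict_extensional)
qed

text \<open>
  Polynomials are dense, phrased as an induction principle. A function is first replaced by
  its truncation to finitely many coordinates, then dilated and Taylor expanded in the last of
  them; the coefficients depend on one coordinate less.
\<close>

theorem polydisc_algebra_induct [consumes 1, case_names const add mult limit]: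
  assumes f: "f \<in> polydisc_algebra"
    and const: "\<And>c. P (\<lambda>z\<in>closed_polydisc. c)"
    and add: "\<And>f g. f \<in> polydisc_algebra \<Longrightarrow> P f \<Longrightarrow> g \<in> polydisc_algebra \<Longrightarrow> P g \<Longrightarrow>
      P (\<lambda>z\<in>closed_polydisc. f z + g z)"
    and mult: "\<And>f i. f \<in> polydisc_algebra \<Longrightarrow> P f \<Longrightarrow> P (\<lambda>z\<in>closed_polydisc. f z * z i)"
    and limit: "\<And>f. f \<in> polydisc_algebra \<Longrightarrow>
      (\<And>e. e > 0 \<Longrightarrow> \<exists>g\<in>polydisc_algebra. P g \<and> (\<forall>z\<in>closed_polydisc. norm (g z - f z) \<le> e)) \<Longrightarrow> P f"
  shows "P f"
proof -
  have sum: "P (\<lambda>z\<in>closed_polydisc. \<Sum>k<n. g k z)"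
    if "\<And>k. g k \<in> polydisc_algebra" "\<And>k. P (g k)" for g :: "nat \<Rightarrow> _" and n
  proof (induction n)
    case 0
    then show ?case using const[of 0] by (simp add: restrict_def)
  next
    case (Suc n)
    have "P (\<lambda>z\<in>closed_polydisc. (\<lambda>z\<in>closed_polydisc. \<Sum>k<n. g k z) z + g n z)"
      by (intro add Suc polydisc_algebra_sum that) auto
    then show ?case by (simp add: restrict_def cong: if_cong)
  qed
  have pow: "(\<lambda>z\<in>closed_polydisc. g z * z i ^ k) \<in> polydisc_algebra \<and> P (\<lambda>z\<in>closed_polydisc. g z * z i ^ k)"
    if "g \<in> polydisc_algebra" "P g" for g i k
  proof (induction k)
    case 0
    have "(\<lambda>z\<in>closed_polydisc. g z) = g"
      using polydisc_algebraD(1)[OF that(1)] by (rule extensional_restrict)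
    then show ?case using that by simp
  next
    case (Suc k)
    define h where "h = (\<lambda>z\<in>closed_polydisc. g z * z i ^ k)"
    have h: "h \<in> polydisc_algebra" "P h" using Suc by (simp_all only: h_def)
    have eq: "(\<lambda>z\<in>closed_polydisc. g z * z i ^ Suc k) = (\<lambda>z\<in>closed_polydisc. h z * z i)"
      by (auto simp: h_def mult_ac)
    have eq': "(\<lambda>z\<in>closed_polydisc. h z * z i) = (\<lambda>z\<in>closed_polydisc. h z * (\<lambda>z\<in>closed_polydisc. z i) z)"
      by auto
    show ?case
      unfolding eq
      using mult[OF h, of i] polydisc_algebra_mult[OF h(1) polydisc_algebra_coord[of i], folded eq'] by blast
  qed
  have finite_case: "P f" if "f \<in> polydisc_algebra"
    and "\<And>x y. x \<in> closed_polydisc \<Longrightarrow> y \<in> closed_polydisc \<Longrightarrow> (\<And>i. i < m \<Longrightarrow> x i = y i) \<Longrightarrow> f x = f y"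
    for f m
    using that
  proof (induction m arbitrary: f)
    case 0
    have "f = (\<lambda>z\<in>closed_polydisc. f (\<lambda>_. 0))"
    proof (rule extensionalityI[OF polydisc_algebraD(1)[OF 0(1)]])
      fix z assume "z \<in> closed_polydisc"
      then show "f z = (\<lambda>z\<in>closed_polydisc. f (\<lambda>_. 0)) z"
        using 0(2)[of z "\<lambda>_. 0"] by (simp add: mem_closed_polydisc)
    qed simp
    then show ?case using const by metis
  next
    case (Suc m)
    note f = Suc.prems(1)
    obtain M where M: "M > 0" "\<And>z. z \<in> closed_polydisc \<Longrightarrow> norm (f z) \<le> M"
      by (rule polydisc_algebra_bounded[OF f]) (rule that)
    show "P f"
    proof (rule limit[OF f])
      fix e :: real assume e: "e > 0"
      obtain m' d where d: "d > 0" and unif0: "\<forall>x\<in>closed_polydisc. \<forall>y\<in>closed_polydisc.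
      (\<forall>i<m'. norm (x i - y i) < d) \<longrightarrow> norm (f x - f y) < e/2"
    using closed_polydisc_uniform_continuity[OF polydisc_algebraD(2)[OF f] half_gt_zero[OF e]] by blast
  note unif = unif0[rule_format]
      define r where "r = max (1/2) (1 - d/2)"
      have r: "0 < r" "r < 1" "1 - r < d" using d by (auto simp: r_def)
      have "(\<lambda>n. M * r ^ n / (1 - r)) \<longlonglongrightarrow> M * 0 / (1 - r)"
        using r by (intro tendsto_intros LIMSEQ_power_zero) auto
      from order_tendstoD(2)[OF this, of "e/2"]
      have "\<forall>\<^sub>F n in sequentially. M * r ^ n / (1 - r) < e/2" using e by simp
      then obtain n where n: "M * r ^ n / (1 - r) < e/2" by (auto simp: eventually_sequentially)
      define c where "c = (\<lambda>k. \<lambda>z\<in>closed_polydisc. of_real r ^ k *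
        (\<lambda>z\<in>closed_polydisc. taylor_coeff (\<lambda>w. f (z(m := w))) k) z)"
      have c: "c k \<in> polydisc_algebra" for k
        unfolding c_def by (intro polydisc_algebra_scale polydisc_algebra_taylor_coeff f)
      have Pc: "P (c k)" for k
      proof (rule Suc.IH[OF c])
        fix x y :: "nat \<Rightarrow> complex"
        assume xy: "x \<in> closed_polydisc" "y \<in> closed_polydisc" "\<And>i. i < m \<Longrightarrow> x i = y i"
        have ev: "f (x(m := w)) = f (y(m := w))" if "norm w < 1" for w
          by (rule Suc.prems(2)) (use xy that in \<open>auto simp: less_Suc_eq mem_closed_polydisc\<close>)
        have "\<forall>\<^sub>F w in nhds 0. f (x(m := w)) = f (y(m := w))"
          unfolding eventually_nhds using ev
          by (intro exI[of _ "ball 0 1"]) auto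
        then show "c k x = c k y"
          unfolding c_def taylor_coeff_def using xy(1,2) by (simp add: higher_deriv_cong_ev)
      qed
      define g where "g = (\<lambda>z\<in>closed_polydisc. \<Sum>k<n. (\<lambda>z\<in>closed_polydisc. c k z * z m ^ k) z)"
      have pw: "(\<lambda>z\<in>closed_polydisc. c k z * z m ^ k) \<in> polydisc_algebra"
        "P (\<lambda>z\<in>closed_polydisc. c k z * z m ^ k)" for k
        using pow[OF c Pc] by blast+
      have "g \<in> polydisc_algebra" "P g"
        unfolding g_def by (rule polydisc_algebra_sum sum finite_lessThan pw)+
      moreover have "norm (g z - f z) \<le> e" if z: "z \<in> closed_polydisc" for z
      proof -
        have zm: "norm (z m) \<le> 1" using z by (simp add: mem_closed_polydisc)
        have rz: "norm (of_real r * z m) \<le> r" using r zm by (simp add: norm_mult mult_left_le)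
        have "norm (f (z(m := of_real r * z m)) - (\<Sum>k<n. taylor_coeff (\<lambda>w. f (z(m := w))) k * (of_real r * z m) ^ k))
          \<le> M * (norm (of_real r * z m) / 1) ^ n / (1 - norm (of_real r * z m) / 1)"
          by (rule norm_taylor_remainder_le[OF polydisc_algebra_holomorphic_coordinate[OF f z]])
            (use z r rz in \<open>auto intro!: M(2) simp: mem_closed_polydisc\<close>)
        also have "\<dots> \<le> M * r ^ n / (1 - r)"
          using M(1) r rz by (intro frac_le mult_left_mono power_mono) auto
        also have "(\<Sum>k<n. taylor_coeff (\<lambda>w. f (z(m := w))) k * (of_real r * z m) ^ k) = g z"
          using z by (simp add: g_def c_def power_mult_distrib mult_ac)
        finally have 1: "norm (f (z(m := of_real r * z m)) - g z) < e/2" using n by linarith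
        have "norm (z m - of_real r * z m) < d"
        proof -
          have "z m - of_real r * z m = of_real (1 - r) * z m" by (simp add: algebra_simps)
          then have "norm (z m - of_real r * z m) = (1 - r) * norm (z m)"
            using r by (simp only: norm_mult norm_of_real)
          also have "\<dots> \<le> 1 - r" using zm r by (intro mult_left_le) auto
          finally show ?thesis using r by linarith
        qed
        then have 2: "norm (f z - f (z(m := of_real r * z m))) < e/2"
          by (intro unif upd_closed_polydisc z) (use rz r d in auto)
        show ?thesis
          using norm_triangle_ineq[of "f z - f (z(m := of_real r * z m))" "f (z(m := of_real r * z m)) - g z"] 1 2
          by (simp add: norm_minus_commute)
      qed
      ultimately show "\<exists>g\<in>polydisc_algebra. P g \<and> (\<forall>z\<in>closed_polydisc. norm (g z - f z) \<le> e)"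
        by blast
    qed
  qed
  show "P f"
  proof (rule limit[OF f])
    fix e :: real assume e: "e > 0"
    obtain m d where d: "d > 0" and unif0: "\<forall>x\<in>closed_polydisc. \<forall>y\<in>closed_polydisc.
      (\<forall>i<m. norm (x i - y i) < d) \<longrightarrow> norm (f x - f y) < e"
    using closed_polydisc_uniform_continuity[OF polydisc_algebraD(2)[OF f] e] by blast
  note unif = unif0[rule_format]
    define \<tau> :: "(nat \<Rightarrow> complex) \<Rightarrow> nat \<Rightarrow> complex" where "\<tau> z = (\<lambda>i. 0 + (if i < m then 1 else 0) * z i)" for z
    have \<tau>: "\<tau> z \<in> closed_polydisc" if "z \<in> closed_polydisc" for z
      using that by (auto simp: \<tau>_def mem_closed_polydisc)
    have "(\<lambda>z\<in>closed_polydisc. f (\<tau> z)) \<in> polydisc_algebra"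
      unfolding \<tau>_def by (rule polydisc_algebra_affine[OF f]) auto
    moreover from this have "P (\<lambda>z\<in>closed_polydisc. f (\<tau> z))"
    proof (rule finite_case)
      fix x y assume "x \<in> closed_polydisc" "y \<in> closed_polydisc" "\<And>i. i < m \<Longrightarrow> x i = y i"
      moreover from this have "\<tau> x = \<tau> y" by (auto simp: \<tau>_def)
      ultimately show "(\<lambda>z\<in>closed_polydisc. f (\<tau> z)) x = (\<lambda>z\<in>closed_polydisc. f (\<tau> z)) y" by simp
    qed
    moreover have "norm ((\<lambda>z\<in>closed_polydisc. f (\<tau> z)) z - f z) \<le> e" if "z \<in> closed_polydisc" for z
      using unif[OF \<tau>[OF that] that] that d by (simp add: \<tau>_def)
    ultimately show "\<exists>g\<in>polydisc_algebra. P g \<and> (\<forall>z\<in>closed_polydisc. norm (g z - f z) \<le> e)" by blast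
  qed
qed

section \<open>Sharp truncation of trigonometric polynomials\<close>

lemma sin_ge_linear:
  assumes "0 \<le> x" "x \<le> pi / 2" shows "2 * x / pi \<le> sin x"
proof -
  have "concave_on {0..pi} sin"
  proof (rule f''_le0_imp_concave)
    show "(sin has_real_derivative cos x) (at x)" for x :: real
      by (rule DERIV_sin)
    show "(cos has_real_derivative - sin x) (at x)" for x :: real
      by (rule DERIV_cos)
    show "- sin x \<le> 0" if "x \<in> {0..pi}" for x
      using that by (auto intro: sin_ge_zero)
  qed auto
  from concave_onD[OF this, of "2 * x / pi" 0 "pi/2"] assms show ?thesis
    by (simp add: field_simps)
qed

text \<open>
  The sum of the reciprocals of \<open>u\<close> and \<open>1 - u\<close> replaces the reciprocal of the distance of \<open>u\<close> to the
  nearest integer, and can be summed without distinguishing cases.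
\<close>

lemma inverse_sin_le:
  assumes "0 < u" "u < 1" shows "1 / sin (pi * u) \<le> (1 / u + 1 / (1 - u)) / 2"
proof (cases "u \<le> 1/2")
  case True
  have "2 * (pi * u) / pi \<le> sin (pi * u)"
    using assms True by (intro sin_ge_linear) auto
  then have "2 * u \<le> sin (pi * u)" by simp
  then have "1 / sin (pi * u) \<le> 1 / (2 * u)" using assms by (intro divide_left_mono) auto
  also have "\<dots> = 1 / u / 2" by simp
  also have "\<dots> \<le> (1 / u + 1 / (1 - u)) / 2" using assms by (intro divide_right_mono) auto
  finally show ?thesis .
next
  case False
  have "2 * (pi * (1 - u)) / pi \<le> sin (pi * (1 - u))"
    using assms False by (intro sin_ge_linear) (auto simp: field_simps)
  also have "sin (pi * (1 - u)) = sin (pi * u)"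
    using sin_pi_minus[of "pi * u"] by (simp add: algebra_simps)
  finally have "2 * (1 - u) \<le> sin (pi * u)" by simp
  then have "1 / sin (pi * u) \<le> 1 / (2 * (1 - u))" using assms by (intro divide_left_mono) auto
  also have "\<dots> = 1 / (1 - u) / 2" by simp
  also have "\<dots> \<le> (1 / u + 1 / (1 - u)) / 2" using assms by (intro divide_right_mono) auto
  finally show ?thesis .
qed

lemma sum_inverse_le_ln:
  assumes "T \<ge> 1" shows "T \<le> R \<Longrightarrow> (\<Sum>t\<in>{T<..R}. 1 / real t) \<le> ln (real R / real T)"
proof (induction R rule: dec_induct)
  case base
  then show ?case using assms by simp
next
  case (step n)
  have "ln (real n / real (Suc n)) \<le> real n / real (Suc n) - 1"
    using step assms by (intro ln_le_minus_one) auto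
  also have "\<dots> = - (1 / real (Suc n))" by (simp add: field_simps)
  finally have "1 / real (Suc n) \<le> ln (real (Suc n)) - ln (real n)"
    using step assms by (simp add: ln_div)
  moreover have "{T<..Suc n} = insert (Suc n) {T<..n}" using step by auto
  ultimately show ?case using step assms by (simp add: ln_div)
qed

definition dirichlet_sum :: "nat \<Rightarrow> complex \<Rightarrow> complex" where
  "dirichlet_sum K w = (\<Sum>k\<le>K. w ^ k)"

definition unity_root :: "nat \<Rightarrow> nat \<Rightarrow> complex" where
  "unity_root R t = cis (2 * pi * real t / real R)"

lemma norm_unity_root [simp]: "norm (unity_root R t) = 1"
  by (simp add: unity_root_def)

lemma norm_dirichlet_sum_unity_root_le:
  assumes "0 < t" "t < R"
  shows "norm (dirichlet_sum K (unity_root R t)) \<le> real R / 2 * (1 / real t + 1 / real (R - t))"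
proof -
  let ?w = "unity_root R t" and ?u = "real t / real R"
  have u: "0 < ?u" "?u < 1" using assms by auto
  have "norm (1 - ?w) = 2 * \<bar>sin (pi * ?u)\<bar>"
    using dist_exp_i_1[of "2 * pi * real t / real R"]
    by (simp add: unity_root_def cis_conv_exp norm_minus_commute)
  moreover have sp: "sin (pi * ?u) > 0"
    using mult_strict_left_mono[OF u(2) pi_gt_zero] mult_pos_pos[OF pi_gt_zero u(1)]
    by (intro sin_gt_zero) simp_all
  ultimately have nw: "norm (1 - ?w) = 2 * sin (pi * ?u)" by simp
  then have ne: "?w \<noteq> 1" using sp by auto
  have "norm (1 - ?w) * norm (dirichlet_sum K ?w) = norm (1 - ?w ^ Suc K)"
    unfolding dirichlet_sum_def norm_mult[symmetric] sum_gp_basic ..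
  then have "norm (dirichlet_sum K ?w) = norm (1 - ?w ^ Suc K) / norm (1 - ?w)"
    using ne by (simp add: eq_divide_eq mult.commute del: power_Suc)
  also have "\<dots> \<le> 2 / norm (1 - ?w)"
    using norm_triangle_ineq4[of 1 "?w ^ Suc K"] by (intro divide_right_mono) (auto simp: norm_power norm_mult)
  also have "\<dots> = 1 / sin (pi * ?u)" using nw by simp
  also have "\<dots> \<le> (1 / ?u + 1 / (1 - ?u)) / 2" by (rule inverse_sin_le[OF u])
  also have "\<dots> = real R / 2 * (1 / real t + 1 / real (R - t))"
    using assms by (simp add: of_nat_diff field_simps)
  finally show ?thesis .
qed

text \<open>
  The discrete Lebesgue constant. Around the root \<open>1\<close> the trivial bound \<open>K + 1\<close> is used on
  \<open>2 T + 1\<close> of the \<open>(K + 1) T\<close> roots of unity, elsewhere the geometric sum is summed.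
\<close>

lemma lebesgue_constant_le:
  assumes T: "T \<ge> 1" and R: "R = (K + 1) * T"
  shows "(\<Sum>t<R. norm (dirichlet_sum K (unity_root R t))) \<le> real R * (3 + ln (real (K + 1)))"
proof -
  let ?h = "\<lambda>t. norm (dirichlet_sum K (unity_root R t))"
  let ?near = "{t. t < R \<and> (t \<le> T \<or> R - t \<le> T)}" and ?far = "{t. t < R \<and> T < t \<and> T < R - t}"
  have "?near \<subseteq> {..T} \<union> {R - T..<R}" by auto
  then have "card ?near \<le> card ({..T} \<union> {R - T..<R})" by (intro card_mono) auto
  also have "\<dots> \<le> 2 * T + 1" using card_Un_le[of "{..T}" "{R - T..<R}"] by simp
  finally have card: "real (card ?near) \<le> 3 * real T" using T by simp
  have triv: "?h t \<le> real (K + 1)" for t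
    using sum_norm_le[of "{..K}" "\<lambda>k. unity_root R t ^ k" "\<lambda>_. 1"]
    by (simp add: dirichlet_sum_def norm_power)
  have "sum ?h ?near \<le> real (card ?near) * real (K + 1)"
    using sum_bounded_above[of ?near ?h "real (K + 1)"] triv by simp
  also have "\<dots> \<le> 3 * real T * real (K + 1)" using card by (intro mult_right_mono) auto
  also have "\<dots> = 3 * real R" by (simp add: R algebra_simps)
  finally have near: "sum ?h ?near \<le> 3 * real R" .
  have "real R = real (K + 1) * real T" unfolding R by (rule of_nat_mult)
  then have ln: "ln (real R / real T) = ln (real (K + 1))" using T by simp
  have TR: "T \<le> R" using T by (simp add: R)
  have 1: "(\<Sum>t\<in>?far. 1 / real t) \<le> ln (real (K + 1))"
  proof -
    have "(\<Sum>t\<in>?far. 1 / real t) \<le> (\<Sum>t\<in>{T<..R}. 1 / real t)" by (intro sum_mono2) auto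
    then show ?thesis using sum_inverse_le_ln[OF T TR] ln by simp
  qed
  have "(\<Sum>t\<in>?far. 1 / real (R - t)) = (\<Sum>t\<in>?far. 1 / real t)"
    by (rule sum.reindex_bij_witness[of _ "\<lambda>t. R - t" "\<lambda>t. R - t"]) auto
  then have 2: "(\<Sum>t\<in>?far. 1 / real (R - t)) \<le> ln (real (K + 1))" using 1 by simp
  have "sum ?h ?far \<le> (\<Sum>t\<in>?far. real R / 2 * (1 / real t + 1 / real (R - t)))"
    by (intro sum_mono norm_dirichlet_sum_unity_root_le) auto
  also have "\<dots> = real R / 2 * ((\<Sum>t\<in>?far. 1 / real t) + (\<Sum>t\<in>?far. 1 / real (R - t)))"
    by (simp only: sum_distrib_left sum.distrib distrib_left)
  also have "\<dots> \<le> real R / 2 * (ln (real (K + 1)) + ln (real (K + 1)))"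
    using 1 2 by (intro mult_left_mono add_mono) auto
  finally have far: "sum ?h ?far \<le> real R * ln (real (K + 1))" by simp
  have "{..<R} = ?near \<union> ?far" by auto
  moreover have "sum ?h (?near \<union> ?far) = sum ?h ?near + sum ?h ?far"
    by (rule sum.union_disjoint) auto
  ultimately show ?thesis using near far by (simp add: algebra_simps)
qed

lemma sum_unity_root_power:
  assumes "R > 0" "\<bar>int k - int l\<bar> < int R"
  shows "(\<Sum>t<R. unity_root R t ^ k * cnj (unity_root R t) ^ l) = (if k = l then of_nat R else 0)"
proof -
  define w where "w = cis (2 * pi * (real k - real l) / real R)"
  have eq: "unity_root R t ^ k * cnj (unity_root R t) ^ l = w ^ t" for t
    by (simp add: unity_root_def w_def Complex.DeMoivre cis_cnj cis_mult algebra_simps diff_divide_distrib)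
  show ?thesis
  proof (cases "k = l")
    case True
    then show ?thesis unfolding eq by (simp add: w_def)
  next
    case False
    have "w ^ R = cis (2 * pi * (real k - real l))"
      using assms by (simp add: w_def Complex.DeMoivre)
    also have "\<dots> = 1" using cis_multiple_2pi[of "of_int (int k - int l)"] by simp
    finally have wR: "w ^ R = 1" .
    have "w \<noteq> 1"
    proof
      assume "w = 1"
      then have "cos (2 * pi * (real k - real l) / real R) = 1" by (simp add: w_def complex_eq_iff)
      then obtain n :: int where "2 * pi * (real k - real l) / real R = of_int n * 2 * pi"
        using cos_one_2pi_int by auto
      then have "(2 * pi) * ((real k - real l) / real R) = (2 * pi) * of_int n" by (simp add: mult_ac)
      then have "(real k - real l) / real R = of_int n" by (simp only: mult_cancel_left) simp
      then have "real k - real l = of_int n * real R" using assms by (simp add: field_simps)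
      then have "of_int (int k - int l) = (of_int (n * int R) :: real)" by simp
      then have "int k - int l = n * int R" by (simp only: of_int_eq_iff)
      then have "int R dvd int k - int l" by simp
      with assms(2) False show False using dvd_imp_le_int[of "int k - int l" "int R"] by simp
    qed
    then show ?thesis unfolding eq using False wR by (simp add: sum_gp_strict)
  qed
qed

text \<open>
  The average of \<open>w ^ k\<close> times the conjugate Dirichlet kernel over the \<open>R\<close>-th roots of unity is \<open>1\<close> for
  \<open>k \<le> K\<close> and \<open>0\<close> for \<open>K < k < R\<close>. Cutting off the frequencies above \<open>K\<close> thus costs the mean
  modulus of the kernel, and \<open>R\<close> may be chosen as a large multiple of \<open>K + 1\<close>.
\<close>

theorem norm_low_frequency_sum_le:
  fixes b :: "'i \<Rightarrow> complex" and k :: "'i \<Rightarrow> nat"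
  assumes J: "finite J" and M: "\<And>w. norm w = 1 \<Longrightarrow> norm (\<Sum>j\<in>J. b j * w ^ k j) \<le> M"
  shows "norm (\<Sum>j\<in>{j\<in>J. k j \<le> K}. b j) \<le> M * (3 + ln (real (K + 1)))"
proof -
  define T where "T = Suc (Max (insert 0 (k ` J)))"
  define R where "R = (K + 1) * T"
  have T: "T \<ge> 1" by (simp add: T_def)
  have kT: "k j < T" if "j \<in> J" for j
    unfolding T_def using J that by (simp add: less_Suc_eq_le)
  have "T \<le> R" "K < R" using mult_le_mono2[OF T, of "K + 1"] by (simp_all add: R_def)
  then have R0: "R > 0" by simp
  have coeff: "(\<Sum>l\<le>K. if k j = l then of_nat R else 0) = (if k j \<le> K then of_nat R else (0::complex))" for j
    by simp
  have "(\<Sum>t<R. (\<Sum>j\<in>J. b j * unity_root R t ^ k j) * cnj (dirichlet_sum K (unity_root R t)))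
      = (\<Sum>t<R. \<Sum>j\<in>J. \<Sum>l\<le>K. b j * (unity_root R t ^ k j * cnj (unity_root R t) ^ l))"
    by (simp add: dirichlet_sum_def sum_product mult.assoc)
  also have "\<dots> = (\<Sum>j\<in>J. \<Sum>t<R. \<Sum>l\<le>K. b j * (unity_root R t ^ k j * cnj (unity_root R t) ^ l))"
    by (rule sum.swap)
  also have "\<dots> = (\<Sum>j\<in>J. \<Sum>l\<le>K. \<Sum>t<R. b j * (unity_root R t ^ k j * cnj (unity_root R t) ^ l))"
    by (intro sum.cong refl sum.swap)
  also have "\<dots> = (\<Sum>j\<in>J. \<Sum>l\<le>K. b j * (if k j = l then of_nat R else 0))"
    unfolding sum_distrib_left[symmetric]
    using kT \<open>T \<le> R\<close> \<open>K < R\<close> R0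
    by (intro sum.cong refl arg_cong2[where f="(*)"] sum_unity_root_power) (auto simp: abs_if dest!: kT)
  also have "\<dots> = (\<Sum>j\<in>J. b j * (if k j \<le> K then of_nat R else 0))"
    unfolding sum_distrib_left[symmetric] coeff ..
  also have "\<dots> = of_nat R * (\<Sum>j\<in>J. if k j \<le> K then b j else 0)"
    by (simp add: sum_distrib_left mult.commute if_distrib cong: if_cong)
  also have "(\<Sum>j\<in>J. if k j \<le> K then b j else 0) = (\<Sum>j\<in>{j\<in>J. k j \<le> K}. b j)"
    using J by (simp add: sum.inter_filter)
  finally have eq: "of_nat R * (\<Sum>j\<in>{j\<in>J. k j \<le> K}. b j) =
    (\<Sum>t<R. (\<Sum>j\<in>J. b j * unity_root R t ^ k j) * cnj (dirichlet_sum K (unity_root R t)))" by simp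
  have M0: "M \<ge> 0" using M[of 1] norm_ge_zero order_trans by (metis norm_one)
  have "real R * norm (\<Sum>j\<in>{j\<in>J. k j \<le> K}. b j) = norm (of_nat R * (\<Sum>j\<in>{j\<in>J. k j \<le> K}. b j))"
    by (simp add: norm_mult)
  also have "\<dots> \<le> (\<Sum>t<R. M * norm (dirichlet_sum K (unity_root R t)))"
    unfolding eq by (intro sum_norm_le) (auto simp: norm_mult intro!: mult_right_mono M)
  also have "\<dots> \<le> M * (real R * (3 + ln (real (K + 1))))"
    unfolding sum_distrib_left[symmetric]
    by (intro mult_left_mono lebesgue_constant_le[OF T] M0 R_def)
  also have "\<dots> = real R * (M * (3 + ln (real (K + 1))))" by (simp only: mult_ac)
  finally show ?thesis using R0 by (simp only: mult_le_cancel_left_pos of_nat_0_less_iff)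
qed

section \<open>Monomials indexed by integers\<close>

definition nth_prime :: "nat \<Rightarrow> nat" where
  "nth_prime = enumerate {p. prime p}"

definition prime_index :: "nat \<Rightarrow> nat" where
  "prime_index = inv_into UNIV nth_prime"

lemma bij_nth_prime: "bij_betw nth_prime UNIV {p. prime p}"
  unfolding nth_prime_def by (rule bij_enumerate[OF primes_infinite])

lemma prime_nth_prime [simp]: "prime (nth_prime i)"
  using bij_nth_prime by (auto simp: bij_betw_def)

lemma prime_index_nth_prime [simp]: "prime_index (nth_prime i) = i"
  unfolding prime_index_def using bij_nth_prime by (intro inv_into_f_f) (auto simp: bij_betw_def)

lemma nth_prime_prime_index: "prime p \<Longrightarrow> nth_prime (prime_index p) = p"
  unfolding prime_index_def using bij_nth_prime by (intro f_inv_into_f) (auto simp: bij_betw_def)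

lemma nth_prime_ge_2: "nth_prime i \<ge> 2"
  by (rule prime_ge_2_nat) simp

lemma nth_prime_pos [simp]: "nth_prime i > 0"
  using nth_prime_ge_2[of i] by simp

text \<open>Bohr's dictionary: the exponents of \<open>n\<close> are read as a multiindex.\<close>

definition monomial :: "nat \<Rightarrow> (nat \<Rightarrow> complex) \<Rightarrow> complex" where
  "monomial n z = (\<Prod>p\<in>#prime_factorization n. z (prime_index p))"

lemma monomial_1 [simp]: "monomial (Suc 0) z = 1"
  by (simp add: monomial_def)

lemma monomial_mult: "m > 0 \<Longrightarrow> n > 0 \<Longrightarrow> monomial (m * n) z = monomial m z * monomial n z"
  by (simp add: monomial_def prime_factorization_mult)

lemma monomial_prime [simp]: "monomial (nth_prime i) z = z i"
  by (simp add: monomial_def prime_factorization_prime)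

lemma monomial_times: "monomial n (\<lambda>i. a i * z i) = monomial n a * monomial n z"
  by (simp add: monomial_def prod_mset.distrib)

lemma pos_nat_prime_induct [consumes 1, case_names one factor]:
  assumes "n > 0" "P (Suc 0)" "\<And>i m. m > 0 \<Longrightarrow> P m \<Longrightarrow> P (nth_prime i * m)"
  shows "P (n :: nat)"
proof -
  have "n > 0 \<longrightarrow> P n"
  proof (induction n rule: prime_divisors_induct)
    case (factor p x)
    then show ?case using assms(3)[of x "prime_index p"] by (auto simp: nth_prime_prime_index)
  qed (use assms(2) in auto)
  with assms(1) show ?thesis by blast
qed

text \<open>
  A completely multiplicative function is determined by its values at the primes.
\<close>

lemma monomial_eqI:
  assumes n: "n > 0" and f1: "f (Suc 0) = 1"
    and f: "\<And>i m. m > 0 \<Longrightarrow> f (nth_prime i * m) = z i * f m"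
  shows "monomial n z = f n"
  using n by (induction rule: pos_nat_prime_induct) (simp_all add: f1 f monomial_mult)

definition bohr_point :: "complex \<Rightarrow> nat \<Rightarrow> complex" where
  "bohr_point s i = of_nat (nth_prime i) powr (-s)"

lemma norm_of_nat_powr: "n > 0 \<Longrightarrow> norm (of_nat n powr s :: complex) = real n powr Re s"
  using norm_powr_real_powr[of "of_nat n" s] by simp

lemma norm_bohr_point: "norm (bohr_point s i) = real (nth_prime i) powr (- Re s)"
  by (simp add: bohr_point_def norm_of_nat_powr)

lemma bohr_point_closed_polydisc: "Re s \<ge> 0 \<Longrightarrow> bohr_point s \<in> closed_polydisc"
  using nth_prime_ge_2
  by (auto simp: mem_closed_polydisc norm_bohr_point powr_le_one_le powr_minus_divide
      intro!: divide_le_eq_1_pos[THEN iffD2] ge_one_powr_ge_zero order_trans[OF _ nth_prime_ge_2])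

lemma of_nat_mult_powr: "m > 0 \<Longrightarrow> n > 0 \<Longrightarrow>
    of_nat (m * n) powr s = of_nat m powr s * (of_nat n powr s :: complex)"
  using powr_times_real[of "of_nat m" "of_nat n" s] by simp

lemma monomial_bohr_point: "n > 0 \<Longrightarrow> monomial n (bohr_point s) = of_nat n powr (-s)"
  by (rule monomial_eqI) (simp_all add: bohr_point_def of_nat_mult_powr del: of_nat_mult)

section \<open>Bohr's inequality for partial sums\<close>

text \<open>
  Integer weights \<open>\<lfloor>Q log p\<rfloor>\<close> on the primes extend additively to all \<open>n\<close>. For \<open>Q\<close> of the order
  of \<open>N\<^sup>2\<close> they separate the integers up to \<open>N\<close> from the others, so that cutting a Dirichlet
  polynomial at \<open>N\<close> becomes cutting a trigonometric polynomial at a frequency.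
\<close>

definition log_weight :: "real \<Rightarrow> nat \<Rightarrow> nat" where
  "log_weight Q n = (\<Sum>p\<in>#prime_factorization n. nat \<lfloor>Q * ln (real p)\<rfloor>)"

lemma log_weight_mult: "m > 0 \<Longrightarrow> n > 0 \<Longrightarrow> log_weight Q (m * n) = log_weight Q m + log_weight Q n"
  by (simp add: log_weight_def prime_factorization_mult)

lemma log_weight_1 [simp]: "log_weight Q (Suc 0) = 0"
  by (simp add: log_weight_def)

lemma log_weight_prime [simp]: "log_weight Q (nth_prime i) = nat \<lfloor>Q * ln (real (nth_prime i))\<rfloor>"
  by (simp add: log_weight_def prime_factorization_prime)

text \<open>
  Rounding loses at most \<open>1\<close> at each prime factor, and \<open>1 \<le> 2 log p\<close>.
\<close>

lemma log_weight_bounds: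
  assumes "Q \<ge> 2" "n > 0"
  shows "(Q - 2) * ln (real n) \<le> real (log_weight Q n)" "real (log_weight Q n) \<le> Q * ln (real n)"
proof -
  have "(Q - 2) * ln (real n) \<le> real (log_weight Q n) \<and> real (log_weight Q n) \<le> Q * ln (real n)"
    using assms(2)
  proof (induction rule: pos_nat_prime_induct)
    case (factor i m)
    let ?p = "nth_prime i"
    have p: "real ?p \<ge> 2" using nth_prime_ge_2[of i] by simp
    have "ln 2 \<le> ln (real ?p)" using p by simp
    then have l: "ln (real ?p) \<ge> 1/2" using ln2_ge_two_thirds by linarith
    have fl: "0 \<le> Q * ln (real ?p)" using assms l by (intro mult_nonneg_nonneg) linarith+
    have "real (log_weight Q ?p) \<le> Q * ln (real ?p)" using fl by simp
    moreover have "(Q - 2) * ln (real ?p) \<le> real (log_weight Q ?p)"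
    proof -
      have "Q * ln (real ?p) - 1 \<le> real_of_int \<lfloor>Q * ln (real ?p)\<rfloor>" by linarith
      also have "\<dots> \<le> real (nat \<lfloor>Q * ln (real ?p)\<rfloor>)" by simp
      finally show ?thesis using l by (simp add: algebra_simps)
    qed
    moreover have "ln (real (?p * m)) = ln (real ?p) + ln (real m)"
      using factor p by (simp add: ln_mult)
    ultimately show ?case
      using factor by (simp add: log_weight_mult algebra_simps del: log_weight_prime)
  qed simp
  then show "(Q - 2) * ln (real n) \<le> real (log_weight Q n)" "real (log_weight Q n) \<le> Q * ln (real n)"
    by auto
qed

lemma log_weight_separates:
  assumes N: "N \<ge> 1" and n: "n > 0" and Q: "Q = 2 * (real N + 1)\<^sup>2"
  shows "log_weight Q n \<le> nat \<lfloor>Q * ln (real N)\<rfloor> \<longleftrightarrow> n \<le> N"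
proof -
  have "1 \<le> (real N + 1)\<^sup>2" by (simp add: power2_eq_square algebra_simps)
  then have Q2: "Q \<ge> 2" unfolding Q by linarith
  note b = log_weight_bounds[OF Q2 n]
  show ?thesis
  proof
    assume "n \<le> N"
    then have "Q * ln (real n) \<le> Q * ln (real N)" using n Q2 by (intro mult_left_mono) auto
    with b have "real (log_weight Q n) \<le> Q * ln (real N)" by linarith
    then show "log_weight Q n \<le> nat \<lfloor>Q * ln (real N)\<rfloor>" by (simp add: le_nat_floor)
  next
    assume le: "log_weight Q n \<le> nat \<lfloor>Q * ln (real N)\<rfloor>"
    show "n \<le> N"
    proof (rule ccontr)
      assume "\<not> n \<le> N"
      then have "ln (real N + 1) \<le> ln (real n)" using N by simp
      then have "(Q - 2) * ln (real N + 1) \<le> (Q - 2) * ln (real n)" using Q2 by (intro mult_left_mono) auto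
      also have "\<dots> \<le> real (log_weight Q n)" by (rule b)
      also have "\<dots> \<le> real (nat \<lfloor>Q * ln (real N)\<rfloor>)" using le by simp
      also have "\<dots> \<le> Q * ln (real N)" using Q2 N by simp
      finally have "Q * (ln (real N + 1) - ln (real N)) \<le> 2 * ln (real N + 1)" by (simp add: algebra_simps)
      also have "\<dots> \<le> 2 * real N" using ln_le_minus_one[of "real N + 1"] by simp
      finally have 1: "Q * (ln (real N + 1) - ln (real N)) \<le> 2 * real N" .
      \<comment> \<open>The gap of the logarithms is at least \<open>1 / (N + 1)\<close>, which this \<open>Q\<close> magnifies to \<open>2 (N + 1)\<close>.\<close>
      have "1 / (real N + 1) \<le> ln (real N + 1) - ln (real N)"
      proof -
        have "ln (real N / (real N + 1)) \<le> real N / (real N + 1) - 1"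
          using N by (intro ln_le_minus_one) auto
        then show ?thesis using N by (simp add: ln_div field_simps)
      qed
      then have "Q * (1 / (real N + 1)) \<le> Q * (ln (real N + 1) - ln (real N))"
        using Q2 by (intro mult_left_mono) auto
      moreover have "Q * (1 / (real N + 1)) = 2 * (real N + 1)"
        unfolding Q by (simp add: power2_eq_square)
      ultimately have "2 * (real N + 1) \<le> 2 * real N" using 1 by (metis order_trans)
      then show False by simp
    qed
  qed
qed

lemma monomial_power_weight:
  assumes "n > 0"
  shows "monomial n (\<lambda>i. w ^ log_weight Q (nth_prime i) * z i) = w ^ log_weight Q n * monomial n z"
proof -
  have "monomial n (\<lambda>i. w ^ log_weight Q (nth_prime i)) = w ^ log_weight Q n"
    using assms by (rule monomial_eqI) (simp_all add: log_weight_mult power_add del: log_weight_prime)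
  then show ?thesis by (simp add: monomial_times)
qed

text \<open>
  Bohr's inequality. The substitution \<open>z\<^sub>i \<mapsto> w ^ k\<^sub>i z\<^sub>i\<close> with the weights \<open>k\<^sub>i\<close> of the primes maps the
  polydisc into itself for \<open>\<bar>w\<bar> = 1\<close> and turns a polynomial into a trigonometric polynomial in \<open>w\<close>
  whose frequencies up to \<open>K\<close> are those of the terms \<open>n \<le> N\<close>. The Lebesgue constant is of order
  \<open>log K\<close>, and \<open>K\<close> is at most of order \<open>N\<^sup>3\<close>.
\<close>

theorem norm_partial_sum_le:
  assumes M: "\<And>z. z \<in> closed_polydisc \<Longrightarrow> norm (\<Sum>n\<in>{1..L}. a n * monomial n z) \<le> M"
    and z: "z \<in> closed_polydisc" and N: "1 \<le> N" "N \<le> L"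
  shows "norm (\<Sum>n\<in>{1..N}. a n * monomial n z) \<le> M * (4 + 3 * ln (real N + 1))"
proof -
  define Q where "Q = 2 * (real N + 1)\<^sup>2"
  define K where "K = nat \<lfloor>Q * ln (real N)\<rfloor>"
  have Q0: "Q \<ge> 0" by (simp add: Q_def)
  have M0: "M \<ge> 0" using order_trans[OF norm_ge_zero M[OF z]] .
  have "norm (\<Sum>n\<in>{n\<in>{1..L}. log_weight Q n \<le> K}. a n * monomial n z) \<le> M * (3 + ln (real (K + 1)))"
  proof (rule norm_low_frequency_sum_le)
    fix w :: complex assume w: "norm w = 1"
    have "(\<lambda>i. w ^ log_weight Q (nth_prime i) * z i) \<in> closed_polydisc"
      using z w by (auto simp: mem_closed_polydisc norm_mult norm_power)
    note le = M[OF this]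
    have "(\<Sum>n\<in>{1..L}. a n * monomial n (\<lambda>i. w ^ log_weight Q (nth_prime i) * z i)) =
        (\<Sum>n\<in>{1..L}. a n * monomial n z * w ^ log_weight Q n)"
      by (rule sum.cong) (auto simp: monomial_power_weight simp del: log_weight_prime)
    with le show "norm (\<Sum>n\<in>{1..L}. a n * monomial n z * w ^ log_weight Q n) \<le> M" by simp
  qed auto
  moreover have "{n\<in>{1..L}. log_weight Q n \<le> K} = {1..N}"
    using N log_weight_separates[OF N(1) _ Q_def] unfolding K_def by auto
  ultimately have 1: "norm (\<Sum>n\<in>{1..N}. a n * monomial n z) \<le> M * (3 + ln (real (K + 1)))" by simp
  have "real K \<le> Q * ln (real N)" unfolding K_def using Q0 N by simp
  also have "\<dots> \<le> Q * real N"
    using Q0 N ln_le_minus_one[of "real N"] by (intro mult_left_mono) auto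
  finally have "real (K + 1) \<le> Q * real N + 1" by simp
  also have "\<dots> \<le> 2 * (real N + 1) ^ 3"
    by (simp add: Q_def power2_eq_square power3_eq_cube algebra_simps)
  finally have "ln (real (K + 1)) \<le> ln (2 * (real N + 1) ^ 3)" by simp
  also have "\<dots> = ln 2 + 3 * ln (real N + 1)" by (simp add: ln_mult ln_realpow)
  finally have "3 + ln (real (K + 1)) \<le> 4 + 3 * ln (real N + 1)" using ln_2_less_1 by linarith
  then show ?thesis using 1 M0 by (meson mult_left_mono order_trans)
qed

section \<open>Dirichlet series of functions in the polydisc algebra\<close>

text \<open>
  Logarithmic growth of partial sums is absorbed by an arbitrarily small power of \<open>n\<close>. The weight
  is a square so that summation by parts telescopes:
  \<open>(x\<^sup>2 - y\<^sup>2) / x \<le> 2 (x - y)\<close> for \<open>0 < y \<le> x\<close>.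
\<close>

lemma abel_summation_bound:
  fixes b :: "nat \<Rightarrow> complex"
  assumes A: "\<And>N. N \<ge> 1 \<Longrightarrow> norm (\<Sum>n\<in>{1..N}. b n) \<le> C * real N powr e"
    and C: "C \<ge> 0" and e: "e > 0" and N: "N \<ge> 1"
  shows "norm (\<Sum>n\<in>{1..N}. b n * of_real (real n powr (- (2 * e)))) \<le> 2 * C"
proof -
  define x where "x n = real n powr (- e)" for n
  define S where "S N = (\<Sum>n\<in>{1..N}. b n)" for N
  have sq: "real n powr (- (2 * e)) = (x n)\<^sup>2" for n
    by (simp add: x_def power2_eq_square powr_add[symmetric])
  have x0: "x n > 0" if "n \<ge> 1" for n using that by (simp add: x_def)
  have xmono: "x (Suc n) \<le> x n" if "n \<ge> 1" for n
    using that e by (simp add: x_def powr_mono2')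
  have x1: "x n \<le> 1" if "n \<ge> 1" for n
    using that e powr_mono2'[of "-e" 1 "real n"] by (simp add: x_def)
  have Sx: "norm (S n) * x n \<le> C" if "n \<ge> 1" for n
  proof -
    have "norm (S n) * x n \<le> C * real n powr e * x n"
      unfolding S_def by (intro mult_right_mono A) (use that x0[OF that] in auto)
    also have "\<dots> = C" using that by (simp add: x_def powr_add[symmetric] mult.assoc)
    finally show ?thesis .
  qed
  have "norm ((\<Sum>n\<in>{1..N}. b n * of_real ((x n)\<^sup>2)) - S N * of_real ((x N)\<^sup>2)) \<le> 2 * C * (1 - x N)"
    using N
  proof (induction N rule: dec_induct)
    case base
    then show ?case by (simp add: S_def x_def)
  next
    case (step n)
    let ?T = "\<lambda>n. \<Sum>n\<in>{1..n}. b n * of_real ((x n)\<^sup>2)"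
    have eq: "?T (Suc n) - S (Suc n) * of_real ((x (Suc n))\<^sup>2)
        = (?T n - S n * of_real ((x n)\<^sup>2)) + S n * of_real ((x n)\<^sup>2 - (x (Suc n))\<^sup>2)"
      using step by (simp add: S_def algebra_simps)
    have d0: "0 \<le> x n - x (Suc n)" using xmono step by simp
    have "norm (S n * of_real ((x n)\<^sup>2 - (x (Suc n))\<^sup>2)) = norm (S n) * ((x n - x (Suc n)) * (x n + x (Suc n)))"
    proof -
      have f: "(x n)\<^sup>2 - (x (Suc n))\<^sup>2 = (x n - x (Suc n)) * (x n + x (Suc n))"
        by (simp add: power2_eq_square algebra_simps)
      have "(x n - x (Suc n)) * (x n + x (Suc n)) \<ge> 0"
        using d0 x0[of n] x0[of "Suc n"] step by (intro mult_nonneg_nonneg) auto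
      then show ?thesis unfolding f norm_mult norm_of_real by simp
    qed
    also have "\<dots> \<le> norm (S n) * ((x n - x (Suc n)) * (2 * x n))"
      using d0 xmono[of n] step by (intro mult_left_mono) auto
    also have "\<dots> = 2 * (x n - x (Suc n)) * (norm (S n) * x n)" by (simp only: mult_ac)
    also have "\<dots> \<le> 2 * (x n - x (Suc n)) * C"
      using d0 Sx[of n] step by (intro mult_left_mono) auto
    finally have "norm (S n * of_real ((x n)\<^sup>2 - (x (Suc n))\<^sup>2)) \<le> 2 * (x n - x (Suc n)) * C" .
    with step.IH have "norm (?T (Suc n) - S (Suc n) * of_real ((x (Suc n))\<^sup>2))
        \<le> 2 * C * (1 - x n) + 2 * (x n - x (Suc n)) * C"
      unfolding eq by (intro norm_triangle_le add_mono) auto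
    then show ?case by (simp add: algebra_simps)
  qed
  moreover have "norm (S N * of_real ((x N)\<^sup>2)) \<le> C * x N"
  proof -
    have "norm (S N * of_real ((x N)\<^sup>2)) = norm (S N) * x N * x N"
      using x0[OF N] unfolding norm_mult norm_of_real by (simp add: power2_eq_square)
    then show ?thesis using mult_right_mono[OF Sx[OF N]] x0[OF N] by simp
  qed
  moreover have "2 * C * (1 - x N) + C * x N \<le> 2 * C"
    using C x0[OF N] by (simp add: algebra_simps)
  ultimately show ?thesis
    unfolding sq using norm_triangle_sub[of "\<Sum>n\<in>{1..N}. b n * of_real ((x n)\<^sup>2)" "S N * of_real ((x N)\<^sup>2)"]
    by linarith
qed

text \<open>
  Summation by parts doubles the constant of the growth bound for the exponent \<open>\<sigma> / 2\<close>.
\<close>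

definition bohr_const :: "real \<Rightarrow> real" where
  "bohr_const \<sigma> = 2 * (4 + 3 * (2 powr (\<sigma> / 2) / (\<sigma> / 2)))"

lemma bohr_const_pos: "\<sigma> > 0 \<Longrightarrow> bohr_const \<sigma> > 0"
  by (simp add: bohr_const_def add_pos_pos)

lemma log_factor_le_power:
  assumes "e > 0" "N \<ge> 1"
  shows "4 + 3 * ln (real N + 1) \<le> (4 + 3 * (2 powr e / e)) * real N powr e"
proof -
  have "ln (real N + 1) \<le> (real N + 1) powr e / e" using assms by (intro ln_powr_bound) auto
  also have "\<dots> \<le> (2 * real N) powr e / e"
    using assms by (intro divide_right_mono powr_mono2) auto
  also have "\<dots> = 2 powr e / e * real N powr e" by (simp add: powr_mult)
  finally have "ln (real N + 1) \<le> 2 powr e / e * real N powr e" .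
  moreover have "1 \<le> real N powr e" using assms by (intro ge_one_powr_ge_zero) auto
  ultimately show ?thesis unfolding distrib_right by linarith
qed

text \<open>
  The factor \<open>n powr (- i Im s)\<close> is the value of the \<open>n\<close>-th monomial at a point of the torus. The
  growth bound for partial sums at that point leaves the weight \<open>n powr (- Re s)\<close> for summation by parts.
\<close>

lemma norm_dirichlet_partial_sum_le:
  assumes M: "\<And>z. z \<in> closed_polydisc \<Longrightarrow> norm (\<Sum>n\<in>{1..L}. a n * monomial n z) \<le> M"
    and a: "\<And>n. n > L \<Longrightarrow> a n = 0" and s: "Re s > 0"
  shows "norm (\<Sum>n\<in>{1..N}. a n * of_nat n powr (-s)) \<le> bohr_const (Re s) * M"
proof (cases "N = 0")
  case True
  have "0 \<le> M" using order_trans[OF norm_ge_zero M[of "\<lambda>_. 0"]] by (simp add: mem_closed_polydisc)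
  then show ?thesis using True bohr_const_pos[OF s] by simp
next
  case False
  define e where "e = Re s / 2"
  have e: "e > 0" using s by (simp add: e_def)
  define u where "u = bohr_point (\<i> * of_real (Im s))"
  have u: "u \<in> closed_polydisc" unfolding u_def by (rule bohr_point_closed_polydisc) simp
  have M0: "0 \<le> M" using order_trans[OF norm_ge_zero M[OF u]] .
  have "norm (\<Sum>n\<in>{1..N}. a n * monomial n u) \<le> M * (4 + 3 * (2 powr e / e)) * real N powr e"
    if "N \<ge> 1" for N
  proof -
    have "norm (\<Sum>n\<in>{1..N}. a n * monomial n u) \<le> M * (4 + 3 * ln (real N + 1))"
    proof (rule norm_partial_sum_le[where L="max L N", OF _ u that])
      fix z assume z: "z \<in> closed_polydisc"
      have "(\<Sum>n\<in>{1..max L N}. a n * monomial n z) = (\<Sum>n\<in>{1..L}. a n * monomial n z)"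
        by (rule sum.mono_neutral_right) (use a in auto)
      then show "norm (\<Sum>n\<in>{1..max L N}. a n * monomial n z) \<le> M" using M[OF z] by simp
    qed simp
    also have "\<dots> \<le> M * ((4 + 3 * (2 powr e / e)) * real N powr e)"
      by (intro mult_left_mono log_factor_le_power e that M0)
    finally show ?thesis by (simp only: mult.assoc)
  qed
  from abel_summation_bound[OF this _ e, of N] M0 e False
  have "norm (\<Sum>n\<in>{1..N}. a n * monomial n u * of_real (real n powr (- (2 * e)))) \<le> 2 * (M * (4 + 3 * (2 powr e / e)))"
    by simp
  also have "(\<Sum>n\<in>{1..N}. a n * monomial n u * of_real (real n powr (- (2 * e)))) = (\<Sum>n\<in>{1..N}. a n * of_nat n powr (-s))"
  proof (rule sum.cong)
    fix n assume "n \<in> {1..N}"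
    then have n: "n > 0" by simp
    have "of_real (real n powr (- (2 * e))) = (of_nat n powr (of_real (- (2 * e))) :: complex)"
      using powr_of_real[of "real n" "- (2 * e)"] by simp
    then have "monomial n u * of_real (real n powr (- (2 * e)))
      = of_nat n powr (- (\<i> * of_real (Im s)) + of_real (- (2 * e)))"
      unfolding u_def powr_add using n by (simp add: monomial_bohr_point)
    also have "- (\<i> * of_real (Im s)) + of_real (- (2 * e)) = -s"
      by (simp add: e_def complex_eq_iff)
    finally show "a n * monomial n u * of_real (real n powr (- (2 * e))) = a n * of_nat n powr (-s)"
      by (simp only: mult.assoc)
  qed simp
  finally show ?thesis by (simp add: bohr_const_def e_def mult_ac)
qed

text \<open>
  Lists of terms make addition of polynomials a concatenation and multiplication by a coordinate
  a map; repeated monomials are collected only afterwards.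
\<close>

definition poly_sum :: "(complex \<times> nat) list \<Rightarrow> (nat \<Rightarrow> complex) \<Rightarrow> complex" where
  "poly_sum xs z = (\<Sum>(c, n)\<leftarrow>xs. c * monomial n z)"

lemma poly_sum_coefficients:
  "\<forall>(c, n)\<in>set xs. n > 0 \<Longrightarrow>
    \<exists>a L. (\<forall>n>L. a n = 0) \<and> (\<forall>z. (\<Sum>n\<in>{1..L}. a n * monomial n z) = poly_sum xs z)"
proof (induction xs)
  case Nil
  show ?case by (intro exI[of _ "\<lambda>_. 0"] exI[of _ 0]) (simp add: poly_sum_def)
next
  case (Cons x xs)
  obtain c m where x: "x = (c, m)" by force
  have m: "m > 0" using Cons.prems x by simp
  obtain a L where a: "\<forall>n>L. a n = 0" and p: "\<And>z. (\<Sum>n\<in>{1..L}. a n * monomial n z) = poly_sum xs z"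
    using Cons by auto
  have "(\<Sum>n\<in>{1..max L m}. (a n + (if n = m then c else 0)) * monomial n z) = poly_sum (x # xs) z" for z
  proof -
    have "(\<Sum>n\<in>{1..max L m}. a n * monomial n z) = (\<Sum>n\<in>{1..L}. a n * monomial n z)"
      by (rule sum.mono_neutral_right) (use a in auto)
    moreover have "(\<Sum>n\<in>{1..max L m}. (if n = m then c else 0) * monomial n z) = c * monomial m z"
      using m by (simp add: if_distrib[where f="\<lambda>x. x * _"] sum.delta cong: if_cong)
    moreover have "poly_sum (x # xs) z = c * monomial m z + poly_sum xs z"
      by (simp add: poly_sum_def x)
    ultimately show ?thesis by (simp add: distrib_right sum.distrib p del: One_nat_def)
  qed
  then show ?case using a by (intro exI[of _ "\<lambda>n. a n + (if n = m then c else 0)"] exI[of _ "max L m"]) auto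
qed

lemma polydisc_algebra_approx_poly_sum:
  assumes "f \<in> polydisc_algebra"
  shows "\<forall>e>0. \<exists>xs. (\<forall>(c, n)\<in>set xs. n > 0) \<and> (\<forall>z\<in>closed_polydisc. norm (poly_sum xs z - f z) \<le> e)"
  using assms
proof (induction rule: polydisc_algebra_induct)
  case (const c)
  show ?case by (intro allI impI exI[of _ "[(c, Suc 0)]"]) (simp add: poly_sum_def)
next
  case (add f g)
  show ?case
  proof (intro allI impI)
    fix e :: real assume "e > 0"
    then have e2: "e / 2 > 0" by simp
    obtain xs where xs: "\<forall>(c, n)\<in>set xs. n > 0" "\<forall>z\<in>closed_polydisc. norm (poly_sum xs z - f z) \<le> e/2"
      using add.IH(1) e2 by blast
    obtain ys where ys: "\<forall>(c, n)\<in>set ys. n > 0" "\<forall>z\<in>closed_polydisc. norm (poly_sum ys z - g z) \<le> e/2"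
      using add.IH(2) e2 by blast
    have "norm (poly_sum (xs @ ys) z - (f z + g z)) \<le> e" if "z \<in> closed_polydisc" for z
    proof -
      have eq: "poly_sum (xs @ ys) z - (f z + g z) = (poly_sum xs z - f z) + (poly_sum ys z - g z)"
        by (simp add: poly_sum_def)
      show ?thesis
        unfolding eq
        using norm_triangle_ineq[of "poly_sum xs z - f z" "poly_sum ys z - g z"]
          xs(2)[rule_format, OF that] ys(2)[rule_format, OF that] by linarith
    qed
    then show "\<exists>xs. (\<forall>(c, n)\<in>set xs. n > 0) \<and>
        (\<forall>z\<in>closed_polydisc. norm (poly_sum xs z - (\<lambda>z\<in>closed_polydisc. f z + g z) z) \<le> e)"
      using xs(1) ys(1) by (intro exI[of _ "xs @ ys"]) auto
  qed
next
  case (mult f i)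
  show ?case
  proof (intro allI impI)
    fix e :: real assume "e > 0"
    then obtain xs where xs: "\<forall>(c, n)\<in>set xs. n > 0" "\<forall>z\<in>closed_polydisc. norm (poly_sum xs z - f z) \<le> e"
      using mult.IH by blast
    define ys where "ys = map (\<lambda>(c, n). (c, n * nth_prime i)) xs"
    have ys: "\<forall>(c, n)\<in>set ys. n > 0" using xs(1) by (auto simp: ys_def)
    have eq: "poly_sum ys z = poly_sum xs z * z i" for z
      using xs(1) unfolding ys_def
      by (induction xs) (auto simp: poly_sum_def monomial_mult algebra_simps)
    have "norm (poly_sum ys z - f z * z i) \<le> e" if z: "z \<in> closed_polydisc" for z
    proof -
      have "norm (poly_sum ys z - f z * z i) = norm (poly_sum xs z - f z) * norm (z i)"
        unfolding eq norm_mult[symmetric] by (simp add: algebra_simps)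
      also have "\<dots> \<le> norm (poly_sum xs z - f z)"
        using z by (auto simp: mem_closed_polydisc intro: mult_left_le)
      finally show ?thesis using xs(2)[rule_format, OF z] by linarith
    qed
    then show "\<exists>xs. (\<forall>(c, n)\<in>set xs. n > 0) \<and>
        (\<forall>z\<in>closed_polydisc. norm (poly_sum xs z - (\<lambda>z\<in>closed_polydisc. f z * z i) z) \<le> e)"
      using ys by (intro exI[of _ ys]) auto
  qed
next
  case (limit f)
  show ?case
  proof (intro allI impI)
    fix e :: real assume "e > 0"
    then have e2: "e / 2 > 0" by simp
    obtain g where g: "\<forall>e>0. \<exists>xs. (\<forall>(c, n)\<in>set xs. n > 0) \<and> (\<forall>z\<in>closed_polydisc. norm (poly_sum xs z - g z) \<le> e)"
      "\<forall>z\<in>closed_polydisc. norm (g z - f z) \<le> e/2"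
      using limit(2)[OF e2] by blast
    obtain xs where xs: "\<forall>(c, n)\<in>set xs. n > 0" "\<forall>z\<in>closed_polydisc. norm (poly_sum xs z - g z) \<le> e/2"
      using g(1) e2 by blast
    have "norm (poly_sum xs z - f z) \<le> e" if "z \<in> closed_polydisc" for z
      using norm_triangle_ineq[of "poly_sum xs z - g z" "g z - f z"]
        xs(2)[rule_format, OF that] g(2)[rule_format, OF that] by simp
    then show "\<exists>xs. (\<forall>(c, n)\<in>set xs. n > 0) \<and> (\<forall>z\<in>closed_polydisc. norm (poly_sum xs z - f z) \<le> e)"
      using xs(1) by blast
  qed
qed

lemma polydisc_algebra_approx_dirichlet:
  assumes "f \<in> polydisc_algebra" "e > 0"
  obtains a L where "\<And>n. n > L \<Longrightarrow> a n = 0"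
    "\<And>z. z \<in> closed_polydisc \<Longrightarrow> norm ((\<Sum>n\<in>{1..L}. a n * monomial n z) - f z) \<le> e"
proof -
  obtain xs where xs: "\<forall>(c, n)\<in>set xs. n > 0" "\<forall>z\<in>closed_polydisc. norm (poly_sum xs z - f z) \<le> e"
    using polydisc_algebra_approx_poly_sum assms by blast
  obtain a L where "\<forall>n>L. a n = 0" "\<forall>z. (\<Sum>n\<in>{1..L}. a n * monomial n z) = poly_sum xs z"
    using poly_sum_coefficients[OF xs(1)] by blast
  then show thesis using that[of L a] xs(2) by simp
qed

text \<open>
  By Bohr's inequality the \<open>N\<close>-th partial sum at a fixed \<open>s\<close> is a functional on polynomials that is
  bounded uniformly in \<open>N\<close>. Coefficients and convergence therefore pass from polynomials to their
  uniform limits.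
\<close>

theorem bohr_point_dirichlet_series:
  assumes f: "f \<in> polydisc_algebra"
  shows "\<exists>a. \<forall>s\<in>right_half_plane. (\<lambda>n. a (Suc n) / of_nat (Suc n) powr s) sums f (bohr_point s)"
proof -
  have "\<exists>a L. (\<forall>n>L. a n = 0) \<and> (\<forall>z\<in>closed_polydisc.
      norm ((\<Sum>n\<in>{1..L}. a n * monomial n z) - f z) \<le> inverse (real (Suc j)))" for j
    using polydisc_algebra_approx_dirichlet[OF f, of "inverse (real (Suc j))"]
    by (metis inverse_positive_iff_positive of_nat_0_less_iff zero_less_Suc)
  then obtain A L where A0: "\<And>j n. n > L j \<Longrightarrow> A j n = 0" and
    Af: "\<And>j z. z \<in> closed_polydisc \<Longrightarrow>
      norm ((\<Sum>n\<in>{1..L j}. A j n * monomial n z) - f z) \<le> inverse (real (Suc j))"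
    by metis
  define T where "T b s N = (\<Sum>n\<in>{1..N}. b n * of_nat n powr (-s))" for b :: "nat \<Rightarrow> complex" and s N
  define q where "q j = inverse (real (Suc j))" for j :: nat
  have q: "q \<longlonglongrightarrow> 0" unfolding q_def by (rule LIMSEQ_inverse_real_of_nat)
  have diff: "norm (T (A i) s N - T (A j) s N) \<le> bohr_const (Re s) * (q i + q j)"
    if s: "Re s > 0" for i j s N
  proof -
    have "norm (\<Sum>n\<in>{1..N}. (A i n - A j n) * of_nat n powr (-s)) \<le> bohr_const (Re s) * (q i + q j)"
    proof (rule norm_dirichlet_partial_sum_le[where L="max (L i) (L j)", OF _ _ s])
      fix z assume z: "z \<in> closed_polydisc"
      have 1: "(\<Sum>n\<in>{1..max (L i) (L j)}. A i n * monomial n z) = (\<Sum>n\<in>{1..L i}. A i n * monomial n z)"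
        by (rule sum.mono_neutral_right) (use A0 in auto)
      have 2: "(\<Sum>n\<in>{1..max (L i) (L j)}. A j n * monomial n z) = (\<Sum>n\<in>{1..L j}. A j n * monomial n z)"
        by (rule sum.mono_neutral_right) (use A0 in auto)
      have "(\<Sum>n\<in>{1..max (L i) (L j)}. (A i n - A j n) * monomial n z)
          = ((\<Sum>n\<in>{1..L i}. A i n * monomial n z) - f z) - ((\<Sum>n\<in>{1..L j}. A j n * monomial n z) - f z)"
        unfolding 1[symmetric] 2[symmetric] by (simp add: left_diff_distrib sum_subtractf)
      also have "norm \<dots> \<le> q i + q j"
        using norm_triangle_ineq4 Af[OF z, of i] Af[OF z, of j] unfolding q_def
        by (meson add_mono order_trans)
      finally show "norm (\<Sum>n\<in>{1..max (L i) (L j)}. (A i n - A j n) * monomial n z) \<le> q i + q j" .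
    qed (use A0 in auto)
    then show ?thesis by (simp add: T_def left_diff_distrib sum_subtractf)
  qed
  have "convergent (\<lambda>j. A j n)" if n: "n \<ge> 1" for n
  proof -
    let ?C = "2 * bohr_const 1 * real n"
    have C: "?C > 0" using n bohr_const_pos[of 1] by simp
    have bd: "norm (A i n - A j n) \<le> ?C * (q i + q j)" for i j
    proof -
      obtain m where m: "n = Suc m" using n by (cases n) auto
      \<comment> \<open>A coefficient is the difference of two consecutive partial sums at the point \<open>1\<close>.\<close>
      have "(A i n - A j n) * of_nat n powr (-1) = (T (A i) 1 n - T (A j) 1 n) - (T (A i) 1 m - T (A j) 1 m)"
        by (simp add: T_def m algebra_simps)
      also have "norm \<dots> \<le> 2 * (bohr_const 1 * (q i + q j))"
        using norm_triangle_ineq4[of "T (A i) 1 n - T (A j) 1 n" "T (A i) 1 m - T (A j) 1 m"]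
          diff[of 1 i n j] diff[of 1 i m j] by simp
      finally have "norm (A i n - A j n) * real n powr (-1) \<le> 2 * (bohr_const 1 * (q i + q j))"
        using n by (simp add: norm_mult norm_of_nat_powr)
      then show ?thesis using n by (simp add: powr_minus_divide field_simps)
    qed
    have "Cauchy (\<lambda>j. A j n)"
    proof (rule metric_CauchyI)
      fix e :: real assume "e > 0"
      then have "e / (2 * ?C) > 0" using C by simp
      from order_tendstoD(2)[OF q this] obtain N where N: "\<And>j. j \<ge> N \<Longrightarrow> q j < e / (2 * ?C)"
        by (auto simp: eventually_sequentially)
      have "dist (A i n) (A j n) < e" if "i \<ge> N" "j \<ge> N" for i j
      proof -
        have "q i + q j < e / ?C" using N[OF that(1)] N[OF that(2)] by simp
        then have "?C * (q i + q j) < e" using C by (simp add: pos_less_divide_eq mult.commute)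
        then show ?thesis using bd[of i j] by (simp add: dist_norm)
      qed
      then show "\<exists>M. \<forall>m\<ge>M. \<forall>k\<ge>M. dist (A m n) (A k n) < e" by blast
    qed
    then show ?thesis by (simp add: Cauchy_convergent_iff)
  qed
  then obtain a where a: "\<And>n. n \<ge> 1 \<Longrightarrow> (\<lambda>j. A j n) \<longlonglongrightarrow> a n"
    unfolding convergent_def by metis
  have Ta: "norm (T a s N - T (A j) s N) \<le> bohr_const (Re s) * q j" if s: "Re s > 0" for s N j
  proof (rule LIMSEQ_le)
    have "(\<lambda>i. T (A i) s N) \<longlonglongrightarrow> T a s N"
      unfolding T_def by (intro tendsto_intros a) auto
    then show "(\<lambda>i. norm (T (A i) s N - T (A j) s N)) \<longlonglongrightarrow> norm (T a s N - T (A j) s N)"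
      by (intro tendsto_intros)
    have "(\<lambda>i. bohr_const (Re s) * (q i + q j)) \<longlonglongrightarrow> bohr_const (Re s) * (0 + q j)"
      by (intro tendsto_intros q)
    then show "(\<lambda>i. bohr_const (Re s) * (q i + q j)) \<longlonglongrightarrow> bohr_const (Re s) * q j" by simp
    show "\<exists>N'. \<forall>n\<ge>N'. norm (T (A n) s N - T (A j) s N) \<le> bohr_const (Re s) * (q n + q j)"
      using diff[OF s] by blast
  qed
  show ?thesis
  proof (intro exI ballI)
    fix s assume "s \<in> right_half_plane"
    then have s: "Re s > 0" by (simp add: right_half_plane_def)
    let ?B = "bohr_const (Re s) + 1"
    have B: "?B > 0" using bohr_const_pos[OF s] by simp
    have "(\<lambda>N. T a s N) \<longlonglongrightarrow> f (bohr_point s)"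
    proof (rule LIMSEQ_I)
      fix e :: real assume "e > 0"
      then have "e / ?B > 0" using B by simp
      from order_tendstoD(2)[OF q this] obtain j where "q j < e / ?B"
        by (auto simp: eventually_sequentially)
      then have j: "?B * q j < e" using B by (simp add: pos_less_divide_eq mult.commute)
      have "norm (T a s N - f (bohr_point s)) < e" if N: "N \<ge> L j" for N
      proof -
        have "T (A j) s N = (\<Sum>n\<in>{1..L j}. A j n * of_nat n powr (-s))"
          unfolding T_def by (rule sum.mono_neutral_right) (use A0 N in auto)
        also have "\<dots> = (\<Sum>n\<in>{1..L j}. A j n * monomial n (bohr_point s))"
          by (rule sum.cong) (auto simp: monomial_bohr_point)
        finally have "norm (T (A j) s N - f (bohr_point s)) \<le> q j"
          using Af[OF bohr_point_closed_polydisc, of s j] s by (simp add: q_def)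
        with Ta[OF s, of N j] have "norm (T a s N - f (bohr_point s)) \<le> bohr_const (Re s) * q j + q j"
          using norm_triangle_ineq[of "T a s N - T (A j) s N" "T (A j) s N - f (bohr_point s)"] by simp
        then show ?thesis using j by (simp add: algebra_simps)
      qed
      then show "\<exists>N0. \<forall>N\<ge>N0. norm (T a s N - f (bohr_point s)) < e" by blast
    qed
    then show "(\<lambda>n. a (Suc n) / of_nat (Suc n) powr s) sums f (bohr_point s)"
      unfolding sums_def T_def
      by (simp add: sum.atLeast1_atMost_eq powr_minus divide_inverse del: of_nat_Suc)
  qed
qed

section \<open>The half plane as a norming set\<close>

lemma bohr_point_lipschitz:
  assumes "Re s \<ge> 0" "Re s' \<ge> 0"
  shows "norm (bohr_point s i - bohr_point s' i) \<le> ln (real (nth_prime i)) * norm (s - s')"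
proof -
  let ?p = "of_nat (nth_prime i) :: complex"
  have p: "?p \<noteq> 0" using nth_prime_pos[of i] by simp
  have lp: "ln (real (nth_prime i)) \<ge> 0" using nth_prime_ge_2[of i] by simp
  have Lp: "Ln ?p = of_real (ln (real (nth_prime i)))"
    using Ln_of_real[of "real (nth_prime i)"] by simp
  show ?thesis
  proof (rule field_differentiable_bound[where S="{s. Re s \<ge> 0}" and f="\<lambda>s. bohr_point s i"])
    show "convex {s. Re s \<ge> 0}" by (rule convex_halfspace_Re_ge)
    show "((\<lambda>s. bohr_point s i) has_field_derivative (- (Ln ?p * ?p powr (-s)))) (at s within {s. Re s \<ge> 0})" for s
    proof -
      have eq: "bohr_point s i = exp (- s * Ln ?p)" for s using p by (simp add: bohr_point_def powr_def)
      have "((\<lambda>s. exp (- s * Ln ?p)) has_field_derivative exp (- s * Ln ?p) * (- Ln ?p)) (at s within {s. Re s \<ge> 0})"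
        by (auto intro!: derivative_eq_intros)
      then show ?thesis using p unfolding eq by (simp add: powr_def mult.commute)
    qed
    show "norm (- (Ln ?p * ?p powr (-s))) \<le> ln (real (nth_prime i))" if "s \<in> {s. Re s \<ge> 0}" for s
    proof -
      have "norm (?p powr (-s)) \<le> 1"
        using bohr_point_closed_polydisc[of s] that by (simp add: mem_closed_polydisc bohr_point_def)
      then show ?thesis using lp by (simp add: norm_mult Lp mult_left_le)
    qed
  qed (use assms in auto)
qed

lemma bohr_point_uniformly_close:
  assumes "(d::real) > 0"
  obtains r where "r > 0" "\<And>s s' i. Re s \<ge> 0 \<Longrightarrow> Re s' \<ge> 0 \<Longrightarrow> norm (s - s') < r \<Longrightarrow> i < m \<Longrightarrow>
    norm (bohr_point s i - bohr_point s' i) < d"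
proof -
  define L where "L = 1 + (\<Sum>i<m. ln (real (nth_prime i)))"
  have lp: "ln (real (nth_prime i)) \<ge> 0" for i using nth_prime_ge_2[of i] by simp
  have L: "L > 0" unfolding L_def using sum_nonneg[of "{..<m}" "\<lambda>i. ln (real (nth_prime i))"] lp by simp
  show thesis
  proof (rule that[of "d / L"])
    show "d / L > 0" using assms L by simp
    fix s s' i assume s: "Re s \<ge> 0" "Re s' \<ge> 0" "norm (s - s') < d / L" "i < m"
    have "ln (real (nth_prime i)) \<le> (\<Sum>i<m. ln (real (nth_prime i)))"
      using s(4) lp by (intro member_le_sum) auto
    then have "ln (real (nth_prime i)) \<le> L" by (simp add: L_def)
    then have "ln (real (nth_prime i)) * norm (s - s') \<le> L * norm (s - s')" by (intro mult_right_mono) auto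
    also have "\<dots> < d" using s(3) L by (simp add: pos_less_divide_eq mult.commute)
    finally show "norm (bohr_point s i - bohr_point s' i) < d"
      using bohr_point_lipschitz[OF s(1,2), of i] by linarith
  qed
qed

lemma uniformly_continuous_bohr_point:
  assumes f: "f \<in> polydisc_algebra"
  shows "uniformly_continuous_on right_half_plane (\<lambda>s. f (bohr_point s))"
  unfolding uniformly_continuous_on_def dist_norm
proof (intro allI impI)
  fix e :: real assume e: "e > 0"
  obtain m d where d: "d > 0" and unif0: "\<forall>x\<in>closed_polydisc. \<forall>y\<in>closed_polydisc.
      (\<forall>i<m. norm (x i - y i) < d) \<longrightarrow> norm (f x - f y) < e"
    using closed_polydisc_uniform_continuity[OF polydisc_algebraD(2)[OF f] e] by blast
  obtain r where r: "r > 0" "\<And>s s' i. Re s \<ge> 0 \<Longrightarrow> Re s' \<ge> 0 \<Longrightarrow> norm (s - s') < r \<Longrightarrow> i < m \<Longrightarrow>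
      norm (bohr_point s i - bohr_point s' i) < d"
    by (rule bohr_point_uniformly_close[OF d, of m]) (rule that)
  show "\<exists>r>0. \<forall>s\<in>right_half_plane. \<forall>s'\<in>right_half_plane. norm (s' - s) < r \<longrightarrow>
      norm (f (bohr_point s') - f (bohr_point s)) < e"
    by (intro exI[of _ r] conjI ballI impI r unif0[rule_format] bohr_point_closed_polydisc)
      (auto simp: right_half_plane_def)
qed

lemma disc_maximum_on_circle:
  fixes h :: "complex \<Rightarrow> complex"
  assumes "continuous_on (cball 0 1) h" "h holomorphic_on ball 0 1" "norm w \<le> 1"
  shows "\<exists>u. norm u = 1 \<and> norm (h w) \<le> norm (h u)"
proof -
  have "continuous_on (sphere 0 1) (\<lambda>u. norm (h u))"
    by (intro continuous_intros continuous_on_subset[OF assms(1)]) auto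
  moreover have "(1::complex) \<in> sphere 0 1" by simp
  ultimately obtain u where u: "u \<in> sphere 0 1" "\<And>v. v \<in> sphere 0 1 \<Longrightarrow> norm (h v) \<le> norm (h u)"
    using continuous_attains_sup[of "sphere (0::complex) 1" "\<lambda>u. norm (h u)"] compact_sphere by blast
  have "norm (h w) \<le> norm (h u)"
    by (rule maximum_modulus_frontier[of h "cball 0 1"]) (use assms u(2) in auto)
  then show ?thesis using u(1) by auto
qed

lemma polydisc_algebra_maximum_on_torus:
  assumes f: "f \<in> polydisc_algebra" and z: "z \<in> closed_polydisc"
  shows "\<exists>u\<in>closed_polydisc. (\<forall>i<m. norm (u i) = 1) \<and> norm (f z) \<le> norm (f u)"
proof (induction m)
  case 0
  show ?case using z by blast
next
  case (Suc m)
  then obtain u where u: "u \<in> closed_polydisc" "\<forall>i<m. norm (u i) = 1" "norm (f z) \<le> norm (f u)" by blast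
  have "norm (u m) \<le> 1" using u(1) by (simp add: mem_closed_polydisc)
  from disc_maximum_on_circle[OF polydisc_algebra_continuous_coordinate[OF f u(1)]
      polydisc_algebra_holomorphic_coordinate[OF f u(1)] this]
  obtain v where v: "norm v = 1" "norm (f (u(m := u m))) \<le> norm (f (u(m := v)))" by blast
  show ?case
  proof (intro bexI[of _ "u(m := v)"] conjI)
    show "\<forall>i<Suc m. norm ((u(m := v)) i) = 1" using u(2) v(1) by (auto simp: less_Suc_eq)
    show "norm (f z) \<le> norm (f (u(m := v)))" using u(3) v(2) by (simp only: fun_upd_triv)
    show "u(m := v) \<in> closed_polydisc" using u(1) v(1) by auto
  qed
qed

text \<open>
  Exponentiating a vanishing integer combination and sorting its terms by sign yields two equal
  products of prime powers with exponents \<open>c\<^sub>i\<^sup>+\<close> and \<open>c\<^sub>i\<^sup>-\<close>, which unique factorization identifies.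
\<close>

lemma ln_primes_independent:
  fixes c :: "nat \<Rightarrow> int"
  assumes I: "finite I" and s: "(\<Sum>i\<in>I. of_int (c i) * ln (real (nth_prime i))) = 0" and j: "j \<in> I"
  shows "c j = 0"
proof -
  define P where "P f = (\<Prod>i\<in>I. nth_prime i ^ f i)" for f :: "nat \<Rightarrow> nat"
  have lnP: "ln (real (P f)) = (\<Sum>i\<in>I. real (f i) * ln (real (nth_prime i)))" for f
    unfolding P_def using I by (simp add: ln_prod ln_realpow)
  have "(\<Sum>i\<in>I. real (nat (c i)) * ln (real (nth_prime i))) - (\<Sum>i\<in>I. real (nat (- c i)) * ln (real (nth_prime i)))
      = (\<Sum>i\<in>I. of_int (c i) * ln (real (nth_prime i)))"
    unfolding sum_subtractf[symmetric] left_diff_distrib[symmetric]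
    by (intro sum.cong refl arg_cong2[where f="(*)"]) simp
  then have "ln (real (P (\<lambda>i. nat (c i)))) = ln (real (P (\<lambda>i. nat (- c i))))"
    using s unfolding lnP by simp
  moreover have "P f > 0" for f unfolding P_def by (intro prod_pos) auto
  ultimately have eq: "P (\<lambda>i. nat (c i)) = P (\<lambda>i. nat (- c i))" by simp
  have mult: "multiplicity (nth_prime j) (P f) = f j" for f
  proof -
    have inj: "inj_on nth_prime I" by (rule inj_on_inverseI[of _ prime_index]) simp
    have "P f = (\<Prod>p\<in>nth_prime ` I. p ^ f (prime_index p))"
      unfolding P_def by (simp add: prod.reindex[OF inj])
    then have "multiplicity (nth_prime j) (P f) = (if nth_prime j \<in> nth_prime ` I then f (prime_index (nth_prime j)) else 0)"
      using I by (simp only:) (intro multiplicity_prod_prime_powers, auto)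
    then show ?thesis using j by simp
  qed
  have "nat (c j) = nat (- c j)" using mult eq by metis
  then show ?thesis by linarith
qed

lemma norm_exp_i_diff_le: "norm (exp (\<i> * of_real x) - exp (\<i> * of_real y)) \<le> \<bar>x - y\<bar>"
proof -
  have "exp (\<i> * of_real x) - exp (\<i> * of_real y) = exp (\<i> * of_real y) * (exp (\<i> * of_real (x - y)) - 1)"
    by (simp add: algebra_simps exp_add[symmetric])
  then have "norm (exp (\<i> * of_real x) - exp (\<i> * of_real y)) = norm (exp (\<i> * of_real (x - y)) - 1)"
    by (simp add: norm_mult)
  also have "\<dots> = 2 * \<bar>sin ((x - y) / 2)\<bar>" by (rule dist_exp_i_1)
  also have "\<dots> \<le> \<bar>x - y\<bar>" using abs_sin_x_le_abs_x[of "(x - y) / 2"] by simp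
  finally show ?thesis .
qed

text \<open>
  Kronecker: the logarithms of the primes are linearly independent, so the vertical line winds
  densely around every finite-dimensional torus.
\<close>

lemma bohr_point_dense_in_torus:
  assumes z: "\<And>i. i < m \<Longrightarrow> norm (z i) = 1" and e: "e > 0"
  shows "\<exists>t. \<forall>i<m. norm (bohr_point (\<i> * of_real t) i - z i) < e"
proof -
  define \<theta> where "\<theta> i = - ln (real (nth_prime i)) / (2 * pi)" for i
  have inj: "inj \<theta>"
  proof (rule injI)
    fix i j assume "\<theta> i = \<theta> j"
    then have "nth_prime i = nth_prime j" by (simp add: \<theta>_def)
    then show "i = j" using prime_index_nth_prime by metis
  qed
  interpret Modules.module "(\<lambda>r. (*) (real_of_int r))"
    by (simp add: Modules.module.intro distrib_left mult.commute)
  have ind: "independent (\<theta> ` {..<m})"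
    unfolding independent_explicit_module
  proof (intro allI impI)
    fix t and u :: "real \<Rightarrow> int" and v
    assume t: "finite t" "t \<subseteq> \<theta> ` {..<m}" "(\<Sum>v\<in>t. of_int (u v) * v) = 0" "v \<in> t"
    define I where "I = {i. \<theta> i \<in> t}"
    have tI: "t = \<theta> ` I" using t(2) by (auto simp: I_def)
    have "finite I" using t(1) inj unfolding tI by (simp add: finite_image_iff inj_on_subset)
    moreover have "(\<Sum>i\<in>I. of_int (u (\<theta> i)) * ln (real (nth_prime i))) = 0"
    proof -
      have "(\<Sum>i\<in>I. of_int (u (\<theta> i)) * \<theta> i) = 0"
        using t(3) inj unfolding tI by (simp add: sum.reindex inj_on_subset)
      then have "(\<Sum>i\<in>I. of_int (u (\<theta> i)) * \<theta> i) * (- (2 * pi)) = 0" by simp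
      then show ?thesis unfolding sum_distrib_right by (simp add: \<theta>_def)
    qed
    moreover obtain j where "j \<in> I" "v = \<theta> j" using t(4) tI by auto
    ultimately show "u v = 0" using ln_primes_independent[of I "\<lambda>i. u (\<theta> i)" j] by simp
  qed
  define \<alpha> where "\<alpha> i = Arg (z i) / (2 * pi)" for i
  have "e / (2 * pi) > 0" using e by simp
  from Kronecker_thm_1[OF ind inj_on_subset[OF inj] this, of \<alpha>]
  obtain t h where th: "\<And>i. i < m \<Longrightarrow> \<bar>t * \<theta> i - of_int (h i) - \<alpha> i\<bar> < e / (2 * pi)"
    by (metis subset_UNIV)
  have "norm (bohr_point (\<i> * of_real t) i - z i) < e" if i: "i < m" for i
  proof -
    have "bohr_point (\<i> * of_real t) i = exp (\<i> * of_real (2 * pi * (t * \<theta> i)))"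
      using Ln_of_real[of "real (nth_prime i)"]
      by (simp add: bohr_point_def powr_def \<theta>_def mult_ac)
    also have "\<dots> = exp (\<i> * of_real (2 * pi * (t * \<theta> i - of_int (h i))))"
      using exp_integer_2pi[of "of_int (- h i)"]
      by (simp add: algebra_simps exp_diff exp_minus) 
    finally have b: "bohr_point (\<i> * of_real t) i = exp (\<i> * of_real (2 * pi * (t * \<theta> i - of_int (h i))))" .
    have "z i = exp (\<i> * of_real (2 * pi * \<alpha> i))"
      using Arg_eq[of "z i"] z[OF i] by (force simp: \<alpha>_def)
    then have "norm (bohr_point (\<i> * of_real t) i - z i)
        \<le> \<bar>2 * pi * (t * \<theta> i - of_int (h i)) - 2 * pi * \<alpha> i\<bar>"
      unfolding b by (simp only: norm_exp_i_diff_le)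
    also have "\<dots> = 2 * pi * \<bar>t * \<theta> i - of_int (h i) - \<alpha> i\<bar>"
      unfolding right_diff_distrib[symmetric] by (simp add: abs_mult)
    also have "\<dots> < e" using th[OF i] by (simp add: pos_less_divide_eq mult.commute)
    finally show ?thesis .
  qed
  then show ?thesis by blast
qed

text \<open>
  By the maximum principle a point \<open>z\<close> may be moved to one whose first \<open>m\<close> coordinates lie on the
  circle, without decreasing the modulus. The later coordinates hardly matter, and the first ones are
  matched by a point of the imaginary axis, then by one slightly to its right.
\<close>

theorem half_plane_norming:
  assumes f: "f \<in> polydisc_algebra" and C: "\<And>s. s \<in> right_half_plane \<Longrightarrow> norm (f (bohr_point s)) \<le> C"
    and z: "z \<in> closed_polydisc"
  shows "norm (f z) \<le> C"
proof (rule field_le_epsilon)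
  fix e :: real assume e: "e > 0"
  obtain m d where d: "d > 0" and unif0: "\<forall>x\<in>closed_polydisc. \<forall>y\<in>closed_polydisc.
      (\<forall>i<m. norm (x i - y i) < d) \<longrightarrow> norm (f x - f y) < e"
    using closed_polydisc_uniform_continuity[OF polydisc_algebraD(2)[OF f] e] by blast
  obtain u where u: "u \<in> closed_polydisc" "\<forall>i<m. norm (u i) = 1" "norm (f z) \<le> norm (f u)"
    using polydisc_algebra_maximum_on_torus[OF f z, of m] by blast
  have d2: "d / 2 > 0" using d by simp
  obtain t where t: "\<forall>i<m. norm (bohr_point (\<i> * of_real t) i - u i) < d / 2"
    using bohr_point_dense_in_torus[of m u "d / 2"] u(2) d2 by blast
  obtain r where r: "r > 0" "\<And>s s' i. Re s \<ge> 0 \<Longrightarrow> Re s' \<ge> 0 \<Longrightarrow> norm (s - s') < r \<Longrightarrow> i < m \<Longrightarrow>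
      norm (bohr_point s i - bohr_point s' i) < d / 2"
    by (rule bohr_point_uniformly_close[OF d2, of m]) (rule that)
  define s where "s = of_real (r / 2) + \<i> * of_real t"
  have s: "Re s > 0" "norm (s - \<i> * of_real t) < r" using r(1) by (auto simp: s_def)
  have "norm (bohr_point s i - u i) < d" if i: "i < m" for i
    using norm_triangle_ineq[of "bohr_point s i - bohr_point (\<i> * of_real t) i" "bohr_point (\<i> * of_real t) i - u i"]
      r(2)[OF _ _ s(2) i] t i s(1) by fastforce
  then have "norm (f (bohr_point s) - f u) < e"
    using unif0 u(1) bohr_point_closed_polydisc[of s] s(1) by simp
  moreover have "norm (f (bohr_point s)) \<le> C" using C s(1) by (simp add: right_half_plane_def)
  ultimately show "norm (f z) \<le> C + e"
    using u(3) norm_triangle_sub[of "f u" "f (bohr_point s)"] by (simp add: norm_minus_commute)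
qed

lemma pullback_bohr_point_dirichlet_algebra:
  assumes "f \<in> polydisc_algebra"
  shows "pullback right_half_plane bohr_point f \<in> dirichlet_algebra"
proof -
  have "uniformly_continuous_on right_half_plane (pullback right_half_plane bohr_point f)"
    using uniformly_continuous_bohr_point[OF assms]
    by (simp add: uniformly_continuous_on_def pullback_def)
  moreover have "\<exists>a. \<forall>s\<in>right_half_plane.
      (\<lambda>n. a (Suc n) / of_nat (Suc n) powr s) sums pullback right_half_plane bohr_point f s"
    using bohr_point_dirichlet_series[OF assms] by (simp add: pullback_def)
  ultimately show ?thesis by (simp add: dirichlet_algebra_def pullback_def)
qed

section \<open>Gaussian smoothing of Dirichlet series\<close>

lemma norm_sum_mult_by_parts_le:
  fixes b c :: "nat \<Rightarrow> complex"
  assumes B: "\<And>N. norm (\<Sum>n<N. b n) \<le> M"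
  shows "norm (\<Sum>n<N. b n * c n) \<le> M * (norm (c N) + (\<Sum>n<N. norm (c n - c (Suc n))))"
proof -
  have eq: "(\<Sum>n<N. b n * c n) = (\<Sum>n<N. b n) * c N + (\<Sum>n<N. (\<Sum>k<Suc n. b k) * (c n - c (Suc n)))"
    by (induction N) (simp_all add: algebra_simps)
  have "norm ((\<Sum>n<N. b n) * c N) \<le> M * norm (c N)"
    unfolding norm_mult by (intro mult_right_mono B) auto
  moreover have "norm (\<Sum>n<N. (\<Sum>k<Suc n. b k) * (c n - c (Suc n))) \<le> (\<Sum>n<N. M * norm (c n - c (Suc n)))"
    by (intro sum_norm_le) (auto simp only: norm_mult intro!: mult_right_mono B norm_ge_zero)
  ultimately show ?thesis
    unfolding eq distrib_left sum_distrib_left by (intro norm_triangle_le add_mono)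
qed

text \<open>
  On the half plane \<open>Re u \<le> c\<close> the exponential function is Lipschitz with constant \<open>exp c\<close>; compare its
  values at \<open>- w log (n + 1)\<close> and \<open>- w log (n + 2)\<close>.
\<close>

lemma norm_powr_diff_Suc_le:
  assumes "Re w > 0"
  shows "norm (of_nat (Suc n) powr (-w) - of_nat (Suc (Suc n)) powr (-w))
    \<le> norm w * real (Suc n) powr (- 1 - Re w)"
proof -
  define x where "x = ln (real (Suc n))"
  define y where "y = ln (real (Suc (Suc n)))"
  have xy: "x \<le> y" by (simp add: x_def y_def)
  have yx: "y - x \<le> 1 / real (Suc n)"
  proof -
    have "real (Suc (Suc n)) / real (Suc n) = 1 + 1 / real (Suc n)" by (simp add: field_simps)
    moreover have "ln (real (Suc (Suc n)) / real (Suc n)) = y - x"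
      unfolding x_def y_def by (rule ln_divide_pos) simp_all
    ultimately have "y - x = ln (1 + 1 / real (Suc n))" by simp
    also have "\<dots> \<le> 1 / real (Suc n)" by (rule ln_add_one_self_le_self) simp
    finally show ?thesis .
  qed
  have e: "of_nat (Suc n) powr (-w) = exp (- w * of_real x)"
      "of_nat (Suc (Suc n)) powr (-w) = exp (- w * of_real y)"
    unfolding x_def y_def
    using Ln_of_real[of "real (Suc n)"] Ln_of_real[of "real (Suc (Suc n))"]
    by (simp_all add: powr_def del: of_nat_Suc)
  have wx: "- Re w * y \<le> - Re w * x" using xy assms by simp
  have "norm (exp (- w * of_real x) - exp (- w * of_real y))
      \<le> exp (- Re w * x) * norm (- w * of_real x - - w * of_real y)"
  proof (rule field_differentiable_bound[where S="{u. Re u \<le> - Re w * x}" and f=exp and f'=exp])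
    show "convex {u. Re u \<le> - Re w * x}" by (rule convex_halfspace_Re_le)
    show "(exp has_field_derivative exp u) (at u within {u. Re u \<le> - Re w * x})" for u :: complex
      by (rule DERIV_subset[OF DERIV_exp]) simp
  qed (use wx in \<open>auto simp: norm_exp_eq_Re\<close>)
  also have "- w * of_real x - - w * of_real y = w * of_real (y - x)" by (simp add: algebra_simps)
  also have "norm (w * of_real (y - x)) \<le> norm w * (1 / real (Suc n))"
    unfolding norm_mult norm_of_real using xy yx by (intro mult_left_mono) auto
  also have "exp (- Re w * x) = real (Suc n) powr (- Re w)"
    by (simp add: powr_def x_def)
  finally have "norm (exp (- w * of_real x) - exp (- w * of_real y))
      \<le> real (Suc n) powr (- Re w) * (norm w * (1 / real (Suc n)))"
    by (simp add: mult_left_mono)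
  also have "\<dots> = norm w * real (Suc n) powr (- 1 - Re w)"
  proof -
    have "- 1 - Re w = - Re w - 1" by simp
    then have "real (Suc n) powr (- 1 - Re w) = real (Suc n) powr (- Re w) / real (Suc n)"
      by (simp only: powr_diff powr_one of_nat_0_le_iff)
    then show ?thesis by simp
  qed
  finally show ?thesis unfolding e .
qed

text \<open>
  Partial sums on a vertical line grow at most linearly, because the series still converges on
  a line further left. This is the domination needed to smooth term by term.
\<close>

lemma dirichlet_partial_sums_linear_growth:
  assumes D: "\<And>s. Re s > 0 \<Longrightarrow> summable (\<lambda>n. a (Suc n) / of_nat (Suc n) powr s)" and s: "Re s > 0"
  shows "\<exists>C\<ge>0. \<forall>N x. norm (\<Sum>n<N. a (Suc n) / of_nat (Suc n) powr (s + \<i> * of_real x)) \<le> C * (1 + \<bar>x\<bar>)"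
proof -
  define r where "r = Re s / 2"
  define b where "b n = a (Suc n) / of_nat (Suc n) powr (of_real r)" for n
  have r: "r > 0" using s by (simp add: r_def)
  have "summable b" unfolding b_def by (rule D) (simp add: r)
  then have "convergent (\<lambda>N. \<Sum>n<N. b n)" by (simp add: summable_iff_convergent)
  then have "Bseq (\<lambda>N. \<Sum>n<N. b n)" by (rule convergent_imp_Bseq)
  then obtain M where M: "\<And>N. norm (\<Sum>n<N. b n) \<le> M"
    unfolding Bseq_def by blast
  have M0: "M \<ge> 0" using M[of 0] by simp
  define Z where "Z = (\<Sum>n. real (Suc n) powr (- 1 - r))"
  have Zs: "summable (\<lambda>n. real (Suc n) powr (- 1 - r))"
    using summable_Suc_iff[of "\<lambda>n. real n powr (- 1 - r)"] summable_real_powr_iff[of "- 1 - r"] r by simp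
  have Z0: "Z \<ge> 0" unfolding Z_def by (intro suminf_nonneg Zs) simp
  define C where "C = M * (1 + (norm (s - of_real r) + 1) * Z)"
  have "norm (\<Sum>n<N. a (Suc n) / of_nat (Suc n) powr (s + \<i> * of_real x)) \<le> C * (1 + \<bar>x\<bar>)" for N x
  proof -
    define w where "w = s - of_real r + \<i> * of_real x"
    have Rew: "Re w = r" by (simp add: w_def r_def)
    define c where "c n = of_nat (Suc n) powr (-w)" for n
    have "a (Suc n) / of_nat (Suc n) powr (s + \<i> * of_real x) = b n * c n" for n
    proof -
      have "s + \<i> * of_real x = of_real r + w" by (simp add: w_def)
      then show ?thesis by (simp add: b_def c_def powr_add powr_minus field_simps del: of_nat_Suc)
    qed
    then have "norm (\<Sum>n<N. a (Suc n) / of_nat (Suc n) powr (s + \<i> * of_real x))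
        \<le> M * (norm (c N) + (\<Sum>n<N. norm (c n - c (Suc n))))"
      using norm_sum_mult_by_parts_le[where b=b and c=c and M=M and N=N, OF M] by simp
    also have "\<dots> \<le> M * (1 + norm w * Z)"
    proof (intro mult_left_mono add_mono M0)
      have "norm (c N) = real (Suc N) powr (- r)"
        unfolding c_def by (subst norm_of_nat_powr) (auto simp: Rew)
      also have "\<dots> \<le> real (Suc N) powr 0" using r by (intro powr_mono) auto
      finally show "norm (c N) \<le> 1" by simp
      have "(\<Sum>n<N. norm (c n - c (Suc n))) \<le> (\<Sum>n<N. norm w * real (Suc n) powr (- 1 - r))"
        unfolding c_def using norm_powr_diff_Suc_le[of w] Rew r by (intro sum_mono) simp
      also have "\<dots> = norm w * (\<Sum>n<N. real (Suc n) powr (- 1 - r))" by (rule sum_distrib_left[symmetric])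
      also have "\<dots> \<le> norm w * Z"
        unfolding Z_def by (intro mult_left_mono sum_le_suminf Zs) auto
      finally show "(\<Sum>n<N. norm (c n - c (Suc n))) \<le> norm w * Z" .
    qed
    also have "\<dots> \<le> C * (1 + \<bar>x\<bar>)"
    proof -
      let ?W = "norm (s - of_real r)"
      have "norm w \<le> ?W + \<bar>x\<bar>"
        unfolding w_def using norm_triangle_ineq[of "s - of_real r" "\<i> * of_real x"] by (simp add: norm_mult)
      also have "\<dots> \<le> (?W + 1) * (1 + \<bar>x\<bar>)" by (simp add: algebra_simps)
      finally have "norm w * Z \<le> (?W + 1) * (1 + \<bar>x\<bar>) * Z" using Z0 by (rule mult_right_mono)
      then have "1 + norm w * Z \<le> (1 + (?W + 1) * Z) * (1 + \<bar>x\<bar>)"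
        by (simp add: algebra_simps)
      from mult_left_mono[OF this M0] show ?thesis by (simp add: C_def mult.assoc)
    qed
    finally show ?thesis .
  qed
  moreover have "C \<ge> 0" unfolding C_def using M0 Z0 by (intro mult_nonneg_nonneg add_nonneg_nonneg) auto
  ultimately show ?thesis by blast
qed

abbreviation gauss :: "real measure" where
  "gauss \<equiv> std_normal_distribution"

interpretation gauss: real_distribution gauss
  by (rule real_dist_normal_dist)

lemma integrable_gauss_abs: "integrable gauss (\<lambda>t. \<bar>t\<bar>)"
  using integrable_std_normal_distribution_moment[of 1] integrable_abs by simp

text \<open>
  Walk along the vertical line in steps of length at most \<open>r / 2\<close>.
\<close>

lemma uniformly_continuous_linear_growth:
  assumes unif: "\<And>s s'. s \<in> right_half_plane \<Longrightarrow> s' \<in> right_half_plane \<Longrightarrow> norm (s' - s) < r \<Longrightarrow>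
      norm (D s' - D s) \<le> (e::real)"
    and r: "r > 0" and s: "s \<in> right_half_plane" and e: "e \<ge> 0"
  shows "norm (D (s + \<i> * of_real x) - D s :: complex) \<le> e * (1 + 2 * \<bar>x\<bar> / r)"
proof -
  define K where "K = nat \<lceil>2 * \<bar>x\<bar> / r\<rceil>"
  have sK: "s + \<i> * of_real y \<in> right_half_plane" for y using s by (simp add: right_half_plane_def)
  have K: "2 * \<bar>x\<bar> / r \<le> real K" "real K \<le> 1 + 2 * \<bar>x\<bar> / r"
  proof -
    have "0 \<le> 2 * \<bar>x\<bar> / r" using r by simp
    then have "real K = of_int \<lceil>2 * \<bar>x\<bar> / r\<rceil>" by (simp add: K_def)
    then show "2 * \<bar>x\<bar> / r \<le> real K" "real K \<le> 1 + 2 * \<bar>x\<bar> / r" by linarith+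
  qed
  show ?thesis
  proof (cases "K = 0")
    case True
    then have "x = 0" using K(1) r by (simp add: divide_le_0_iff)
    then show ?thesis using e by simp
  next
    case False
    define p where "p j = s + \<i> * of_real (x * real j / real K)" for j
    have step: "norm (D (p (Suc j)) - D (p j)) \<le> e" for j
    proof (rule unif)
      have "p (Suc j) - p j = \<i> * of_real (x / real K)"
        using False by (simp add: p_def field_simps)
      then have "norm (p (Suc j) - p j) = \<bar>x\<bar> / real K" by (simp add: norm_mult norm_divide)
      also have "\<dots> \<le> r / 2"
        using K(1) False r by (simp add: field_simps)
      finally show "norm (p (Suc j) - p j) < r" using r by simp
    qed (unfold p_def, (rule sK)+)
    have "norm (D (p j) - D (p 0)) \<le> e * real j" for j
    proof (induction j)
      case (Suc j)
      then show ?case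
        using norm_triangle_ineq[of "D (p (Suc j)) - D (p j)" "D (p j) - D (p 0)"] step[of j]
        by (simp add: algebra_simps)
    qed simp
    from this[of K] have "norm (D (s + \<i> * of_real x) - D s) \<le> e * real K"
      using False by (simp add: p_def)
    also have "\<dots> \<le> e * (1 + 2 * \<bar>x\<bar> / r)" using K(2) e by (rule mult_left_mono)
    finally show ?thesis .
  qed
qed

lemma monomial_polydisc_algebra:
  "n > 0 \<Longrightarrow> (\<lambda>z\<in>closed_polydisc. monomial n z) \<in> polydisc_algebra"
proof (induction rule: pos_nat_prime_induct)
  case one
  show ?case using polydisc_algebra_const[of 1] by (simp add: restrict_def)
next
  case (factor i m)
  have "(\<lambda>z\<in>closed_polydisc. monomial (nth_prime i * m) z)
     = (\<lambda>z\<in>closed_polydisc. (\<lambda>z\<in>closed_polydisc. z i) z * (\<lambda>z\<in>closed_polydisc. monomial m z) z)"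
    using factor.hyps by (auto simp: monomial_mult)
  then show ?case
    using polydisc_algebra_mult[OF polydisc_algebra_coord[of i] factor.IH] by (simp only:)
qed

text \<open>
  Averaging over a Gaussian in the vertical direction multiplies the \<open>n\<close>-th coefficient by
  \<open>exp (- (\<delta> log n)\<^sup>2 / 2)\<close>, which makes the series absolutely convergent up to the boundary, and
  moves a uniformly continuous function only little.
\<close>

lemma gaussian_average:
  assumes D: "\<And>s. s \<in> right_half_plane \<Longrightarrow> (\<lambda>n. a (Suc n) / of_nat (Suc n) powr s) sums D s"
    and cont: "continuous_on right_half_plane D"
    and s: "s \<in> right_half_plane"
  shows "(\<lambda>N. \<Sum>n<N. a (Suc n) * of_real (exp (- (\<delta> * ln (real (Suc n)))\<^sup>2 / 2)) / of_nat (Suc n) powr s)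
     \<longlonglongrightarrow> (LINT t|gauss. D (s + \<i> * of_real (\<delta> * t)))" (is "?G \<longlonglongrightarrow> _")
    and "integrable gauss (\<lambda>t. D (s + \<i> * of_real (\<delta> * t)))"
proof -
  define S where "S N t = (\<Sum>n<N. a (Suc n) / of_nat (Suc n) powr (s + \<i> * of_real (\<delta> * t)))" for N t
  have Res: "Re s > 0" using s by (simp add: right_half_plane_def)
  have st: "s + \<i> * of_real (\<delta> * t) \<in> right_half_plane" for t using s by (simp add: right_half_plane_def)
  have "summable (\<lambda>n. a (Suc n) / of_nat (Suc n) powr s)" if "Re s > 0" for s
    using D that sums_summable by (auto simp: right_half_plane_def)
  from dirichlet_partial_sums_linear_growth[OF this Res] obtain C
    where C: "C \<ge> 0" "\<And>N x. norm (\<Sum>n<N. a (Suc n) / of_nat (Suc n) powr (s + \<i> * of_real x)) \<le> C * (1 + \<bar>x\<bar>)"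
    by blast
  have term_eq: "a (Suc n) / of_nat (Suc n) powr (s + \<i> * of_real (\<delta> * t))
      = a (Suc n) / of_nat (Suc n) powr s * iexp ((- \<delta> * ln (real (Suc n))) * t)" for n t
  proof -
    have "of_nat (Suc n) powr (\<i> * of_real (\<delta> * t)) = iexp (\<delta> * ln (real (Suc n)) * t)"
      using Ln_of_real[of "real (Suc n)"] by (simp add: powr_def mult_ac del: of_nat_Suc)
    then show ?thesis by (simp add: powr_add exp_minus field_simps del: of_nat_Suc)
  qed
  have int_iexp: "integrable gauss (\<lambda>t. iexp (c * t))" for c
    by (rule gauss.integrable_const_bound[where B=1]) auto
  have "(LINT t|gauss. S N t) = ?G N" for N
  proof -
    have "(LINT t|gauss. iexp ((- \<delta> * ln (real (Suc n))) * t)) = of_real (exp (- (\<delta> * ln (real (Suc n)))\<^sup>2 / 2))" for n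
      using fun_cong[OF char_std_normal_distribution, of "- \<delta> * ln (real (Suc n))"]
      unfolding char_def by simp
    moreover have "(LINT t|gauss. S N t) = (\<Sum>n<N. LINT t|gauss.
        a (Suc n) / of_nat (Suc n) powr s * iexp ((- \<delta> * ln (real (Suc n))) * t))"
      unfolding S_def term_eq by (rule Bochner_Integration.integral_sum) (rule integrable_mult_right[OF int_iexp])
    ultimately show ?thesis
      by (simp only: integral_mult_right_zero integral_divide_zero times_divide_eq_left)
  qed
  moreover have lim: "AE t in gauss. (\<lambda>N. S N t) \<longlonglongrightarrow> D (s + \<i> * of_real (\<delta> * t))"
    using D[OF st] by (simp add: S_def sums_def)
  have bd: "AE t in gauss. norm (S N t) \<le> C * (1 + \<bar>\<delta>\<bar> * \<bar>t\<bar>)" for N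
    using C(2)[where N=N and x="\<delta> * t" for t] by (auto simp: S_def abs_mult)
  have m1: "(\<lambda>t. D (s + \<i> * of_real (\<delta> * t))) \<in> borel_measurable gauss"
  proof -
    have "continuous_on UNIV (\<lambda>t. D (s + \<i> * of_real (\<delta> * t)))"
      by (rule continuous_on_compose2[OF cont]) (use st in \<open>auto intro!: continuous_intros\<close>)
    then show ?thesis using borel_measurable_continuous_onI by simp
  qed
  have m2: "S N \<in> borel_measurable gauss" for N
    unfolding S_def term_eq by measurable
  have wi: "integrable gauss (\<lambda>t. C * (1 + \<bar>\<delta>\<bar> * \<bar>t\<bar>))"
    by (intro integrable_mult_right Bochner_Integration.integrable_add integrable_gauss_abs) simp
  show "integrable gauss (\<lambda>t. D (s + \<i> * of_real (\<delta> * t)))"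
    by (rule integrable_dominated_convergence[OF m1 m2 wi lim bd])
  have "(\<lambda>N. LINT t|gauss. S N t) \<longlonglongrightarrow> (LINT t|gauss. D (s + \<i> * of_real (\<delta> * t)))"
    by (rule integral_dominated_convergence[OF m1 m2 wi lim bd])
  ultimately show "?G \<longlonglongrightarrow> (LINT t|gauss. D (s + \<i> * of_real (\<delta> * t)))" by simp
qed

text \<open>
  Convergence at \<open>1\<close> bounds the coefficients linearly in \<open>n\<close>, and the Gaussian factor decays faster
  than any power: completing the square gives \<open>- (\<delta> l)\<^sup>2 / 2 \<le> 9 / (2 \<delta>\<^sup>2) - 3 l\<close>.
\<close>

lemma summable_gaussian_coefficients:
  assumes s: "summable (\<lambda>n. a (Suc n) / of_nat (Suc n) powr (1::complex))" and d: "\<delta> \<noteq> 0"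
  shows "summable (\<lambda>n. norm (a (Suc n) * of_real (exp (- (\<delta> * ln (real (Suc n)))\<^sup>2 / 2))))"
proof -
  have "(\<lambda>n. a (Suc n) / of_nat (Suc n)) \<longlonglongrightarrow> 0"
    using summable_LIMSEQ_zero[OF s] by simp
  then have "Bseq (\<lambda>n. a (Suc n) / of_nat (Suc n))"
    using convergentI convergent_imp_Bseq by blast
  then obtain C where C: "C > 0" "\<And>n. norm (a (Suc n) / of_nat (Suc n)) \<le> C"
    unfolding Bseq_def by blast
  define B where "B = exp (9 / (2 * \<delta>\<^sup>2))"
  have bd: "norm (norm (a (Suc n) * of_real (exp (- (\<delta> * ln (real (Suc n)))\<^sup>2 / 2)))) \<le> C * B * real (Suc n) powr (- 2)" for n
  proof -
    define l where "l = ln (real (Suc n))"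
    have "0 \<le> (\<delta> * l - 3 / \<delta>)\<^sup>2" by simp
    also have "\<dots> = (\<delta> * l)\<^sup>2 - 6 * l + 9 / \<delta>\<^sup>2"
      using d by (simp add: power2_eq_square field_simps)
    finally have "- (\<delta> * l)\<^sup>2 / 2 \<le> 9 / (2 * \<delta>\<^sup>2) + - 3 * l" by simp
    then have "exp (- (\<delta> * l)\<^sup>2 / 2) \<le> B * exp (- 3 * l)"
      unfolding B_def exp_add[symmetric] by simp
    also have "exp (- 3 * l) = real (Suc n) powr (- 3)" by (simp add: powr_def l_def)
    finally have g: "exp (- (\<delta> * l)\<^sup>2 / 2) \<le> B * real (Suc n) powr (- 3)" .
    have "norm (a (Suc n)) \<le> C * real (Suc n)"
      using C(2)[of n] by (simp add: norm_divide pos_divide_le_eq del: of_nat_Suc)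
    then have "norm (a (Suc n)) * exp (- (\<delta> * l)\<^sup>2 / 2) \<le> C * real (Suc n) * (B * real (Suc n) powr (- 3))"
      using g C(1) by (intro mult_mono) auto
    also have "\<dots> = C * B * (real (Suc n) powr 1 * real (Suc n) powr (- 3))" by simp
    also have "real (Suc n) powr 1 * real (Suc n) powr (- 3) = real (Suc n) powr (- 2)"
      unfolding powr_add[symmetric] by simp
    finally show ?thesis by (simp add: norm_mult l_def)
  qed
  have "summable (\<lambda>n. C * B * real (Suc n) powr (- 2))"
    using summable_Suc_iff[of "\<lambda>n. real n powr (- 2)"] summable_real_powr_iff[of "- 2"]
    by (intro summable_mult) simp
  then show ?thesis by (rule summable_comparison_test'[where N=0]) (rule bd)
qed

text \<open>
  The Gaussian average with small variance is uniformly close to \<open>D\<close>. Its Dirichlet series converges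
  absolutely on the whole closed half plane, hence is uniformly close to a partial sum, which is
  the restriction of a polynomial.
\<close>

theorem dirichlet_algebra_approx:
  assumes D: "D \<in> dirichlet_algebra" and e: "e > 0"
  shows "\<exists>f\<in>polydisc_algebra. \<forall>s\<in>right_half_plane. norm (D s - f (bohr_point s)) \<le> e"
proof -
  obtain a where a: "\<And>s. s \<in> right_half_plane \<Longrightarrow> (\<lambda>n. a (Suc n) / of_nat (Suc n) powr s) sums D s"
    using D by (auto simp: dirichlet_algebra_def)
  have uc: "uniformly_continuous_on right_half_plane D" using D by (simp add: dirichlet_algebra_def)
  define E where "E = (LINT t|gauss. \<bar>t\<bar>)"
  have E0: "E \<ge> 0" unfolding E_def by (rule integral_nonneg_AE) auto
  \<comment> \<open>For \<open>\<delta> = r / 2\<close> the mean displacement error is \<open>\<eta>\<close> times the mean of \<open>1 + \<bar>t\<bar>\<close>, that is, \<open>e / 2\<close>.\<close>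
  define \<eta> where "\<eta> = e / (2 * (1 + E))"
  have \<eta>: "\<eta> > 0" using e E0 by (simp add: \<eta>_def)
  obtain r where r: "r > 0" and unif: "\<And>s s'. s \<in> right_half_plane \<Longrightarrow> s' \<in> right_half_plane \<Longrightarrow>
      norm (s' - s) < r \<Longrightarrow> norm (D s' - D s) \<le> \<eta>"
    using uc \<eta> unfolding uniformly_continuous_on_def dist_norm by (metis less_imp_le)
  define \<delta> where "\<delta> = r / 2"
  define b where "b n = a (Suc n) * of_real (exp (- (\<delta> * ln (real (Suc n)))\<^sup>2 / 2))" for n
  have "summable (\<lambda>n. a (Suc n) / of_nat (Suc n) powr (1::complex))"
    by (rule sums_summable, rule a) (simp add: right_half_plane_def)
  then have sb: "summable (\<lambda>n. norm (b n))"
    unfolding b_def using r by (intro summable_gaussian_coefficients) (auto simp: \<delta>_def)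
  have e2: "e / 2 > 0" using e by simp
  obtain N where N: "\<And>m. norm (\<Sum>n\<in>{N..<m}. norm (b n)) < e / 2"
    using sb e2 unfolding summable_Cauchy by blast
  define f where "f = (\<lambda>z\<in>closed_polydisc. \<Sum>n<N. (\<lambda>z\<in>closed_polydisc. b n * (\<lambda>z\<in>closed_polydisc. monomial (Suc n) z) z) z)"
  have f: "f \<in> polydisc_algebra"
    unfolding f_def by (intro polydisc_algebra_sum polydisc_algebra_scale monomial_polydisc_algebra) auto
  have "norm (D s - f (bohr_point s)) \<le> e" if s: "s \<in> right_half_plane" for s
  proof -
    have Res: "Re s > 0" using s by (simp add: right_half_plane_def)
    let ?I = "LINT t|gauss. D (s + \<i> * of_real (\<delta> * t))"
    have fs: "f (bohr_point s) = (\<Sum>n<N. b n / of_nat (Suc n) powr s)"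
      using bohr_point_closed_polydisc[of s] Res
      by (simp add: f_def monomial_bohr_point powr_minus divide_inverse del: of_nat_Suc)
    have lim: "(\<lambda>m. \<Sum>n<m. b n / of_nat (Suc n) powr s) \<longlonglongrightarrow> ?I"
      using gaussian_average(1)[OF a uniformly_continuous_imp_continuous[OF uc] s, of \<delta>] by (simp only: b_def)
    have int: "integrable gauss (\<lambda>t. D (s + \<i> * of_real (\<delta> * t)))"
      by (rule gaussian_average(2)[OF a uniformly_continuous_imp_continuous[OF uc] s])
    have "norm (?I - f (bohr_point s)) \<le> e / 2"
    proof (rule tendsto_upperbound)
      show "(\<lambda>m. norm ((\<Sum>n<m. b n / of_nat (Suc n) powr s) - f (bohr_point s))) \<longlonglongrightarrow> norm (?I - f (bohr_point s))"
        by (intro tendsto_intros lim)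
      have "norm ((\<Sum>n<m. b n / of_nat (Suc n) powr s) - f (bohr_point s)) \<le> e / 2" if "m \<ge> N" for m
      proof -
        have "{..<m} = {..<N} \<union> {N..<m}" using that by auto
        then have "(\<Sum>n<m. b n / of_nat (Suc n) powr s) - f (bohr_point s) = (\<Sum>n\<in>{N..<m}. b n / of_nat (Suc n) powr s)"
          unfolding fs by (simp add: sum.union_disjoint ivl_disj_int(2))
        also have "norm \<dots> \<le> (\<Sum>n\<in>{N..<m}. norm (b n))"
        proof (rule sum_norm_le)
          fix n
          have "1 \<le> real (Suc n) powr Re s" using Res by (intro ge_one_powr_ge_zero) auto
          then have "norm (b n) / real (Suc n) powr Re s \<le> norm (b n) / 1"
            by (intro divide_left_mono) auto
          then show "norm (b n / of_nat (Suc n) powr s) \<le> norm (b n)"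
            by (simp add: norm_divide norm_of_nat_powr del: of_nat_Suc)
        qed
        also have "\<dots> \<le> e / 2" using N[of m] by simp
        finally show ?thesis .
      qed
      then show "\<forall>\<^sub>F m in sequentially. norm ((\<Sum>n<m. b n / of_nat (Suc n) powr s) - f (bohr_point s)) \<le> e / 2"
        by (auto simp: eventually_sequentially)
    qed simp
    moreover have "norm (?I - D s) \<le> e / 2"
    proof -
      have "?I - D s = (LINT t|gauss. D (s + \<i> * of_real (\<delta> * t)) - D s)"
        using int by (simp add: gauss.prob_space[unfolded gauss.space_eq_univ])
      also have "norm \<dots> \<le> (LINT t|gauss. \<eta> * (1 + \<bar>t\<bar>))"
      proof (rule Bochner_Integration.integral_norm_bound_integral)
        show "norm (D (s + \<i> * of_real (\<delta> * t)) - D s) \<le> \<eta> * (1 + \<bar>t\<bar>)" for t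
          using uniformly_continuous_linear_growth[OF unif r s, where x="\<delta> * t"] \<eta> r
          by (simp add: \<delta>_def abs_mult)
      qed (use int in \<open>auto intro!: integrable_gauss_abs\<close>)
      also have "\<dots> = \<eta> * (1 + E)"
        using integrable_gauss_abs by (simp add: E_def gauss.prob_space[unfolded gauss.space_eq_univ])
      also have "\<dots> = e / 2"
      proof -
        have "1 + E \<noteq> 0" using E0 by linarith
        then show ?thesis by (simp add: \<eta>_def divide_simps)
      qed
      finally show ?thesis .
    qed
    ultimately show ?thesis
      using norm_triangle_ineq4[of "?I - f (bohr_point s)" "?I - D s"] by simp
  qed
  with f show ?thesis by blast
qed

theorem norming_pullback_dirichlet:
  "norming_pullback closed_polydisc polydisc_algebra right_half_plane dirichlet_algebra bohr_point"
proof
  have "(1::complex) \<in> right_half_plane" by (simp add: right_half_plane_def)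
  then show "right_half_plane \<noteq> {}" by blast
  show "closed_polydisc \<noteq> {}" by (rule closed_polydisc_nonempty)
  show "sup_banach_algebra closed_polydisc polydisc_algebra" by (rule sup_banach_algebra_polydisc_algebra)
  show "bohr_point t \<in> closed_polydisc" if "t \<in> right_half_plane" for t
    using that by (intro bohr_point_closed_polydisc) (simp add: right_half_plane_def)
  show "dirichlet_algebra \<subseteq> extensional right_half_plane" by (auto simp: dirichlet_algebra_def)
  show "pullback right_half_plane bohr_point f \<in> dirichlet_algebra" if "f \<in> polydisc_algebra" for f
    using that by (rule pullback_bohr_point_dirichlet_algebra)
  show "norm (f s) \<le> C" if "f \<in> polydisc_algebra" "\<And>t. t \<in> right_half_plane \<Longrightarrow> norm (f (bohr_point t)) \<le> C"
    "s \<in> closed_polydisc" for f C s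
    using that by (rule half_plane_norming)
  show "\<exists>f\<in>polydisc_algebra. \<forall>t\<in>right_half_plane. norm (g t - f (bohr_point t)) \<le> e"
    if "g \<in> dirichlet_algebra" "e > 0" for g e
    using that by (rule dirichlet_algebra_approx)
qed

section \<open>Functions on null sequences that are holomorphic on lines\<close>

notation scaleC_c0 (infixr "*\<^sub>c" 75)

lemma scaleC_c0_simps [simp]:
  "0 *\<^sub>c v = 0" "1 *\<^sub>c v = v" "c *\<^sub>c 0 = 0" "a *\<^sub>c b *\<^sub>c v = (a * b) *\<^sub>c v"
  by (intro c0_eqI, simp add: scaleC_c0.rep_eq zero_c0.rep_eq)+

lemma scaleC_c0_add:
  "c *\<^sub>c (u + v) = c *\<^sub>c u + c *\<^sub>c v" "(a + b) *\<^sub>c v = a *\<^sub>c v + b *\<^sub>c v"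
  by (intro c0_eqI, simp add: scaleC_c0.rep_eq plus_c0.rep_eq algebra_simps)+

lemma bounded_linear_scaleC_left: "bounded_linear (\<lambda>t. t *\<^sub>c v)"
proof (rule bounded_linear_intro[where K="norm v"])
  show "(r *\<^sub>R t) *\<^sub>c v = r *\<^sub>R (t *\<^sub>c v)" for r t
    by (simp add: scaleR_scaleC_c0 scaleR_conv_of_real)
qed (simp_all add: scaleC_c0_add norm_scaleC_c0)

lemma continuous_on_cline: "continuous_on S (\<lambda>t. x + t *\<^sub>c v)"
  using linear_continuous_on[OF bounded_linear_scaleC_left] by (intro continuous_intros)

lemma open_cline: "open U \<Longrightarrow> open {t. x + t *\<^sub>c v \<in> U}"
  using open_vimage[OF _ continuous_on_cline[of UNIV x v]] by (simp add: vimage_def)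

definition line_holomorphic_on :: "(c0 \<Rightarrow> complex) \<Rightarrow> c0 set \<Rightarrow> bool" where
  "line_holomorphic_on F U \<longleftrightarrow> (\<forall>x v. (\<lambda>t. F (x + t *\<^sub>c v)) holomorphic_on {t. x + t *\<^sub>c v \<in> U})"

definition dir_deriv :: "(c0 \<Rightarrow> complex) \<Rightarrow> c0 \<Rightarrow> c0 \<Rightarrow> complex" where
  "dir_deriv F x v = deriv (\<lambda>t. F (x + t *\<^sub>c v)) 0"

lemma taylor_coeff_0 [simp]: "taylor_coeff h 0 = h 0"
  by (simp add: taylor_coeff_def)

lemma dir_deriv_eq_taylor_coeff: "dir_deriv F x v = taylor_coeff (\<lambda>t. F (x + t *\<^sub>c v)) 1"
  by (simp add: taylor_coeff_def dir_deriv_def)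

lemma line_holomorphic_on_subset:
  "line_holomorphic_on F U \<Longrightarrow> V \<subseteq> U \<Longrightarrow> line_holomorphic_on F V"
  unfolding line_holomorphic_on_def by (fast intro: holomorphic_on_subset)

lemma line_holomorphic_on_ball:
  assumes "line_holomorphic_on F (ball x r)" "R * norm v \<le> r" "r > 0"
  shows "(\<lambda>t. F (x + t *\<^sub>c v)) holomorphic_on ball 0 R"
proof -
  have "x + t *\<^sub>c v \<in> ball x r" if "norm t < R" for t
  proof (cases "v = 0")
    case False
    then have "norm t * norm v < R * norm v" using that by simp
    then show ?thesis using assms(2) by (simp add: dist_norm norm_scaleC_c0)
  qed (use assms in simp)
  then have "ball 0 R \<subseteq> {t. x + t *\<^sub>c v \<in> ball x r}" by auto
  moreover have "(\<lambda>t. F (x + t *\<^sub>c v)) holomorphic_on {t. x + t *\<^sub>c v \<in> ball x r}"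
    using assms(1) unfolding line_holomorphic_on_def by blast
  ultimately show ?thesis using holomorphic_on_subset by blast
qed

text \<open>
  On lines through the centre of a ball where the function is bounded, Taylor expansion in one
  complex variable gives estimates that do not depend on the direction.
\<close>

locale bounded_line_holomorphic =
  fixes F :: "c0 \<Rightarrow> complex" and x :: c0 and r M :: real
  assumes holo: "line_holomorphic_on F (ball x r)" and r: "r > 0"
    and bounded: "y \<in> ball x r \<Longrightarrow> norm (F y) \<le> M"
begin

lemma M_nonneg: "M \<ge> 0"
  using order_trans[OF norm_ge_zero bounded[of x]] r by simp

lemma recenter: "y \<in> ball x r \<Longrightarrow> bounded_line_holomorphic F y (r - dist x y) M"
proof
  assume y: "y \<in> ball x r"
  have sub: "ball y (r - dist x y) \<subseteq> ball x r"
  proof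
    fix z assume "z \<in> ball y (r - dist x y)"
    then show "z \<in> ball x r" using dist_triangle[of x z y] by simp
  qed
  then show "line_holomorphic_on F (ball y (r - dist x y))"
    using holo line_holomorphic_on_subset by blast
  show "norm (F z) \<le> M" if "z \<in> ball y (r - dist x y)" for z
    using that sub bounded by blast
qed simp

lemma shrink: "0 < r' \<Longrightarrow> r' \<le> r \<Longrightarrow> bounded_line_holomorphic F x r' M"
  using holo bounded
  by unfold_locales (auto intro: line_holomorphic_on_subset[OF _ subset_ball])

lemma line_bound: 
  assumes "R * norm v \<le> r" "norm t < R" shows "norm (F (x + t *\<^sub>c v)) \<le> M"
proof (rule bounded)
  show "x + t *\<^sub>c v \<in> ball x r"
  proof (cases "v = 0")
    case False
    then have "norm t * norm v < R * norm v" using assms by simp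
    then show ?thesis using assms(1) by (simp add: dist_norm norm_scaleC_c0)
  qed (use r in simp)
qed

lemma norm_dir_deriv_le: "norm (dir_deriv F x v) \<le> M * norm v / r"
proof (cases "v = 0")
  case True
  then show ?thesis by (simp add: dir_deriv_def)
next
  case False
  have "norm (dir_deriv F x v) \<le> M / (r / norm v) ^ 1"
    unfolding dir_deriv_eq_taylor_coeff
    by (rule norm_taylor_coeff_le[OF line_holomorphic_on_ball[OF holo _ r] line_bound])
      (use False r in auto)
  then show ?thesis by simp
qed

lemma taylor_remainder_le:
  assumes "norm w \<le> r / 2"
  shows "norm (F (x + w) - (\<Sum>k<n. taylor_coeff (\<lambda>t. F (x + t *\<^sub>c w)) k)) \<le> 2 * M * (norm w / r) ^ n"
proof (cases "w = 0")
  case True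
  have eq: "taylor_coeff (\<lambda>t. F x) k = (if k = 0 then F x else 0)" for k
    by (cases k) (simp_all add: taylor_coeff_def)
  have "(\<Sum>k<n. taylor_coeff (\<lambda>t. F x) k) = (if n = 0 then 0 else F x)"
    unfolding eq by (simp add: sum.delta)
  then show ?thesis using True bounded[of x] r M_nonneg by (cases n) auto
next
  case False
  define q where "q = norm w / r"
  have q: "0 \<le> q" "q \<le> 1 / 2" using assms r by (auto simp: q_def field_simps)
  have "norm (F (x + 1 *\<^sub>c w) - (\<Sum>k<n. taylor_coeff (\<lambda>t. F (x + t *\<^sub>c w)) k * 1 ^ k))
      \<le> M * (norm (1::complex) / (r / norm w)) ^ n / (1 - norm (1::complex) / (r / norm w))"
    by (rule norm_taylor_remainder_le[OF line_holomorphic_on_ball[OF holo _ r] line_bound[where R="r / norm w"]])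
      (use False r assms in \<open>auto simp: field_simps\<close>)
  then have "norm (F (x + w) - (\<Sum>k<n. taylor_coeff (\<lambda>t. F (x + t *\<^sub>c w)) k)) \<le> M * q ^ n / (1 - q)"
    by (simp add: q_def)
  also have "\<dots> \<le> M * q ^ n / (1 / 2)"
    using q M_nonneg by (intro divide_left_mono) auto
  finally show ?thesis by (simp add: q_def)
qed

lemma lipschitz: "norm w \<le> r / 2 \<Longrightarrow> norm (F (x + w) - F x) \<le> 2 * M * norm w / r"
  using taylor_remainder_le[of w 1] by simp

lemma second_order:
  "norm w \<le> r / 2 \<Longrightarrow> norm (F (x + w) - F x - dir_deriv F x w) \<le> 2 * M * (norm w / r)\<^sup>2"
  using taylor_remainder_le[of w 2]
  by (simp add: dir_deriv_eq_taylor_coeff numeral_2_eq_2 algebra_simps)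

lemma line_has_derivative: "((\<lambda>t. F (x + t *\<^sub>c v)) has_field_derivative dir_deriv F x v) (at 0)"
proof -
  have "(\<lambda>t. F (x + t *\<^sub>c v)) holomorphic_on {t. x + t *\<^sub>c v \<in> ball x r}"
    using holo unfolding line_holomorphic_on_def by blast
  moreover have "open {t. x + t *\<^sub>c v \<in> ball x r}" by (rule open_cline) simp
  moreover have "0 \<in> {t. x + t *\<^sub>c v \<in> ball x r}" using r by simp
  ultimately show ?thesis unfolding dir_deriv_def by (rule holomorphic_derivI)
qed

lemma dir_deriv_scale: "dir_deriv F x (c *\<^sub>c v) = c * dir_deriv F x v"
proof -
  have "((\<lambda>t. F (x + (t * c) *\<^sub>c v)) has_field_derivative dir_deriv F x v * c) (at 0)"
    by (rule DERIV_chain2[where g="\<lambda>t. t * c"])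
      (use line_has_derivative[of v] in \<open>auto intro!: derivative_eq_intros\<close>)
  from DERIV_imp_deriv[OF this] show ?thesis by (simp add: dir_deriv_def)
qed

text \<open>
  The difference of \<open>F\<close> and its translate by \<open>w\<close> is of order \<open>\<parallel>w\<parallel>\<close> by the Lipschitz estimate; apply
  Cauchy's estimate to this difference on a smaller ball.
\<close>

lemma dir_deriv_continuous:
  assumes w: "norm w \<le> r / 4"
  shows "norm (dir_deriv F (x + w) v - dir_deriv F x v) \<le> 8 * M * norm w * norm v / r\<^sup>2"
proof -
  define G where "G y = F (y + w) - F y" for y
  have in1: "y \<in> ball x r" "y + w \<in> ball x r" if "y \<in> ball x (r / 2)" for y
  proof -
    show "y \<in> ball x r" using that r by simp
    have "dist x (y + w) \<le> dist x y + norm w"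
      using norm_triangle_ineq[of "x - y" "- w"] by (simp add: dist_norm diff_diff_eq)
    then show "y + w \<in> ball x r" using that w r by simp
  qed
  have "bounded_line_holomorphic G x (r / 2) (4 * M * norm w / r)"
  proof
    show "line_holomorphic_on G (ball x (r / 2))"
      unfolding line_holomorphic_on_def G_def
    proof (intro allI holomorphic_on_diff)
      fix y v
      have "(\<lambda>t. F ((y + w) + t *\<^sub>c v)) holomorphic_on {t. (y + w) + t *\<^sub>c v \<in> ball x r}"
        using holo unfolding line_holomorphic_on_def by blast
      then show "(\<lambda>t. F (y + t *\<^sub>c v + w)) holomorphic_on {t. y + t *\<^sub>c v \<in> ball x (r / 2)}"
      proof -
        have eq: "(y + w) + t *\<^sub>c v = y + t *\<^sub>c v + w" for t by (simp only: add_ac)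
        assume "(\<lambda>t. F ((y + w) + t *\<^sub>c v)) holomorphic_on {t. (y + w) + t *\<^sub>c v \<in> ball x r}"
        then show ?thesis unfolding eq by (rule holomorphic_on_subset) (use in1(2) in blast)
      qed
      have "(\<lambda>t. F (y + t *\<^sub>c v)) holomorphic_on {t. y + t *\<^sub>c v \<in> ball x r}"
        using holo unfolding line_holomorphic_on_def by blast
      then show "(\<lambda>t. F (y + t *\<^sub>c v)) holomorphic_on {t. y + t *\<^sub>c v \<in> ball x (r / 2)}"
        using in1(1) by (auto elim!: holomorphic_on_subset)
    qed
    fix y assume y: "y \<in> ball x (r / 2)"
    interpret y: bounded_line_holomorphic F y "r / 2" M
    proof -
      interpret y: bounded_line_holomorphic F y "r - dist x y" M by (rule recenter[OF in1(1)[OF y]])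
      show "bounded_line_holomorphic F y (r / 2) M" by (rule y.shrink) (use y r in auto)
    qed
    show "norm (G y) \<le> 4 * M * norm w / r"
      using y.lipschitz[of w] w unfolding G_def by simp
  qed (use r in simp)
  then interpret G: bounded_line_holomorphic G x "r / 2" "4 * M * norm w / r" .
  have xw: "x + w \<in> ball x r" using in1(2)[of x] r by simp
  interpret xw: bounded_line_holomorphic F "x + w" "r - dist x (x + w)" M by (rule recenter[OF xw])
  have eq: "dir_deriv G x v = dir_deriv F (x + w) v - dir_deriv F x v"
    unfolding dir_deriv_def[of G]
    by (rule DERIV_imp_deriv)
      (use DERIV_diff[OF xw.line_has_derivative[of v] line_has_derivative[of v]] in \<open>simp add: G_def add_ac\<close>)
  show ?thesis using G.norm_dir_deriv_le[of v] r unfolding eq by (simp add: power2_eq_square field_simps)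
qed

text \<open>
  Local boundedness gives additivity in the direction without Hartogs' theorem. The increment from
  \<open>x\<close> to \<open>x + t (u + v)\<close> is expanded directly and through the intermediate point \<open>x + t u\<close>; local
  boundedness makes all remainders, and the change of the derivative in direction \<open>v\<close>, of order
  \<open>t\<^sup>2\<close>.
\<close>

lemma dir_deriv_add: "dir_deriv F x (u + v) = dir_deriv F x u + dir_deriv F x v"
proof -
  define \<Delta> where "\<Delta> = dir_deriv F x (u + v) - dir_deriv F x u - dir_deriv F x v"
  define K where "K = 2 * M * (norm (u + v) / r)\<^sup>2 + 2 * M * (norm u / r)\<^sup>2 + 8 * M * (norm v / r)\<^sup>2
    + 8 * M * norm u * norm v / r\<^sup>2"
  define b where "b = norm u + norm v + 1"
  define \<tau> where "\<tau> = r / (4 * b)"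
  have nn: "0 < b" unfolding b_def using norm_ge_zero[of u] norm_ge_zero[of v] by linarith
  have \<tau>: "\<tau> > 0" using r nn by (simp add: \<tau>_def)
  have small: "t * a \<le> r / 4" if "0 < t" "t < \<tau>" "0 \<le> a" "a \<le> b" for t a
  proof -
    have "t * a \<le> \<tau> * b" using that \<tau> by (intro mult_mono) auto
    also have "\<dots> = r / 4" using nn by (simp add: \<tau>_def)
    finally show ?thesis .
  qed
  \<comment> \<open>For \<open>t < \<tau>\<close> every increment stays within the radius where the expansions hold.\<close>
  have "norm \<Delta> \<le> K * t" if t: "0 < t" "t < \<tau>" for t
  proof -
    let ?t = "of_real t :: complex"
    have nt: "norm (?t *\<^sub>c w) = t * norm w" for w using t by (simp add: norm_scaleC_c0)
    have su: "norm (?t *\<^sub>c u) \<le> r / 4" unfolding nt by (rule small[OF t]) (auto simp: b_def)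
    have sv: "norm (?t *\<^sub>c v) \<le> r / 4" unfolding nt by (rule small[OF t]) (auto simp: b_def)
    have suv: "norm (?t *\<^sub>c (u + v)) \<le> r / 2"
      unfolding nt using small[OF t, of "norm (u + v)"] norm_triangle_ineq[of u v] r by (simp add: b_def)
    have xu: "x + ?t *\<^sub>c u \<in> ball x r" using su r by (simp add: dist_norm)
    interpret xu: bounded_line_holomorphic F "x + ?t *\<^sub>c u" "r / 2" M
    proof -
      interpret xu: bounded_line_holomorphic F "x + ?t *\<^sub>c u" "r - dist x (x + ?t *\<^sub>c u)" M
        by (rule recenter[OF xu])
      show "bounded_line_holomorphic F (x + ?t *\<^sub>c u) (r / 2) M"
        by (rule xu.shrink) (use su r in \<open>auto simp: dist_norm\<close>)
    qed
    have 1: "norm (F (x + ?t *\<^sub>c (u + v)) - F x - ?t * dir_deriv F x (u + v)) \<le> 2 * M * (norm (u + v) / r)\<^sup>2 * t\<^sup>2"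
      using second_order[OF suv] by (simp only: dir_deriv_scale nt) (simp add: power_mult_distrib power_divide mult_ac)
    have 2: "norm (F (x + ?t *\<^sub>c u) - F x - ?t * dir_deriv F x u) \<le> 2 * M * (norm u / r)\<^sup>2 * t\<^sup>2"
      using second_order[of "?t *\<^sub>c u"] su r
      by (simp only: dir_deriv_scale nt) (simp add: power_mult_distrib power_divide mult_ac)
    have 3: "norm (F (x + ?t *\<^sub>c u + ?t *\<^sub>c v) - F (x + ?t *\<^sub>c u) - ?t * dir_deriv F (x + ?t *\<^sub>c u) v)
        \<le> 8 * M * (norm v / r)\<^sup>2 * t\<^sup>2"
      using xu.second_order[of "?t *\<^sub>c v"] sv r
      by (simp only: xu.dir_deriv_scale nt) (simp add: power_mult_distrib power_divide mult_ac)
    have 4: "norm (?t * (dir_deriv F (x + ?t *\<^sub>c u) v - dir_deriv F x v)) \<le> 8 * M * norm u * norm v / r\<^sup>2 * t\<^sup>2"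
    proof -
      have "norm (?t * (dir_deriv F (x + ?t *\<^sub>c u) v - dir_deriv F x v))
        = t * norm (dir_deriv F (x + ?t *\<^sub>c u) v - dir_deriv F x v)" using t by (simp add: norm_mult)
      also have "\<dots> \<le> t * (8 * M * norm (?t *\<^sub>c u) * norm v / r\<^sup>2)"
        using t by (intro mult_left_mono dir_deriv_continuous su) auto
      finally show ?thesis by (simp add: nt power2_eq_square mult_ac)
    qed
    have eq: "?t * \<Delta> = - (F (x + ?t *\<^sub>c (u + v)) - F x - ?t * dir_deriv F x (u + v))
        + (F (x + ?t *\<^sub>c u) - F x - ?t * dir_deriv F x u)
        + (F (x + ?t *\<^sub>c u + ?t *\<^sub>c v) - F (x + ?t *\<^sub>c u) - ?t * dir_deriv F (x + ?t *\<^sub>c u) v)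
        + ?t * (dir_deriv F (x + ?t *\<^sub>c u) v - dir_deriv F x v)"
      by (simp add: \<Delta>_def scaleC_c0_add algebra_simps)
    have "norm (?t * \<Delta>) \<le> 2 * M * (norm (u + v) / r)\<^sup>2 * t\<^sup>2 + 2 * M * (norm u / r)\<^sup>2 * t\<^sup>2
        + 8 * M * (norm v / r)\<^sup>2 * t\<^sup>2 + 8 * M * norm u * norm v / r\<^sup>2 * t\<^sup>2"
      unfolding eq by (intro norm_triangle_le add_mono 2 3 4) (use 1 in \<open>simp only: norm_minus_cancel\<close>)
    also have "\<dots> = K * t * t" by (simp add: K_def algebra_simps power2_eq_square)
    finally show ?thesis using t by (simp add: norm_mult mult.commute)
  qed
  then have ev: "\<forall>\<^sub>F t in at_right 0. norm \<Delta> \<le> K * t"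
    using eventually_at_right_real[OF \<tau>] by (auto elim: eventually_mono)
  have lim: "((\<lambda>t. K * t) \<longlongrightarrow> K * 0) (at_right 0)" by (intro tendsto_intros)
  have "norm \<Delta> \<le> K * 0"
    by (rule tendsto_lowerbound[OF lim ev]) simp
  then show ?thesis by (simp add: \<Delta>_def diff_eq_eq add.commute)
qed

lemma bounded_linear_dir_deriv: "bounded_linear (dir_deriv F x)"
proof (rule bounded_linear_intro[where K="M / r"])
  show "dir_deriv F x (s *\<^sub>R v) = s *\<^sub>R dir_deriv F x v" for s v
    by (simp add: scaleR_scaleC_c0 dir_deriv_scale scaleR_conv_of_real)
  show "norm (dir_deriv F x v) \<le> norm v * (M / r)" for v
    using norm_dir_deriv_le[of v] by (simp add: mult.commute)
qed (rule dir_deriv_add)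

theorem has_derivative_dir_deriv: "(F has_derivative dir_deriv F x) (at x)"
  unfolding has_derivative_at
proof (intro conjI bounded_linear_dir_deriv)
  let ?q = "\<lambda>h. norm (F (x + h) - F x - dir_deriv F x h) / norm h"
  have b: "?q h \<le> 2 * M / r\<^sup>2 * norm h" if "norm h < r / 2" for h
  proof (cases "h = 0")
    case False
    then show ?thesis
      using second_order[of h] that by (simp add: pos_divide_le_eq power_divide power2_eq_square mult_ac)
  qed simp
  have ev: "\<forall>\<^sub>F h in at 0. norm (?q h) \<le> 2 * M / r\<^sup>2 * norm h"
    unfolding eventually_at using b r by (intro exI[of _ "r / 2"]) (auto simp: dist_norm)
  have "((\<lambda>h::c0. 2 * M / r\<^sup>2 * norm h) \<longlongrightarrow> 2 * M / r\<^sup>2 * norm (0::c0)) (at 0)"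
    by (intro tendsto_intros)
  then have "((\<lambda>h::c0. 2 * M / r\<^sup>2 * norm h) \<longlongrightarrow> 0) (at 0)" by simp
  then show "?q \<midarrow>0\<rightarrow> 0" by (rule Lim_null_comparison[OF ev])
qed

corollary complex_frechet_differentiable: "complex_frechet_differentiable_at F x"
  unfolding complex_frechet_differentiable_at_def
  using has_derivative_dir_deriv dir_deriv_scale by blast

corollary continuous_at: "isCont F x"
  by (rule has_derivative_continuous[OF has_derivative_dir_deriv])

end

lemma complex_frechet_line_holomorphic:
  assumes "open U" "\<And>x. x \<in> U \<Longrightarrow> complex_frechet_differentiable_at g x"
  shows "line_holomorphic_on g U"
  unfolding line_holomorphic_on_def
proof (intro allI)
  fix x v
  have "(\<lambda>t. g (x + t *\<^sub>c v)) field_differentiable at t" if t: "x + t *\<^sub>c v \<in> U" for t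
  proof -
    obtain L where L: "(g has_derivative L) (at (x + t *\<^sub>c v))" "\<And>c v. L (c *\<^sub>c v) = c * L v"
      using assms(2)[OF t] unfolding complex_frechet_differentiable_at_def by blast
    have "((\<lambda>t. x + t *\<^sub>c v) has_derivative (\<lambda>t. t *\<^sub>c v)) (at t)"
      by (auto intro!: derivative_eq_intros bounded_linear_imp_has_derivative bounded_linear_scaleC_left)
    from has_derivative_compose[OF this L(1)]
    have "((\<lambda>t. g (x + t *\<^sub>c v)) has_derivative (\<lambda>t. t * L v)) (at t)" by (simp add: L(2))
    then have "((\<lambda>t. g (x + t *\<^sub>c v)) has_field_derivative L v) (at t)"
      unfolding has_field_derivative_def by (simp only: mult.commute[of _ "L v"])
    then show ?thesis unfolding field_differentiable_def by blast
  qed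
  then show "(\<lambda>t. g (x + t *\<^sub>c v)) holomorphic_on {t. x + t *\<^sub>c v \<in> U}"
    unfolding holomorphic_on_def by (auto intro: field_differentiable_at_within)
qed

section \<open>Schur's theorem on weak convergence in the space of summable sequences\<close>

text \<open>
  The gliding hump. If the diagonal does not tend to zero, rows \<open>i\<^sub>1 < i\<^sub>2 < \<dots>\<close> can be chosen whose
  mass concentrates on consecutive disjoint blocks around the diagonal. Summing only over the
  diagonal indices of even blocks then gives large values for even and small values for odd rows.
\<close>

lemma schur_null:
  fixes c :: "nat \<Rightarrow> nat \<Rightarrow> complex"
  assumes sm: "\<And>i. summable (\<lambda>j. norm (c i j))" and col: "\<And>j. (\<lambda>i. c i j) \<longlonglongrightarrow> 0"
    and conv: "\<And>J. convergent (\<lambda>i. \<Sum>j. if j \<in> J then c i j else 0)"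
  shows "(\<lambda>i. c i i) \<longlonglongrightarrow> 0"
proof (rule ccontr)
  assume "\<not> ?thesis"
  then obtain e where e: "e > 0" and inf: "\<forall>N. \<exists>i\<ge>N. norm (c i i) \<ge> e"
    unfolding LIMSEQ_iff by (auto simp: not_less)
  have e8: "e / 8 > 0" using e by simp
  have "\<exists>i q. p < i \<and> i < q \<and> norm (c i i) \<ge> e \<and> (\<Sum>j\<le>p. norm (c i j)) < e / 8 \<and>
      (\<Sum>n. norm (c i (n + q))) < e / 8" for p
  proof -
    have "(\<lambda>i. \<Sum>j\<le>p. norm (c i j)) \<longlonglongrightarrow> (\<Sum>j\<le>p. norm (0::complex))"
      by (intro tendsto_intros col)
    then have "(\<lambda>i. \<Sum>j\<le>p. norm (c i j)) \<longlonglongrightarrow> 0" by simp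
    from order_tendstoD(2)[OF this e8] obtain N where N: "\<And>i. i \<ge> N \<Longrightarrow> (\<Sum>j\<le>p. norm (c i j)) < e / 8"
      by (auto simp: eventually_sequentially)
    obtain i where i: "i \<ge> max N (Suc p)" "norm (c i i) \<ge> e" using inf by blast
    obtain q where q: "\<forall>n\<ge>q. norm (\<Sum>j. norm (c i (j + n))) < e / 8"
      using suminf_exist_split[OF e8 sm[of i]] by blast
    have "(\<Sum>n. norm (c i (n + max q (Suc i)))) < e / 8"
      using q[rule_format, of "max q (Suc i)"] by simp
    then show ?thesis using i N[of i] by (intro exI[of _ i] exI[of _ "max q (Suc i)"]) auto
  qed
  then obtain I Q where IQ: "\<And>p. p < I p" "\<And>p. I p < Q p" "\<And>p. norm (c (I p) (I p)) \<ge> e"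
    "\<And>p. (\<Sum>j\<le>p. norm (c (I p) j)) < e / 8" "\<And>p. (\<Sum>n. norm (c (I p) (n + Q p))) < e / 8"
    by metis
  define p where "p k = (Q ^^ k) 0" for k
  define \<iota> where "\<iota> k = I (p k)" for k
  have pS: "p (Suc k) = Q (p k)" for k by (simp add: p_def)
  have between: "p k < \<iota> k" "\<iota> k < p (Suc k)" for k using IQ(1,2) by (auto simp: \<iota>_def pS)
  then have "strict_mono p" by (intro strict_mono_Suc_iff[THEN iffD2] allI) (meson less_trans)
  then have pmono: "p k \<le> p l" if "k \<le> l" for k l using that by (simp add: strict_mono_less_eq)
  have uniq: "l = k" if "p k < \<iota> l" "\<iota> l < p (Suc k)" for k l
  proof (rule ccontr)
    assume "l \<noteq> k"
    then have "Suc l \<le> k \<or> Suc k \<le> l" by linarith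
    then show False using pmono[of "Suc l" k] pmono[of "Suc k" l] between[of l] that by auto
  qed
  define J where "J = \<iota> ` {k. even k}"
  have inJ: "\<iota> k \<in> J \<longleftrightarrow> even k" for k
  proof
    assume "\<iota> k \<in> J"
    then obtain l where l: "even l" "\<iota> k = \<iota> l" by (auto simp: J_def)
    then have "l = k" by (intro uniq) (use between[of k] in \<open>simp_all only:\<close>)
    with l show "even k" by simp
  qed (auto simp: J_def)
  define S where "S i = (\<Sum>j. if j \<in> J then c i j else 0)" for i
  \<comment> \<open>Between \<open>p k\<close> and \<open>p (k + 1)\<close> the set \<open>J\<close> contains at most the diagonal index; the rest of the row is small.\<close>
  have est: "norm (S (\<iota> k) - (if even k then c (\<iota> k) (\<iota> k) else 0)) \<le> e / 4" for k
  proof -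
    let ?i = "\<iota> k"
    define x where "x = (if even k then c ?i ?i else 0)"
    define d where "d j = (if j \<in> J then c ?i j else 0) - (if j = ?i then x else 0)" for j
    have d_le: "norm (d j) \<le> norm (c ?i j)" for j
      using inJ[of k] by (auto simp: d_def x_def)
    have d0: "d j = 0" if "p k < j" "j < p (Suc k)" for j
    proof (cases "j \<in> J")
      case True
      then obtain l where "j = \<iota> l" by (auto simp: J_def)
      then have "j = ?i" using uniq[of k l] that by simp
      then show ?thesis using True inJ[of k] by (simp add: d_def x_def)
    next
      case False
      then show ?thesis using inJ[of k] by (auto simp: d_def x_def)
    qed
    have sd: "summable d" by (rule summable_comparison_test'[OF sm[of ?i], where N=0]) (rule d_le)
    have "(\<lambda>j. if j = ?i then x else 0) sums x" using sums_single[of ?i "\<lambda>_. x"] by simp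
    moreover have "summable (\<lambda>j. if j \<in> J then c ?i j else 0)"
      by (rule summable_comparison_test'[OF sm[of ?i], where N=0]) auto
    ultimately have "S ?i - x = suminf d"
      unfolding S_def d_def by (subst suminf_diff[symmetric]) (auto simp: sums_iff)
    also have "\<dots> = (\<Sum>n. d (n + p (Suc k))) + (\<Sum>j<p (Suc k). d j)"
      using suminf_split_initial_segment[OF sd] .
    also have "(\<Sum>j<p (Suc k). d j) = (\<Sum>j\<le>p k. d j)"
      using between[of k] by (intro sum.mono_neutral_right) (auto intro!: d0)
    also have "norm ((\<Sum>n. d (n + p (Suc k))) + (\<Sum>j\<le>p k. d j)) \<le> e / 8 + e / 8"
    proof (intro norm_triangle_le add_mono)
      have "norm (\<Sum>n. d (n + p (Suc k))) \<le> (\<Sum>n. norm (c ?i (n + p (Suc k))))"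
        by (rule norm_suminf_le[OF d_le summable_ignore_initial_segment[OF sm]])
      then show "norm (\<Sum>n. d (n + p (Suc k))) \<le> e / 8"
        using IQ(5)[of "p k"] by (simp add: \<iota>_def pS)
      have "norm (\<Sum>j\<le>p k. d j) \<le> (\<Sum>j\<le>p k. norm (c ?i j))" by (intro sum_norm_le d_le)
      then show "norm (\<Sum>j\<le>p k. d j) \<le> e / 8" using IQ(4)[of "p k"] by (simp add: \<iota>_def)
    qed
    finally show ?thesis by (simp add: x_def)
  qed
  have "Cauchy S" using conv[of J] unfolding S_def by (rule convergent_Cauchy)
  then obtain N where N: "\<And>m n. m \<ge> N \<Longrightarrow> n \<ge> N \<Longrightarrow> norm (S m - S n) < e / 4"
    using e unfolding Cauchy_def dist_norm by (metis zero_less_divide_iff zero_less_numeral)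
  have big: "\<iota> k \<ge> k" for k
    using strict_mono_imp_increasing[OF \<open>strict_mono p\<close>, of k] between(1)[of k] by linarith
  have "norm (S (\<iota> (2 * N)) - S (\<iota> (Suc (2 * N)))) < e / 4"
    using big[of "2 * N"] big[of "Suc (2 * N)"] by (intro N) linarith+
  moreover have "norm (S (\<iota> (2 * N)) - c (\<iota> (2 * N)) (\<iota> (2 * N))) \<le> e / 4" using est[of "2 * N"] by simp
  moreover have "norm (S (\<iota> (Suc (2 * N)))) \<le> e / 4" using est[of "Suc (2 * N)"] by simp
  moreover have "norm (c (\<iota> (2 * N)) (\<iota> (2 * N))) \<ge> e" using IQ(3) by (simp add: \<iota>_def)
  moreover have "norm (c (\<iota> (2 * N)) (\<iota> (2 * N))) \<le> norm (S (\<iota> (2 * N)) - c (\<iota> (2 * N)) (\<iota> (2 * N)))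
      + norm (S (\<iota> (2 * N)) - S (\<iota> (Suc (2 * N)))) + norm (S (\<iota> (Suc (2 * N))))"
    using norm_triangle_ineq4[of "S (\<iota> (2 * N))" "S (\<iota> (2 * N)) - c (\<iota> (2 * N)) (\<iota> (2 * N))"]
      norm_triangle_sub[of "S (\<iota> (2 * N))" "S (\<iota> (Suc (2 * N)))"] by simp
  ultimately show False using e by linarith
qed

text \<open>
  The column limits form a summable sequence, so they can be subtracted and themselves tend to zero.
\<close>

lemma schur:
  fixes a :: "nat \<Rightarrow> nat \<Rightarrow> complex"
  assumes bd: "\<And>i n. (\<Sum>j<n. norm (a i j)) \<le> C"
    and conv: "\<And>J. convergent (\<lambda>i. \<Sum>j. if j \<in> J then a i j else 0)"
  shows "(\<lambda>i. a i i) \<longlonglongrightarrow> 0"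
proof -
  have sa: "summable (\<lambda>j. norm (a i j))" for i
    by (rule summableI_nonneg_bounded[where x=C]) (use bd in auto)
  have "convergent (\<lambda>i. a i j)" for j
  proof -
    have "(\<Sum>k. if k \<in> {j} then a i k else 0) = a i j" for i
      using sums_single[of j "a i"] by (simp add: sums_iff)
    then show ?thesis using conv[of "{j}"] by simp
  qed
  then obtain b where b: "\<And>j. (\<lambda>i. a i j) \<longlonglongrightarrow> b j" unfolding convergent_def by metis
  have "(\<Sum>j<n. norm (b j)) \<le> C" for n
  proof (rule tendsto_upperbound)
    show "(\<lambda>i. \<Sum>j<n. norm (a i j)) \<longlonglongrightarrow> (\<Sum>j<n. norm (b j))" by (intro tendsto_intros b)
  qed (use bd in auto)
  then have sb: "summable (\<lambda>j. norm (b j))" by (intro summableI_nonneg_bounded[where x=C]) auto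
  have "(\<lambda>i. a i i - b i) \<longlonglongrightarrow> 0"
  proof (rule schur_null[where c="\<lambda>i j. a i j - b j"])
    show "summable (\<lambda>j. norm (a i j - b j))" for i
      by (rule summable_comparison_test'[OF summable_add[OF sa[of i] sb], where N=0])
        (simp add: norm_triangle_ineq4)
    show "(\<lambda>i. a i j - b j) \<longlonglongrightarrow> 0" for j
      using tendsto_diff[OF b[of j] tendsto_const[of "b j"]] by simp
    fix J
    have sJ: "summable (\<lambda>j. if j \<in> J then f j else 0)" if "summable (\<lambda>j. norm (f j))" for f :: "nat \<Rightarrow> complex"
      by (rule summable_comparison_test'[OF that, where N=0]) auto
    have "(\<Sum>j. if j \<in> J then a i j - b j else 0) =
        (\<Sum>j. if j \<in> J then a i j else 0) - (\<Sum>j. if j \<in> J then b j else 0)" for i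
    proof -
      have "(\<Sum>j. if j \<in> J then a i j - b j else 0) =
        (\<Sum>j. (if j \<in> J then a i j else 0) - (if j \<in> J then b j else 0))"
        by (rule suminf_cong) simp
      then show ?thesis by (simp only: suminf_diff[OF sJ[OF sa] sJ[OF sb]])
    qed
    then show "convergent (\<lambda>i. \<Sum>j. if j \<in> J then a i j - b j else 0)"
      using convergent_diff[OF conv[of J] convergent_const] by simp
  qed
  moreover have "b \<longlonglongrightarrow> 0" using summable_LIMSEQ_zero[OF sb] by (simp add: tendsto_norm_zero_iff)
  ultimately have "(\<lambda>i. (a i i - b i) + b i) \<longlonglongrightarrow> 0 + 0" by (rule tendsto_add)
  then show ?thesis by simp
qed

section \<open>Entire functions of polynomial growth on null sequences\<close>

text \<open>
  By induction on \<open>k\<close>, the coefficient is a uniform limit of quotients that are holomorphic in the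
  parameter.
\<close>

lemma holomorphic_taylor_coeff_parameter:
  assumes S: "open S" and R: "R > 0"
    and hol: "\<And>t. t \<in> S \<Longrightarrow> H t holomorphic_on ball 0 R"
    and bd: "\<And>t w. t \<in> S \<Longrightarrow> norm w < R \<Longrightarrow> norm (H t w) \<le> M"
    and par: "\<And>w. norm w < R \<Longrightarrow> (\<lambda>t. H t w) holomorphic_on S"
  shows "(\<lambda>t. taylor_coeff (H t) k) holomorphic_on S"
proof (induction k rule: less_induct)
  case (less k)
  show ?case
  proof (rule holomorphic_on_uniform_approx[OF S])
    fix e :: real assume e: "e > 0"
    define B where "B = 2 * \<bar>M\<bar> / R ^ Suc k + 1"
    have B: "B > 0" using R by (simp add: B_def add_nonneg_pos)
    define s where "s = min (R / 2) (e / B)"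
    have s: "s > 0" "s \<le> R / 2" "B * s \<le> e"
      using R e B by (auto simp: s_def min_def field_simps)
    define g where "g t = (H t (of_real s) - (\<Sum>i<k. taylor_coeff (H t) i * of_real s ^ i)) / of_real s ^ k" for t
    have "g holomorphic_on S"
      unfolding g_def using s R less.IH by (intro holomorphic_intros par) auto
    moreover have "norm (g t - taylor_coeff (H t) k) \<le> e" if t: "t \<in> S" for t
    proof -
      have "norm (g t - taylor_coeff (H t) k) \<le> 2 * M * norm (of_real s :: complex) / R ^ Suc k"
        unfolding g_def by (rule norm_taylor_quotient_diff_le[OF hol[OF t] bd[OF t] R]) (use s in auto)
      also have "\<dots> = 2 * M / R ^ Suc k * s" using s by simp
      also have "\<dots> \<le> B * s"
        unfolding B_def using s R by (intro mult_right_mono) (auto intro!: divide_right_mono add_increasing2)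
      finally show ?thesis using s by linarith
    qed
    ultimately show "\<exists>g. g holomorphic_on S \<and> (\<forall>t\<in>S. norm (g t - taylor_coeff (H t) k) \<le> e)" by blast
  qed
qed

lemma line_holomorphic_UNIV:
  "line_holomorphic_on F UNIV \<longleftrightarrow> (\<forall>x v. (\<lambda>t. F (x + t *\<^sub>c v)) holomorphic_on UNIV)"
  by (simp add: line_holomorphic_on_def)

text \<open>
  By Liouville such a function is a polynomial of degree at most \<open>d\<close> on every complex line. The growth
  condition describes the polynomials on \<open>c\<^sub>0\<close> without multilinear maps, and with a fixed constant \<open>M\<close>
  it survives pointwise limits.
\<close>

definition poly_growth :: "nat \<Rightarrow> real \<Rightarrow> (c0 \<Rightarrow> complex) \<Rightarrow> bool" where
  "poly_growth d M F \<longleftrightarrow> line_holomorphic_on F UNIV \<and> (\<forall>x. norm (F x) \<le> M * (1 + norm x) ^ d)"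

lemma poly_growth_nonneg: "poly_growth d M F \<Longrightarrow> M \<ge> 0"
  using order_trans[OF norm_ge_zero, of "F 0" M] by (auto simp: poly_growth_def dest: spec[of _ 0])

lemma poly_growth_bounded_line:
  assumes F: "poly_growth d M F" and r: "r > 0"
  shows "bounded_line_holomorphic F x r (M * (1 + norm x + r) ^ d)"
proof
  show "line_holomorphic_on F (ball x r)"
    using F line_holomorphic_on_subset[of F UNIV] by (simp add: poly_growth_def)
  fix y assume "y \<in> ball x r"
  then have "norm y \<le> norm x + r"
    using norm_triangle_ineq4[of x "x - y"] by (simp add: dist_norm)
  then have "M * (1 + norm y) ^ d \<le> M * (1 + norm x + r) ^ d"
    using poly_growth_nonneg[OF F] by (intro mult_left_mono power_mono) auto
  moreover have "norm (F y) \<le> M * (1 + norm y) ^ d" using F by (simp add: poly_growth_def)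
  ultimately show "norm (F y) \<le> M * (1 + norm x + r) ^ d" by linarith
qed (rule r)

lemma poly_growth_continuous:
  assumes "poly_growth d M F" shows "isCont F x"
proof -
  interpret bounded_line_holomorphic F x 1 "M * (1 + norm x + 1) ^ d"
    by (rule poly_growth_bounded_line[OF assms]) simp
  show ?thesis by (rule continuous_at)
qed

text \<open>A directional derivative has growth of one order less: apply Cauchy's estimate at scale \<open>1 + \<parallel>x\<parallel>\<close>.\<close>

lemma poly_growth_dir_deriv:
  assumes F: "poly_growth (Suc d) M F" and v: "norm v \<le> 1"
  shows "poly_growth d (2 ^ Suc d * M) (\<lambda>x. dir_deriv F x v)"
  unfolding poly_growth_def
proof (intro conjI allI)
  note lh = F[unfolded poly_growth_def line_holomorphic_UNIV, THEN conjunct1, rule_format]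
  show "line_holomorphic_on (\<lambda>x. dir_deriv F x v) UNIV"
    unfolding line_holomorphic_UNIV
  proof (intro allI)
    fix x w
    have "(\<lambda>t. dir_deriv F (x + t *\<^sub>c w) v) holomorphic_on ball 0 B" for B
      unfolding dir_deriv_eq_taylor_coeff
    proof (rule holomorphic_taylor_coeff_parameter[where R=1 and M="M * (1 + (norm x + B * norm w + 1)) ^ Suc d"])
      show "(\<lambda>s. F (x + t *\<^sub>c w + s *\<^sub>c v)) holomorphic_on ball 0 1" for t
        using lh by (rule holomorphic_on_subset) simp
      show "(\<lambda>t. F (x + t *\<^sub>c w + s *\<^sub>c v)) holomorphic_on ball 0 B" for s
        using holomorphic_on_subset[OF lh[of "x + s *\<^sub>c v" w], of "ball 0 B"] by (simp add: add_ac)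
      fix t s :: complex assume ts: "t \<in> ball 0 B" "norm s < 1"
      have B0: "0 \<le> B" using ts(1) order_le_less_trans[OF norm_ge_zero, of t B] by simp
      have "norm (x + t *\<^sub>c w + s *\<^sub>c v) \<le> norm x + norm (t *\<^sub>c w) + norm (s *\<^sub>c v)"
        by (meson add_right_mono norm_triangle_ineq order_trans)
      also have "\<dots> \<le> norm x + B * norm w + 1 * 1"
        unfolding norm_scaleC_c0 using ts v B0 by (intro add_mono mult_mono order_refl) auto
      finally have "M * (1 + norm (x + t *\<^sub>c w + s *\<^sub>c v)) ^ Suc d \<le> M * (1 + (norm x + B * norm w + 1)) ^ Suc d"
        using poly_growth_nonneg[OF F] by (intro mult_left_mono power_mono) auto
      then show "norm (F (x + t *\<^sub>c w + s *\<^sub>c v)) \<le> M * (1 + (norm x + B * norm w + 1)) ^ Suc d"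
        using F order_trans unfolding poly_growth_def by blast
    qed auto
    then have "(\<lambda>t. dir_deriv F (x + t *\<^sub>c w) v) field_differentiable at t" for t
      using holomorphic_on_imp_differentiable_at[of _ "ball 0 (norm t + 1)" t] by simp
    then show "(\<lambda>t. dir_deriv F (x + t *\<^sub>c w) v) holomorphic_on UNIV"
      by (simp add: holomorphic_on_def field_differentiable_at_within)
  qed
  fix x :: c0
  have x: "1 + norm x > 0" using norm_ge_zero[of x] by linarith
  interpret bounded_line_holomorphic F x "1 + norm x" "M * (1 + norm x + (1 + norm x)) ^ Suc d"
    by (rule poly_growth_bounded_line[OF F x])
  have "norm (dir_deriv F x v) \<le> M * (1 + norm x + (1 + norm x)) ^ Suc d * norm v / (1 + norm x)"
    by (rule norm_dir_deriv_le)
  also have "\<dots> \<le> M * (1 + norm x + (1 + norm x)) ^ Suc d * 1 / (1 + norm x)"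
    using v x M_nonneg by (intro divide_right_mono mult_left_mono) auto
  also have "1 + norm x + (1 + norm x) = 2 * (1 + norm x)" by simp
  also have "M * (2 * (1 + norm x)) ^ Suc d * 1 / (1 + norm x) = 2 ^ Suc d * M * (1 + norm x) ^ d"
  proof -
    have "M * (2 * a) ^ Suc d * 1 / a = 2 ^ Suc d * M * a ^ d" if "a > 0" for a :: real
      using that by (simp add: power_mult_distrib)
    then show ?thesis using x .
  qed
  finally show "norm (dir_deriv F x v) \<le> 2 ^ Suc d * M * (1 + norm x) ^ d" .
qed

text \<open>
  Montel's theorem on each line turns pointwise into locally uniform convergence of a subsequence.
\<close>

lemma poly_growth_limit:
  assumes F: "\<And>n. poly_growth d M (F n)" and lim: "\<And>x. (\<lambda>n. F n x) \<longlonglongrightarrow> G x"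
  shows "poly_growth d M G"
  unfolding poly_growth_def line_holomorphic_UNIV
proof (intro conjI allI)
  fix x
  show "norm (G x) \<le> M * (1 + norm x) ^ d"
    by (rule tendsto_upperbound[OF tendsto_norm[OF lim[of x]]]) (use F in \<open>auto simp: poly_growth_def\<close>)
next
  fix x v
  let ?H = "{h. h holomorphic_on UNIV \<and> (\<forall>t. norm (h t) \<le> M * (1 + norm (x + t *\<^sub>c v)) ^ d)}"
  obtain g r where g: "g holomorphic_on UNIV" "strict_mono (r :: nat \<Rightarrow> nat)"
    "\<And>t. t \<in> UNIV \<Longrightarrow> (\<lambda>n. F (r n) (x + t *\<^sub>c v)) \<longlonglongrightarrow> g t"
  proof (rule Montel[of UNIV ?H "\<lambda>n t. F n (x + t *\<^sub>c v)"])
    fix K :: "complex set" assume "compact K" "K \<subseteq> UNIV"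
    then obtain B where B: "\<And>t. t \<in> K \<Longrightarrow> norm t \<le> B" using compact_imp_bounded bounded_iff by metis
    have "norm (h t) \<le> M * (1 + (norm x + B * norm v)) ^ d" if h: "h \<in> ?H" and t: "t \<in> K" for h t
    proof -
      have "norm (x + t *\<^sub>c v) \<le> norm x + norm t * norm v"
        using norm_triangle_ineq[of x "t *\<^sub>c v"] by (simp add: norm_scaleC_c0)
      also have "\<dots> \<le> norm x + B * norm v" using B[OF t] by (intro add_mono mult_right_mono) auto
      finally have "M * (1 + norm (x + t *\<^sub>c v)) ^ d \<le> M * (1 + (norm x + B * norm v)) ^ d"
        using poly_growth_nonneg[OF F] by (intro mult_left_mono power_mono) auto
      then show ?thesis using h order_trans by blast
    qed
    then show "\<exists>B. \<forall>h\<in>?H. \<forall>t\<in>K. norm (h t) \<le> B" by blast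
  next
    show "range (\<lambda>n t. F n (x + t *\<^sub>c v)) \<subseteq> ?H"
      using F by (auto simp: poly_growth_def line_holomorphic_UNIV)
  qed (auto intro: that)
  have "g t = G (x + t *\<^sub>c v)" for t
  proof (rule LIMSEQ_unique[OF g(3)])
    show "(\<lambda>n. F (r n) (x + t *\<^sub>c v)) \<longlonglongrightarrow> G (x + t *\<^sub>c v)"
      using LIMSEQ_subseq_LIMSEQ[OF lim g(2), of "x + t *\<^sub>c v"] by (simp add: o_def)
  qed simp
  then have "g = (\<lambda>t. G (x + t *\<^sub>c v))" by (rule ext)
  with g(1) show "(\<lambda>t. G (x + t *\<^sub>c v)) holomorphic_on UNIV" by simp
qed

section \<open>Derivatives along disjoint blocks\<close>

lemma c0_nth_simps [simp]:
  "c0_nth 0 n = 0" "c0_nth (x + y) n = c0_nth x n + c0_nth y n" "c0_nth (x - y) n = c0_nth x n - c0_nth y n"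
  "c0_nth (c *\<^sub>c x) n = c * c0_nth x n"
  by (simp_all add: zero_c0.rep_eq plus_c0.rep_eq minus_c0.rep_eq scaleC_c0.rep_eq)

lemma c0_nth_sum: "c0_nth (\<Sum>i\<in>I. f i) n = (\<Sum>i\<in>I. c0_nth (f i) n)"
  by (induction I rule: infinite_finite_induct) simp_all

definition disjoint_blocks :: "(nat \<Rightarrow> c0) \<Rightarrow> bool" where
  "disjoint_blocks u \<longleftrightarrow> (\<forall>j. norm (u j) \<le> 1) \<and>
     (\<forall>j k n. c0_nth (u j) n \<noteq> 0 \<longrightarrow> c0_nth (u k) n \<noteq> 0 \<longrightarrow> j = k)"

lemma norm_block_sum_le:
  assumes u: "disjoint_blocks u" and I: "finite I" and \<theta>: "\<And>j. norm (\<theta> j) \<le> (1::real)"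
  shows "norm (\<Sum>j\<in>I. \<theta> j *\<^sub>c u j) \<le> 1"
proof (rule norm_c0_leI)
  fix n
  show "norm (c0_nth (\<Sum>j\<in>I. \<theta> j *\<^sub>c u j) n) \<le> 1"
  proof (cases "\<exists>k\<in>I. c0_nth (u k) n \<noteq> 0")
    case True
    then obtain k where k: "k \<in> I" "c0_nth (u k) n \<noteq> 0" by blast
    have "(\<Sum>j\<in>I. \<theta> j * c0_nth (u j) n) = (\<Sum>j\<in>{k}. \<theta> j * c0_nth (u j) n)"
      using u k I by (intro sum.mono_neutral_right) (auto simp: disjoint_blocks_def)
    moreover have "norm (\<theta> k * c0_nth (u k) n) \<le> 1"
      unfolding norm_mult using \<theta>[of k] u norm_c0_nth_le[of "u k" n]
      by (intro mult_le_one) (auto simp: disjoint_blocks_def intro: order_trans)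
    ultimately show ?thesis by (simp add: c0_nth_sum)
  next
    case False
    then show ?thesis by (simp add: c0_nth_sum)
  qed
qed

lemma dir_deriv_sum:
  assumes "poly_growth d M F"
  shows "dir_deriv F x (\<Sum>j\<in>I. \<theta> j *\<^sub>c u j) = (\<Sum>j\<in>I. \<theta> j * dir_deriv F x (u j))"
proof -
  interpret bounded_line_holomorphic F x 1 "M * (1 + norm x + 1) ^ d"
    by (rule poly_growth_bounded_line[OF assms]) simp
  have "dir_deriv F x 0 = 0" using dir_deriv_scale[of 0 0] by simp
  then show ?thesis
    by (induction I rule: infinite_finite_induct) (simp_all add: dir_deriv_add dir_deriv_scale)
qed

text \<open>
  Multiplying the blocks by suitable phases makes all derivatives nonnegative. As the blocks are disjoint,
  the sum of the rotated blocks is still in the unit ball, and its derivative is the sum.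
\<close>

lemma sum_block_derivatives_le:
  assumes F: "poly_growth (Suc d) M F" and u: "disjoint_blocks u" and I: "finite I"
  shows "(\<Sum>j\<in>I. norm (dir_deriv F x (u j))) \<le> 2 ^ Suc d * M * (1 + norm x) ^ d"
proof -
  define \<theta> where "\<theta> j = cnj (sgn (dir_deriv F x (u j)))" for j
  have \<theta>: "norm (\<theta> j) \<le> 1" for j by (simp add: \<theta>_def norm_sgn)
  have "\<theta> j * dir_deriv F x (u j) = of_real (norm (dir_deriv F x (u j)))" for j
  proof (cases "dir_deriv F x (u j) = 0")
    case False
    then show ?thesis
      using complex_norm_square[of "dir_deriv F x (u j)"]
      by (simp add: \<theta>_def sgn_div_norm scaleR_conv_of_real power2_eq_square field_simps)
  qed simp
  then have "dir_deriv F x (\<Sum>j\<in>I. \<theta> j *\<^sub>c u j) = of_real (\<Sum>j\<in>I. norm (dir_deriv F x (u j)))"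
    by (simp add: dir_deriv_sum[OF F])
  moreover have "norm (dir_deriv F x (\<Sum>j\<in>I. \<theta> j *\<^sub>c u j)) \<le> 2 ^ Suc d * M * (1 + norm x) ^ d"
    using poly_growth_dir_deriv[OF F norm_block_sum_le[OF u I \<theta>]] by (simp only: poly_growth_def)
  ultimately have "norm (of_real (\<Sum>j\<in>I. norm (dir_deriv F x (u j))) :: complex) \<le> 2 ^ Suc d * M * (1 + norm x) ^ d"
    by simp
  then show ?thesis unfolding norm_of_real by (simp only: abs_le_iff)
qed

text \<open>
  The blocks need not sum to a null sequence, so the series is not itself a directional derivative. It is
  the pointwise limit of derivatives along finite sums of blocks, with a common growth constant.
\<close>

lemma poly_growth_block_series:
  assumes F: "poly_growth (Suc d) M F" and u: "disjoint_blocks u"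
  shows "poly_growth d (2 ^ Suc d * M) (\<lambda>x. \<Sum>j. if j \<in> J then dir_deriv F x (u j) else 0)"
proof (rule poly_growth_limit)
  let ?\<theta> = "\<lambda>j. if j \<in> J then 1 else 0 :: complex"
  show "poly_growth d (2 ^ Suc d * M) (\<lambda>x. dir_deriv F x (\<Sum>j<n. ?\<theta> j *\<^sub>c u j))" for n
    by (intro poly_growth_dir_deriv[OF F] norm_block_sum_le[OF u]) auto
  fix x
  have "summable (\<lambda>j. norm (dir_deriv F x (u j)))"
    by (rule summableI_nonneg_bounded[where x="2 ^ Suc d * M * (1 + norm x) ^ d"])
      (use sum_block_derivatives_le[OF F u] in auto)
  then have "summable (\<lambda>j. if j \<in> J then dir_deriv F x (u j) else 0)"
    by (rule summable_comparison_test'[where N=0]) auto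
  then have "(\<lambda>n. \<Sum>j<n. if j \<in> J then dir_deriv F x (u j) else 0) \<longlonglongrightarrow> (\<Sum>j. if j \<in> J then dir_deriv F x (u j) else 0)"
    by (rule summable_LIMSEQ)
  moreover have "?\<theta> j * z = (if j \<in> J then z else 0)" for j z by simp
  ultimately show "(\<lambda>n. dir_deriv F x (\<Sum>j<n. ?\<theta> j *\<^sub>c u j)) \<longlonglongrightarrow> (\<Sum>j. if j \<in> J then dir_deriv F x (u j) else 0)"
    by (simp only: dir_deriv_sum[OF F])
qed

section \<open>Uniform approximation by finitely many coordinates\<close>

definition truncate :: "nat \<Rightarrow> (nat \<Rightarrow> complex) \<Rightarrow> c0" where
  "truncate m z = Abs_c0 (\<lambda>i. if i < m then z i else 0)"

lemma c0_nth_truncate [simp]: "c0_nth (truncate m z) i = (if i < m then z i else 0)"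
proof -
  have "(\<lambda>i. if i < m then z i else 0) \<longlonglongrightarrow> 0"
    by (rule tendsto_eventually) (auto simp: eventually_sequentially intro!: exI[of _ m])
  then show ?thesis by (simp add: truncate_def Abs_c0_inverse)
qed

lemma norm_truncate_le: "0 \<le> b \<Longrightarrow> (\<And>i. i < m \<Longrightarrow> norm (z i) \<le> b) \<Longrightarrow> norm (truncate m z) \<le> b"
  by (rule norm_c0_leI) simp

definition c0_unit :: "nat \<Rightarrow> c0" where
  "c0_unit i = truncate (Suc i) (\<lambda>j. if j = i then 1 else 0)"

lemma c0_nth_unit [simp]: "c0_nth (c0_unit i) j = (if j = i then 1 else 0)"
  by (simp add: c0_unit_def)

lemma truncate_eq_sum: "truncate m z = (\<Sum>i<m. z i *\<^sub>c c0_unit i)"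
  by (rule c0_eqI) (simp add: c0_nth_sum sum.delta if_distrib cong: if_cong)

lemma continuous_on_truncate: "continuous_on S (truncate m)"
proof -
  have "continuous_on S (\<lambda>z. 0 + z i *\<^sub>c c0_unit i)" for i
    by (rule continuous_on_compose2[OF continuous_on_cline[of UNIV 0] continuous_on_coord]) simp
  then have "continuous_on S (\<lambda>z. \<Sum>i<m. z i *\<^sub>c c0_unit i)" by (intro continuous_on_sum) simp
  then show ?thesis by (simp only: truncate_eq_sum[abs_def])
qed

lemma truncate_tendsto: "(\<lambda>m. truncate m (c0_nth x)) \<longlonglongrightarrow> x"
proof (rule LIMSEQ_I)
  fix e :: real assume "e > 0"
  then obtain N where N: "\<And>n. n \<ge> N \<Longrightarrow> norm (c0_nth x n) < e / 2"
    using LIMSEQ_D[OF c0_nth_tendsto, of "e / 2" x] by auto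
  have "norm (truncate m (c0_nth x) - x) \<le> e / 2" if "m \<ge> N" for m
    by (rule norm_c0_leI) (use N that \<open>e > 0\<close> in \<open>auto intro: less_imp_le\<close>)
  then show "\<exists>N. \<forall>m\<ge>N. norm (truncate m (c0_nth x) - x) < e"
    using \<open>e > 0\<close> by (intro exI[of _ N]) fastforce
qed

lemma c0_nth_closed_polydisc: "norm x \<le> 1 \<Longrightarrow> c0_nth x \<in> closed_polydisc"
  unfolding mem_closed_polydisc using norm_c0_nth_le order_trans by blast

lemma poly_growth_mean_value:
  assumes F: "poly_growth d M F"
    and B: "\<And>\<tau>. 0 \<le> \<tau> \<Longrightarrow> \<tau> \<le> 1 \<Longrightarrow> norm (dir_deriv F (x + of_real \<tau> *\<^sub>c u) u) \<le> B"
  shows "norm (F (x + u) - F x) \<le> B"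
proof -
  have der: "((\<lambda>t. F (x + t *\<^sub>c u)) has_field_derivative dir_deriv F (x + t *\<^sub>c u) u) (at t)" for t
  proof -
    interpret bounded_line_holomorphic F "x + t *\<^sub>c u" 1 "M * (1 + norm (x + t *\<^sub>c u) + 1) ^ d"
      by (rule poly_growth_bounded_line[OF F]) simp
    have eq: "x + t *\<^sub>c u + s *\<^sub>c u = x + (s + t) *\<^sub>c u" for s
      by (simp add: scaleC_c0_add add_ac)
    have "((\<lambda>s. F (x + (s + t) *\<^sub>c u)) has_field_derivative dir_deriv F (x + t *\<^sub>c u) u) (at 0)"
      using line_has_derivative[of u] unfolding eq .
    then show ?thesis
      using DERIV_shift[of "\<lambda>t. F (x + t *\<^sub>c u)" "dir_deriv F (x + t *\<^sub>c u) u" 0 t] by simp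
  qed
  have "norm (F (x + 1 *\<^sub>c u) - F (x + 0 *\<^sub>c u)) \<le> B * norm (1 - 0 :: complex)"
  proof (rule field_differentiable_bound[where S="closed_segment 0 1" and f="\<lambda>t. F (x + t *\<^sub>c u)"])
    show "((\<lambda>t. F (x + t *\<^sub>c u)) has_field_derivative dir_deriv F (x + t *\<^sub>c u) u) (at t within closed_segment 0 1)" for t
      using der by (rule has_field_derivative_at_within)
    show "norm (dir_deriv F (x + t *\<^sub>c u) u) \<le> B" if "t \<in> closed_segment 0 1" for t
      using that B by (auto simp: closed_segment_def scaleR_conv_of_real)
  qed auto
  then show ?thesis by simp
qed

lemma closed_polydisc_convergent_subsequence:
  fixes y :: "nat \<Rightarrow> c0"
  assumes y: "\<And>i. norm (y i) \<le> 1"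
  obtains r l where "strict_mono (r :: nat \<Rightarrow> nat)" "\<And>n. (\<lambda>i. c0_nth (y (r i)) n) \<longlonglongrightarrow> l n"
proof -
  have "seq_compact closed_polydisc" using compact_closed_polydisc by (rule compact_imp_seq_compact)
  moreover have "\<forall>i. c0_nth (y i) \<in> closed_polydisc" using y c0_nth_closed_polydisc by blast
  ultimately obtain l r where r: "strict_mono r" "((\<lambda>i. c0_nth (y i)) \<circ> r) \<longlonglongrightarrow> l"
    unfolding seq_compact_def by metis
  have "(\<lambda>i. c0_nth (y (r i)) n) \<longlonglongrightarrow> l n" for n
    using continuous_on_tendsto_compose[OF continuous_on_coord[of UNIV n] r(2)] by (simp add: o_def)
  then show thesis by (rule that[OF r(1)])
qed

text \<open>
  Up to a small error only finitely many coordinates matter, and in these the sequence converges in norm.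
\<close>

lemma convergent_of_truncation:
  assumes F: "poly_growth d M F"
    and tr: "\<And>e. e > 0 \<Longrightarrow> \<exists>m. \<forall>x. norm x \<le> 1 \<longrightarrow> norm (F x - F (truncate m (c0_nth x))) \<le> e"
    and y: "\<And>i. norm (y i) \<le> 1" and l: "\<And>n. (\<lambda>i. c0_nth (y i) n) \<longlonglongrightarrow> l n"
  shows "convergent (\<lambda>i::nat. F (y i))"
proof -
  have "Cauchy (\<lambda>i. F (y i))"
    unfolding Cauchy_def dist_norm
  proof (intro allI impI)
    fix e :: real assume e: "e > 0"
    then obtain m where m: "\<And>x. norm x \<le> 1 \<Longrightarrow> norm (F x - F (truncate m (c0_nth x))) \<le> e / 4"
      using tr[of "e / 4"] by auto
    have "(\<lambda>i. \<Sum>n<m. 0 + c0_nth (y i) n *\<^sub>c c0_unit n) \<longlonglongrightarrow> (\<Sum>n<m. 0 + l n *\<^sub>c c0_unit n)"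
      by (intro tendsto_sum continuous_on_tendsto_compose[OF continuous_on_cline[of UNIV 0] l]) auto
    then have "(\<lambda>i. truncate m (c0_nth (y i))) \<longlonglongrightarrow> truncate m l" by (simp add: truncate_eq_sum)
    then have "(\<lambda>i. F (truncate m (c0_nth (y i)))) \<longlonglongrightarrow> F (truncate m l)"
      by (rule isCont_tendsto_compose[OF poly_growth_continuous[OF F]])
    then have "Cauchy (\<lambda>i. F (truncate m (c0_nth (y i))))" by (rule LIMSEQ_imp_Cauchy)
    then obtain N where N: "\<And>i j. i \<ge> N \<Longrightarrow> j \<ge> N \<Longrightarrow>
        norm (F (truncate m (c0_nth (y i))) - F (truncate m (c0_nth (y j)))) < e / 4"
      using e unfolding Cauchy_def dist_norm by (metis zero_less_divide_iff zero_less_numeral)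
    have "norm (F (y i) - F (y j)) < e" if "i \<ge> N" "j \<ge> N" for i j
    proof -
      let ?a = "F (y i)" and ?b = "F (truncate m (c0_nth (y i)))" and ?c = "F (truncate m (c0_nth (y j)))" and ?d = "F (y j)"
      have "norm (?a - ?d) \<le> norm (?a - ?b) + norm (?b - ?c) + norm (?c - ?d)"
        using norm_triangle_ineq[of "?a - ?b" "?b - ?d"] norm_triangle_ineq[of "?b - ?c" "?c - ?d"] by simp
      then show ?thesis
        using m[OF y[of i]] m[OF y[of j]] N[OF that] e by (simp add: norm_minus_commute)
    qed
    then show "\<exists>N. \<forall>i\<ge>N. \<forall>j\<ge>N. norm (F (y i) - F (y j)) < e" by blast
  qed
  then show ?thesis by (simp add: Cauchy_convergent_iff)
qed

text \<open>
  If \<open>F\<close> changes by more than \<open>e\<close> when a tail of \<open>x\<close> is removed, then it does so when only a finite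
  block of the tail is removed, and by the mean value theorem the derivative along this block exceeds
  \<open>e\<close> somewhere on the segment.
\<close>

lemma truncation_failure_block:
  assumes F: "poly_growth d M F"
    and fail: "\<And>m0. \<exists>m\<ge>m0. \<exists>x. norm x \<le> 1 \<and> norm (F x - F (truncate m (c0_nth x))) > e"
  shows "\<exists>q>p. \<exists>y u. norm y \<le> 1 \<and> norm u \<le> 1 \<and> (\<forall>i. c0_nth u i \<noteq> 0 \<longrightarrow> p \<le> i \<and> i < q) \<and>
    norm (dir_deriv F y u) > e"
proof -
  obtain m x where mx: "m \<ge> p" "norm x \<le> 1" "norm (F x - F (truncate m (c0_nth x))) > e"
    using fail by blast
  have "(\<lambda>k. norm (F (truncate k (c0_nth x)) - F (truncate m (c0_nth x)))) \<longlonglongrightarrow> norm (F x - F (truncate m (c0_nth x)))"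
    by (intro tendsto_intros isCont_tendsto_compose[OF poly_growth_continuous[OF F]] truncate_tendsto)
  from order_tendstoD(1)[OF this mx(3)] obtain N where
    N: "\<And>k. k \<ge> N \<Longrightarrow> norm (F (truncate k (c0_nth x)) - F (truncate m (c0_nth x))) > e"
    by (auto simp: eventually_sequentially)
  define q where "q = max N (Suc m)"
  define x' where "x' = truncate m (c0_nth x)"
  define u where "u = truncate q (c0_nth x) - x'"
  have u_nth: "c0_nth u i = (if m \<le> i \<and> i < q then c0_nth x i else 0)" for i
    by (auto simp: u_def x'_def q_def)
  have xn: "norm (c0_nth x i) \<le> 1" for i using norm_c0_nth_le[of x i] mx(2) by linarith
  have "norm (F (x' + u) - F x') > e" using N[of q] by (simp add: u_def x'_def q_def)
  then obtain \<tau> where \<tau>: "0 \<le> \<tau>" "\<tau> \<le> 1" "norm (dir_deriv F (x' + of_real \<tau> *\<^sub>c u) u) > e"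
    using poly_growth_mean_value[OF F, of x' u e] by (meson not_le)
  have "norm (x' + of_real \<tau> *\<^sub>c u) \<le> 1"
    by (rule norm_c0_leI) (use \<tau> xn in \<open>auto simp: x'_def u_nth norm_mult intro!: mult_le_one\<close>)
  moreover have "norm u \<le> 1" by (rule norm_c0_leI) (use xn in \<open>auto simp: u_nth\<close>)
  moreover have "\<forall>i. c0_nth u i \<noteq> 0 \<longrightarrow> p \<le> i \<and> i < q" using mx(1) by (auto simp: u_nth)
  moreover have "q > p" using mx(1) by (simp add: q_def)
  ultimately show ?thesis using \<tau>(3) by blast
qed

text \<open>
  Induction on the growth exponent. If truncation did not converge uniformly, there would be
  disjoint blocks \<open>u\<^sub>j\<close> and coordinatewise convergent points \<open>y\<^sub>j\<close> of the unit ball at which the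
  derivative along \<open>u\<^sub>j\<close> stays large. For every set \<open>J\<close> of indices the sum over \<open>J\<close> of the
  derivatives along the blocks is a function of smaller growth, so by induction it converges along
  \<open>y\<^sub>i\<close>. Schur's theorem makes the diagonal of the matrix of derivatives tend to zero.
\<close>

theorem poly_growth_truncation:
  assumes "poly_growth d M F" "e > 0"
  shows "\<exists>m0. \<forall>m\<ge>m0. \<forall>x. norm x \<le> 1 \<longrightarrow> norm (F x - F (truncate m (c0_nth x))) \<le> e"
  using assms
proof (induction d arbitrary: M F e)
  case 0
  have c: "F x = F 0" for x
  proof -
    have "(\<lambda>t. F (0 + t *\<^sub>c x)) holomorphic_on UNIV"
      using 0(1) unfolding poly_growth_def line_holomorphic_UNIV by blast
    moreover have "bounded (range (\<lambda>t. F (0 + t *\<^sub>c x)))"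
      using 0(1) unfolding poly_growth_def bounded_iff by auto
    ultimately obtain c where "\<And>t. F (0 + t *\<^sub>c x) = c"
      using Liouville_theorem[of "\<lambda>t. F (0 + t *\<^sub>c x)"] unfolding constant_on_def by auto
    from this[of 1] this[of 0] show ?thesis by simp
  qed
  have "norm (F x - F (truncate m (c0_nth x))) \<le> e" for x m
    using c[of x] c[of "truncate m (c0_nth x)"] 0(2) by simp
  then show ?case by blast
next
  case (Suc d)
  note F = Suc.prems(1) and e = Suc.prems(2)
  show ?case
  proof (rule ccontr)
    assume "\<not> ?case"
    then have fail: "\<exists>m\<ge>m0. \<exists>x. norm x \<le> 1 \<and> norm (F x - F (truncate m (c0_nth x))) > e" for m0
      by (meson not_le)
    have "\<forall>p. \<exists>q>p. \<exists>y u. norm y \<le> 1 \<and> norm u \<le> 1 \<and> (\<forall>i. c0_nth u i \<noteq> 0 \<longrightarrow> p \<le> i \<and> i < q) \<and>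
        norm (dir_deriv F y u) > e"
      using truncation_failure_block[OF F fail] by blast
    then obtain Q Y U where Q: "\<And>p. Q p > p" and Y: "\<And>p. norm (Y p) \<le> 1" and U: "\<And>p. norm (U p) \<le> 1"
      and supp: "\<And>p i. c0_nth (U p) i \<noteq> 0 \<Longrightarrow> p \<le> i \<and> i < Q p"
      and large: "\<And>p. norm (dir_deriv F (Y p) (U p)) > e"
      by metis
    define p where "p k = (Q ^^ k) 0" for k
    have pS: "p (Suc k) = Q (p k)" for k by (simp add: p_def)
    have "strict_mono p" using Q by (intro strict_mono_Suc_iff[THEN iffD2]) (simp add: pS)
    then have pmono: "p k \<le> p l" if "k \<le> l" for k l using that by (simp add: strict_mono_less_eq)
    obtain r l where r: "strict_mono (r :: nat \<Rightarrow> nat)"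
      and l: "\<And>n. (\<lambda>i. c0_nth (Y (p (r i))) n) \<longlonglongrightarrow> l n"
      by (rule closed_polydisc_convergent_subsequence[of "\<lambda>i. Y (p i)"]) (auto intro: Y)
    define y where "y i = Y (p (r i))" for i
    define u where "u j = U (p (r j))" for j
    have u: "disjoint_blocks u"
      unfolding disjoint_blocks_def
    proof (intro conjI allI impI)
      show "norm (u j) \<le> 1" for j by (simp add: u_def U)
      fix j k n assume "c0_nth (u j) n \<noteq> 0" "c0_nth (u k) n \<noteq> 0"
      then have n: "p (r j) \<le> n" "n < p (Suc (r j))" "p (r k) \<le> n" "n < p (Suc (r k))"
        using supp unfolding u_def pS by blast+
      have "r j = r k"
      proof (rule ccontr)
        assume "r j \<noteq> r k"
        then have "Suc (r j) \<le> r k \<or> Suc (r k) \<le> r j" by linarith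
        then show False using pmono[of "Suc (r j)" "r k"] pmono[of "Suc (r k)" "r j"] n by auto
      qed
      then show "j = k" using r by (simp add: strict_mono_eq)
    qed
    have M: "M \<ge> 0" by (rule poly_growth_nonneg[OF F])
    have "(\<lambda>i. dir_deriv F (y i) (u i)) \<longlonglongrightarrow> 0"
    proof (rule schur[where a="\<lambda>i j. dir_deriv F (y i) (u j)"])
      fix i n :: nat
      have "(\<Sum>j<n. norm (dir_deriv F (y i) (u j))) \<le> 2 ^ Suc d * M * (1 + norm (y i)) ^ d"
        by (rule sum_block_derivatives_le[OF F u]) simp
      also have "\<dots> \<le> 2 ^ Suc d * M * (1 + 1) ^ d"
        using M Y by (intro mult_left_mono power_mono) (auto simp: y_def)
      finally show "(\<Sum>j<n. norm (dir_deriv F (y i) (u j))) \<le> 2 ^ Suc d * M * (1 + 1) ^ d" .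
    next
      fix J
      note G = poly_growth_block_series[OF F u, of J]
      show "convergent (\<lambda>i. \<Sum>j. if j \<in> J then dir_deriv F (y i) (u j) else 0)"
      proof (rule convergent_of_truncation[OF G])
        fix e' :: real assume "e' > 0"
        from Suc.IH[OF G this] show "\<exists>m. \<forall>x. norm x \<le> 1 \<longrightarrow>
            norm ((\<Sum>j. if j \<in> J then dir_deriv F x (u j) else 0) -
              (\<Sum>j. if j \<in> J then dir_deriv F (truncate m (c0_nth x)) (u j) else 0)) \<le> e'"
          by blast
      qed (use Y l in \<open>auto simp: y_def\<close>)
    qed
    from LIMSEQ_D[OF this e] obtain i where "norm (dir_deriv F (y i) (u i) - 0) < e" by blast
    with large[of "p (r i)"] show False by (simp add: y_def u_def)
  qed
qed

lemma poly_growth_truncate_polydisc_algebra: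
  assumes F: "poly_growth d M F"
  shows "(\<lambda>z\<in>closed_polydisc. F (truncate m z)) \<in> polydisc_algebra"
proof (rule polydisc_algebra_restrictI)
  have "continuous_on UNIV F"
    using poly_growth_continuous[OF F] by (simp add: continuous_at_imp_continuous_on)
  then show "continuous_on closed_polydisc (\<lambda>z. F (truncate m z))"
    by (rule continuous_on_compose2[OF _ continuous_on_truncate]) simp
  fix z n
  let ?v = "if n < m then c0_unit n else 0"
  have eq: "truncate m (z(n := w)) = truncate m (z(n := 0)) + w *\<^sub>c ?v" for w
    by (rule c0_eqI) auto
  have "(\<lambda>w. F (truncate m (z(n := 0)) + w *\<^sub>c ?v)) holomorphic_on UNIV"
    using F unfolding poly_growth_def line_holomorphic_UNIV by blast
  then have "(\<lambda>w. F (truncate m (z(n := 0)) + w *\<^sub>c ?v)) holomorphic_on ball 0 1"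
    by (rule holomorphic_on_subset) simp
  then show "(\<lambda>w. F (truncate m (z(n := w)))) holomorphic_on ball 0 1"
    by (rule holomorphic_transform) (rule arg_cong[where f=F], rule eq[symmetric])
qed

section \<open>The ball algebra\<close>

text \<open>
  The homogeneous terms of the Taylor series at the origin. The coefficient depends only on small
  \<open>t\<close>, so it makes sense for all \<open>x\<close> although \<open>g\<close> matters only on the unit ball.
\<close>

definition homogeneous_part :: "(c0 \<Rightarrow> complex) \<Rightarrow> nat \<Rightarrow> c0 \<Rightarrow> complex" where
  "homogeneous_part g k x = taylor_coeff (\<lambda>t. g (t *\<^sub>c x)) k"

text \<open>
  Cauchy's estimate on the disc of radius \<open>1 / (1 + \<parallel>x\<parallel>)\<close>, where \<open>t x\<close> stays in the unit ball.
\<close>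

lemma poly_growth_homogeneous_part:
  assumes g: "line_holomorphic_on g (ball 0 1)" and M: "\<And>x. norm x < 1 \<Longrightarrow> norm (g x) \<le> M"
  shows "poly_growth k M (homogeneous_part g k)"
  unfolding poly_growth_def line_holomorphic_UNIV
proof (intro conjI allI)
  have ray: "(\<lambda>t. g (t *\<^sub>c x)) holomorphic_on ball 0 R" if "R * norm x \<le> 1" for x R
    using line_holomorphic_on_ball[OF g that] by simp
  have ray_bound: "norm (g (t *\<^sub>c x)) \<le> M" if "R * norm x \<le> 1" "norm t < R" for x t R
  proof (rule M)
    show "norm (t *\<^sub>c x) < 1"
    proof (cases "x = 0")
      case False
      then have "norm t * norm x < R * norm x" using that by simp
      then show ?thesis using that by (simp add: norm_scaleC_c0)
    qed simp
  qed
  fix x :: c0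
  have x: "1 + norm x > 0" using norm_ge_zero[of x] by linarith
  have xs: "1 / (1 + norm x) * norm x \<le> 1" using x by simp
  have "norm (homogeneous_part g k x) \<le> M / (1 / (1 + norm x)) ^ k"
    unfolding homogeneous_part_def by (rule norm_taylor_coeff_le[OF ray[OF xs] ray_bound[OF xs]]) (use x in auto)
  then show "norm (homogeneous_part g k x) \<le> M * (1 + norm x) ^ k" by (simp add: power_divide)
  fix v
  have "(\<lambda>t. homogeneous_part g k (x + t *\<^sub>c v)) holomorphic_on ball 0 B" if B: "B > 0" for B
  proof -
    define R where "R = 1 / (1 + norm x + B * norm v)"
    have den: "1 + norm x + B * norm v > 0" using x B by (intro add_pos_nonneg) auto
    have R: "R > 0" using den by (simp add: R_def)
    have small: "R * norm (x + t *\<^sub>c v) \<le> 1" if "norm t < B" for t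
    proof -
      have "norm (x + t *\<^sub>c v) \<le> norm x + norm t * norm v"
        using norm_triangle_ineq[of x "t *\<^sub>c v"] by (simp add: norm_scaleC_c0)
      also have "\<dots> \<le> norm x + B * norm v" using that by (intro add_mono mult_right_mono) auto
      finally show ?thesis using den by (simp add: R_def)
    qed
    show ?thesis
      unfolding homogeneous_part_def
    proof (rule holomorphic_taylor_coeff_parameter[OF _ R])
      show "(\<lambda>s. g (s *\<^sub>c (x + t *\<^sub>c v))) holomorphic_on ball 0 R" if "t \<in> ball 0 B" for t
        using that by (intro ray small) simp
      show "norm (g (s *\<^sub>c (x + t *\<^sub>c v))) \<le> M" if "t \<in> ball 0 B" "norm s < R" for t s
        using that by (intro ray_bound[where R=R] small) auto
      show "(\<lambda>t. g (s *\<^sub>c (x + t *\<^sub>c v))) holomorphic_on ball 0 B" if s: "norm s < R" for s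
      proof -
        have eq: "s *\<^sub>c (x + t *\<^sub>c v) = s *\<^sub>c x + t *\<^sub>c (s *\<^sub>c v)" for t
          by (simp add: scaleC_c0_add mult.commute)
        have "(\<lambda>t. g (s *\<^sub>c x + t *\<^sub>c (s *\<^sub>c v))) holomorphic_on {t. s *\<^sub>c x + t *\<^sub>c (s *\<^sub>c v) \<in> ball 0 1}"
          using g unfolding line_holomorphic_on_def by blast
        moreover have "ball 0 B \<subseteq> {t. s *\<^sub>c x + t *\<^sub>c (s *\<^sub>c v) \<in> ball 0 1}"
        proof
          fix t :: complex assume "t \<in> ball 0 B"
          then have t: "norm t < B" by simp
          have "norm (s *\<^sub>c (x + t *\<^sub>c v)) < 1"
          proof (cases "x + t *\<^sub>c v = 0")
            case False
            then have "norm s * norm (x + t *\<^sub>c v) < R * norm (x + t *\<^sub>c v)" using s by simp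
            then show ?thesis using small[OF t] by (simp add: norm_scaleC_c0)
          qed simp
          then show "t \<in> {t. s *\<^sub>c x + t *\<^sub>c (s *\<^sub>c v) \<in> ball 0 1}" unfolding eq by simp
        qed
        ultimately show ?thesis unfolding eq by (rule holomorphic_on_subset)
      qed
    qed simp
  qed
  then have "(\<lambda>t. homogeneous_part g k (x + t *\<^sub>c v)) field_differentiable at t" for t
    using holomorphic_on_imp_differentiable_at[of _ "ball 0 (norm t + 1)" t] by (simp add: add_nonneg_pos)
  then show "(\<lambda>t. homogeneous_part g k (x + t *\<^sub>c v)) holomorphic_on UNIV"
    by (simp add: holomorphic_on_def field_differentiable_at_within)
qed

text \<open>
  Go from the origin to a point of the ball in a fixed number of short steps.
\<close>

lemma uniformly_continuous_on_ball_bounded: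
  fixes g :: "c0 \<Rightarrow> complex"
  assumes g: "uniformly_continuous_on (ball 0 1) g"
  shows "\<exists>M>0. \<forall>x\<in>ball 0 1. norm (g x) \<le> M"
proof -
  obtain d where d: "d > 0" and unif: "\<And>x y. x \<in> ball 0 1 \<Longrightarrow> y \<in> ball 0 1 \<Longrightarrow> norm (y - x) < d \<Longrightarrow> norm (g y - g x) < 1"
    using g unfolding uniformly_continuous_on_def dist_norm by (metis zero_less_one)
  obtain N :: nat where N: "inverse (real (Suc N)) < d" using reals_Archimedean[OF d] by blast
  have "norm (g x) \<le> norm (g 0) + real (Suc N)" if x: "x \<in> ball 0 1" for x
  proof -
    define p where "p j = (real j / real (Suc N)) *\<^sub>R x" for j
    have p_in: "p j \<in> ball 0 1" if "j \<le> Suc N" for j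
    proof -
      have "norm (p j) \<le> 1 * norm x"
        unfolding p_def norm_scaleR using that by (intro mult_right_mono) auto
      then show ?thesis using x by simp
    qed
    have "j \<le> Suc N \<Longrightarrow> norm (g (p j) - g 0) \<le> real j" for j
    proof (induction j)
      case (Suc j)
      have "p (Suc j) - p j = inverse (real (Suc N)) *\<^sub>R x"
        unfolding p_def scaleR_diff_left[symmetric] by (simp add: field_simps diff_divide_distrib[symmetric])
      then have "norm (p (Suc j) - p j) \<le> inverse (real (Suc N)) * 1"
        using x by (simp only: norm_scaleR) (intro mult_mono, auto)
      then have "norm (g (p (Suc j)) - g (p j)) < 1"
        using N Suc.prems by (intro unif p_in) auto
      then show ?case
        using Suc norm_triangle_ineq[of "g (p (Suc j)) - g (p j)" "g (p j) - g 0"] by simp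
    qed (simp add: p_def)
    from this[of "Suc N"] have "norm (g x - g 0) \<le> real (Suc N)" by (simp add: p_def del: of_nat_Suc)
    then show ?thesis using norm_triangle_sub[of "g x" "g 0"] by linarith
  qed
  then show ?thesis by (intro exI[of _ "norm (g 0) + real (Suc N)"]) (auto intro: add_nonneg_pos)
qed

text \<open>
  Three approximations: \<open>g x\<close> by \<open>g (r x)\<close> with \<open>r < 1\<close>, using uniform continuity; this by a Taylor
  polynomial, with geometric remainder; and its homogeneous parts by their values at truncations of
  \<open>x\<close>, which extend to the closed polydisc.
\<close>

theorem ball_algebra_approx:
  assumes g: "g \<in> ball_algebra" and e: "e > 0"
  shows "\<exists>f\<in>polydisc_algebra. \<forall>x\<in>ball 0 1. norm (g x - f (c0_nth x)) \<le> e"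
proof -
  have uc: "uniformly_continuous_on (ball 0 1) g" using g by (simp add: ball_algebra_def)
  have lh: "line_holomorphic_on g (ball 0 1)"
    using g by (intro complex_frechet_line_holomorphic) (auto simp: ball_algebra_def)
  obtain M where M: "M > 0" "\<And>x. norm x < 1 \<Longrightarrow> norm (g x) \<le> M"
    using uniformly_continuous_on_ball_bounded[OF uc] by auto
  have e3: "e / 3 > 0" using e by simp
  obtain d where d: "d > 0" and unif: "\<And>x y. x \<in> ball 0 1 \<Longrightarrow> y \<in> ball 0 1 \<Longrightarrow> norm (y - x) < d \<Longrightarrow> norm (g y - g x) < e / 3"
    using uc e3 unfolding uniformly_continuous_on_def dist_norm by metis
  define r where "r = max (1/2) (1 - d/2)"
  have r: "0 < r" "r < 1" "1 - r < d" using d by (auto simp: r_def)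
  have "(\<lambda>n. M * r ^ n / (1 - r)) \<longlonglongrightarrow> M * 0 / (1 - r)"
    using r by (intro tendsto_intros LIMSEQ_power_zero) auto
  then have "(\<lambda>n. M * r ^ n / (1 - r)) \<longlonglongrightarrow> 0" by simp
  from order_tendstoD(2)[OF this e3] obtain n where n: "M * r ^ n / (1 - r) < e / 3"
    by (auto simp: eventually_sequentially)
  let ?P = "homogeneous_part g"
  note P = poly_growth_homogeneous_part[OF lh M(2)]
  define e' where "e' = e / (3 * real (Suc n))"
  have e': "e' > 0" using e by (simp add: e'_def)
  have "\<forall>k. \<exists>m0. \<forall>m\<ge>m0. \<forall>x. norm x \<le> 1 \<longrightarrow> norm (?P k x - ?P k (truncate m (c0_nth x))) \<le> e'"
    using poly_growth_truncation[OF P e'] by blast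
  then obtain m0 where m0: "\<And>k m x. m \<ge> m0 k \<Longrightarrow> norm x \<le> 1 \<Longrightarrow> norm (?P k x - ?P k (truncate m (c0_nth x))) \<le> e'"
    by metis
  define m where "m = (\<Sum>k<n. m0 k)"
  have m: "m \<ge> m0 k" if "k < n" for k
    unfolding m_def using that by (intro member_le_sum) auto
  define f where "f = (\<lambda>z\<in>closed_polydisc. \<Sum>k<n. (\<lambda>z\<in>closed_polydisc. of_real (r ^ k) *
    (\<lambda>z\<in>closed_polydisc. ?P k (truncate m z)) z) z)"
  have "f \<in> polydisc_algebra"
    unfolding f_def
    by (intro polydisc_algebra_sum polydisc_algebra_scale poly_growth_truncate_polydisc_algebra[OF P]) auto
  moreover have "norm (g x - f (c0_nth x)) \<le> e" if x: "x \<in> ball 0 1" for x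
  proof -
    have xn: "norm x < 1" using x by simp
    have rx: "norm (of_real r *\<^sub>c x) < 1"
      using xn r mult_strict_mono[of r 1 "norm x" 1] by (simp add: norm_scaleC_c0)
    have "norm (x - of_real r *\<^sub>c x) < d"
    proof -
      have "x - of_real r *\<^sub>c x = of_real (1 - r) *\<^sub>c x"
        by (rule c0_eqI) (simp add: algebra_simps)
      then have "norm (x - of_real r *\<^sub>c x) = (1 - r) * norm x"
        using r by (simp only: norm_scaleC_c0 norm_of_real)
      also have "\<dots> \<le> 1 - r" using xn r by (intro mult_left_le) auto
      finally show ?thesis using r by linarith
    qed
    then have 1: "norm (g x - g (of_real r *\<^sub>c x)) \<le> e / 3"
      using unif[of "of_real r *\<^sub>c x" x] rx x by simp
    have "norm (g (of_real r *\<^sub>c x) - (\<Sum>k<n. ?P k x * of_real r ^ k))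
        \<le> M * (norm (of_real r :: complex) / 1) ^ n / (1 - norm (of_real r :: complex) / 1)"
      unfolding homogeneous_part_def
    proof (rule norm_taylor_remainder_le)
      show "(\<lambda>t. g (t *\<^sub>c x)) holomorphic_on ball 0 1"
        using line_holomorphic_on_ball[OF lh, of 1 x] xn by simp
      show "norm (g (w *\<^sub>c x)) \<le> M" if "norm w < 1" for w
        using that xn mult_strict_mono[of "norm w" 1 "norm x" 1] by (intro M(2)) (simp add: norm_scaleC_c0)
    qed (use r in auto)
    then have 2: "norm (g (of_real r *\<^sub>c x) - (\<Sum>k<n. ?P k x * of_real r ^ k)) \<le> e / 3"
    proof -
      assume "norm (g (of_real r *\<^sub>c x) - (\<Sum>k<n. ?P k x * of_real r ^ k))
        \<le> M * (norm (of_real r :: complex) / 1) ^ n / (1 - norm (of_real r :: complex) / 1)"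
      then have "norm (g (of_real r *\<^sub>c x) - (\<Sum>k<n. ?P k x * of_real r ^ k)) \<le> M * r ^ n / (1 - r)"
        using r by simp
      with n show ?thesis by linarith
    qed
    have fx: "f (c0_nth x) = (\<Sum>k<n. ?P k (truncate m (c0_nth x)) * of_real r ^ k)"
      using c0_nth_closed_polydisc[of x] xn by (simp add: f_def mult.commute)
    have "norm ((\<Sum>k<n. ?P k x * of_real r ^ k) - f (c0_nth x)) \<le> (\<Sum>k<n. e')"
      unfolding fx sum_subtractf[symmetric] left_diff_distrib[symmetric]
    proof (rule sum_norm_le)
      fix k assume "k \<in> {..<n}"
      then have k: "k < n" by simp
      have "norm ((?P k x - ?P k (truncate m (c0_nth x))) * of_real r ^ k) \<le> e' * 1"
        unfolding norm_mult using m0[OF m[OF k], of x] xn r e'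
        by (intro mult_mono) (auto simp: norm_power power_le_one)
      then show "norm ((?P k x - ?P k (truncate m (c0_nth x))) * of_real r ^ k) \<le> e'" by simp
    qed
    also have "\<dots> \<le> e / 3"
    proof -
      have "real n * e' \<le> real (Suc n) * e'" using e' by (intro mult_right_mono) auto
      also have "\<dots> = e / 3" by (simp add: e'_def del: of_nat_Suc)
      finally show ?thesis by simp
    qed
    finally have 3: "norm ((\<Sum>k<n. ?P k x * of_real r ^ k) - f (c0_nth x)) \<le> e / 3" .
    have "g x - f (c0_nth x) = (g x - g (of_real r *\<^sub>c x)) + (g (of_real r *\<^sub>c x) - (\<Sum>k<n. ?P k x * of_real r ^ k))
        + ((\<Sum>k<n. ?P k x * of_real r ^ k) - f (c0_nth x))" by simp
    also have "norm \<dots> \<le> e / 3 + e / 3 + e / 3"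
      by (intro norm_triangle_le add_mono 1 2 3)
    finally show ?thesis by simp
  qed
  ultimately show ?thesis by blast
qed

lemma line_holomorphic_on_c0_nth:
  assumes "f \<in> polydisc_algebra"
  shows "line_holomorphic_on (\<lambda>x. f (c0_nth x)) (ball 0 1)"
  using assms
proof (induction rule: polydisc_algebra_induct)
  have mem: "c0_nth y \<in> closed_polydisc" if "y \<in> ball 0 1" for y
    using that by (intro c0_nth_closed_polydisc) simp
  {
    case (const c)
    show ?case unfolding line_holomorphic_on_def
      by (intro allI holomorphic_transform[OF holomorphic_on_const[of c]]) (use mem in auto)
  next
    case (add f g)
    show ?case unfolding line_holomorphic_on_def
    proof (intro allI)
      fix x v
      have "(\<lambda>t. f (c0_nth (x + t *\<^sub>c v)) + g (c0_nth (x + t *\<^sub>c v))) holomorphic_on {t. x + t *\<^sub>c v \<in> ball 0 1}"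
        using add.IH unfolding line_holomorphic_on_def by (intro holomorphic_on_add) blast+
      then show "(\<lambda>t. (\<lambda>z\<in>closed_polydisc. f z + g z) (c0_nth (x + t *\<^sub>c v))) holomorphic_on {t. x + t *\<^sub>c v \<in> ball 0 1}"
        by (rule holomorphic_transform) (use mem in auto)
    qed
  next
    case (mult f i)
    show ?case unfolding line_holomorphic_on_def
    proof (intro allI)
      fix x v
      have "(\<lambda>t. f (c0_nth (x + t *\<^sub>c v)) * (c0_nth x i + t * c0_nth v i)) holomorphic_on {t. x + t *\<^sub>c v \<in> ball 0 1}"
        using mult.IH unfolding line_holomorphic_on_def by (intro holomorphic_intros) blast
      then show "(\<lambda>t. (\<lambda>z\<in>closed_polydisc. f z * z i) (c0_nth (x + t *\<^sub>c v))) holomorphic_on {t. x + t *\<^sub>c v \<in> ball 0 1}"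
        by (rule holomorphic_transform) (use mem in auto)
    qed
  next
    case (limit f)
    show ?case unfolding line_holomorphic_on_def
    proof (intro allI holomorphic_on_uniform_approx open_cline open_ball)
      fix x v and e :: real assume "e > 0"
      from limit(2)[OF this] obtain g where g: "line_holomorphic_on (\<lambda>x. g (c0_nth x)) (ball 0 1)"
        "\<forall>z\<in>closed_polydisc. norm (g z - f z) \<le> e" by blast
      show "\<exists>h. h holomorphic_on {t. x + t *\<^sub>c v \<in> ball 0 1} \<and>
          (\<forall>t\<in>{t. x + t *\<^sub>c v \<in> ball 0 1}. norm (h t - f (c0_nth (x + t *\<^sub>c v))) \<le> e)"
        by (rule exI[of _ "\<lambda>t. g (c0_nth (x + t *\<^sub>c v))"])
          (use g mem in \<open>auto simp: line_holomorphic_on_def\<close>)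
    qed
  }
qed

lemma pullback_c0_nth_ball_algebra:
  assumes f: "f \<in> polydisc_algebra"
  shows "pullback (ball 0 1) c0_nth f \<in> ball_algebra"
proof -
  have mem: "c0_nth y \<in> closed_polydisc" if "y \<in> ball 0 1" for y
    using that by (intro c0_nth_closed_polydisc) simp
  obtain M where M: "\<And>z. z \<in> closed_polydisc \<Longrightarrow> norm (f z) \<le> M"
    by (rule polydisc_algebra_bounded[OF f]) (rule that)
  let ?F = "pullback (ball 0 1) c0_nth f"
  have "uniformly_continuous_on (ball 0 1) ?F"
    unfolding uniformly_continuous_on_def dist_norm
  proof (intro allI impI)
    fix e :: real assume e: "e > 0"
    obtain m d where d: "d > 0" and unif0: "\<forall>x\<in>closed_polydisc. \<forall>y\<in>closed_polydisc.
        (\<forall>i<m. norm (x i - y i) < d) \<longrightarrow> norm (f x - f y) < e"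
      using closed_polydisc_uniform_continuity[OF polydisc_algebraD(2)[OF f] e] by blast
    have "norm (?F y - ?F x) < e" if "x \<in> ball 0 1" "y \<in> ball 0 1" "norm (y - x) < d" for x y
    proof -
      have "norm (c0_nth y i - c0_nth x i) < d" for i
        using norm_c0_nth_le[of "y - x" i] that(3) by simp
      then have "norm (f (c0_nth y) - f (c0_nth x)) < e"
        using unif0 mem that by blast
      then show ?thesis using that by (simp add: pullback_def)
    qed
    then show "\<exists>d>0. \<forall>x\<in>ball 0 1. \<forall>y\<in>ball 0 1. norm (y - x) < d \<longrightarrow> norm (?F y - ?F x) < e"
      using d by blast
  qed
  moreover have "complex_frechet_differentiable_at ?F x" if x: "x \<in> ball 0 1" for x
  proof -
    have sub: "ball x (1 - norm x) \<subseteq> ball 0 1"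
    proof
      fix y assume "y \<in> ball x (1 - norm x)"
      then show "y \<in> ball 0 1" using norm_triangle_ineq4[of x "x - y"] by (simp add: dist_norm)
    qed
    interpret bounded_line_holomorphic "\<lambda>x. f (c0_nth x)" x "1 - norm x" M
    proof
      show "line_holomorphic_on (\<lambda>x. f (c0_nth x)) (ball x (1 - norm x))"
        using line_holomorphic_on_c0_nth[OF f] sub by (rule line_holomorphic_on_subset)
      show "norm (f (c0_nth y)) \<le> M" if "y \<in> ball x (1 - norm x)" for y
        using that sub mem M by blast
    qed (use x in simp)
    obtain L where L: "((\<lambda>x. f (c0_nth x)) has_derivative L) (at x)" "\<forall>c v. L (c *\<^sub>c v) = c * L v"
      using complex_frechet_differentiable unfolding complex_frechet_differentiable_at_def by blast
    have "(?F has_derivative L) (at x)"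
      by (rule has_derivative_transform_within_open[OF L(1) open_ball x]) (simp add: pullback_def)
    then show ?thesis using L(2) unfolding complex_frechet_differentiable_at_def by blast
  qed
  ultimately show ?thesis by (simp add: ball_algebra_def pullback_def)
qed

text \<open>
  Shrunk truncations of \<open>z\<close> lie in the ball and are close to \<open>z\<close> in the finitely many coordinates that
  matter.
\<close>

lemma ball_norming:
  assumes f: "f \<in> polydisc_algebra" and C: "\<And>x. x \<in> ball 0 1 \<Longrightarrow> norm (f (c0_nth x)) \<le> C"
    and z: "z \<in> closed_polydisc"
  shows "norm (f z) \<le> C"
proof (rule field_le_epsilon)
  fix e :: real assume e: "e > 0"
  obtain m d where d: "d > 0" and unif0: "\<forall>x\<in>closed_polydisc. \<forall>y\<in>closed_polydisc.
      (\<forall>i<m. norm (x i - y i) < d) \<longrightarrow> norm (f x - f y) < e"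
    using closed_polydisc_uniform_continuity[OF polydisc_algebraD(2)[OF f] e] by blast
  define r where "r = max (1/2) (1 - d/2)"
  have r: "0 < r" "r < 1" "1 - r < d" using d by (auto simp: r_def)
  have zn: "norm (z i) \<le> 1" for i using z by (simp add: mem_closed_polydisc)
  define x where "x = truncate m (\<lambda>i. of_real r * z i)"
  have "norm x \<le> r"
    unfolding x_def using r zn by (intro norm_truncate_le) (auto simp: norm_mult mult_left_le)
  then have x: "norm x < 1" using r by simp
  have "norm (z i - c0_nth x i) < d" if "i < m" for i
  proof -
    have "z i - c0_nth x i = of_real (1 - r) * z i" using that by (simp add: x_def algebra_simps)
    then have "norm (z i - c0_nth x i) = (1 - r) * norm (z i)"
      using r by (simp only: norm_mult norm_of_real)
    also have "\<dots> \<le> 1 - r" using zn r by (intro mult_left_le) auto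
    finally show ?thesis using r by linarith
  qed
  then have "norm (f z - f (c0_nth x)) < e"
    using unif0 z c0_nth_closed_polydisc[of x] x by simp
  then show "norm (f z) \<le> C + e"
    using C[of x] x norm_triangle_sub[of "f z" "f (c0_nth x)"] by simp
qed

theorem norming_pullback_ball:
  "norming_pullback closed_polydisc polydisc_algebra (ball (0::c0) 1) ball_algebra c0_nth"
proof
  show "ball (0::c0) 1 \<noteq> {}" by simp
  show "closed_polydisc \<noteq> {}" by (rule closed_polydisc_nonempty)
  show "sup_banach_algebra closed_polydisc polydisc_algebra" by (rule sup_banach_algebra_polydisc_algebra)
  show "c0_nth x \<in> closed_polydisc" if "x \<in> ball 0 1" for x
    using that by (intro c0_nth_closed_polydisc) simp
  show "ball_algebra \<subseteq> extensional (ball 0 1)" by (auto simp: ball_algebra_def)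
  show "pullback (ball 0 1) c0_nth f \<in> ball_algebra" if "f \<in> polydisc_algebra" for f
    using that by (rule pullback_c0_nth_ball_algebra)
  show "norm (f s) \<le> C" if "f \<in> polydisc_algebra" "\<And>t. t \<in> ball 0 1 \<Longrightarrow> norm (f (c0_nth t)) \<le> C"
    "s \<in> closed_polydisc" for f C s
    using that by (rule ball_norming)
  show "\<exists>f\<in>polydisc_algebra. \<forall>t\<in>ball 0 1. norm (g t - f (c0_nth t)) \<le> e"
    if "g \<in> ball_algebra" "e > 0" for g e
    using that by (rule ball_algebra_approx)
qed

theorem theorem2p6:
  shows "sup_banach_algebra closed_polydisc polydisc_algebra \<and>
    sup_banach_algebra right_half_plane dirichlet_algebra \<and>
    sup_banach_algebra (ball (0::c0) 1) ball_algebra \<and>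
    (\<exists>\<Phi>. isometric_algebra_iso closed_polydisc polydisc_algebra
           right_half_plane dirichlet_algebra \<Phi>) \<and>
    (\<exists>\<Psi>. isometric_algebra_iso closed_polydisc polydisc_algebra
           (ball (0::c0) 1) ball_algebra \<Psi>)"
proof -
  interpret D: norming_pullback closed_polydisc polydisc_algebra right_half_plane dirichlet_algebra bohr_point
    by (rule norming_pullback_dirichlet)
  interpret B: norming_pullback closed_polydisc polydisc_algebra "ball (0::c0) 1" ball_algebra c0_nth
    by (rule norming_pullback_ball)
  show ?thesis
    using sup_banach_algebra_polydisc_algebra D.sup_banach_algebra_codomain B.sup_banach_algebra_codomain
      D.isometric_algebra_iso_pullback B.isometric_algebra_iso_pullback by blast
qed

end
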